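(* Let $d\ge 3$ and $\beta>0$, and let $U$ be a nonempty connected open subset of $[0,1)^d$ whose boundary is a smooth, closed, orientable surface. Then there exist positive constants $C(U,\beta)$ and $c(U,\beta)$ such that, for all large enough $n$, $$c(U,\beta)\, n^{\frac{d-1}{d}}\le \mathrm{Var}(N(U))\le C(U,\beta)\, n^{\frac{d-1}{d}}\log^{13} n .$$ The lower bound is in fact a corollary of the following stronger anti-concentration statement: there are constants $c>0$ and $p<1$, depending only on $U$ and $\beta$, such that for all large enough $n$, $$\mathbb{P}(a\le N(U)\le b)\le p$$ for any real numbers $a\le b$ with $b-a\le c\, n^{\frac{d-1}{2d}}$.
   Context: Dyadic cubes: for $k\ge 0$, $\mathcal{D}_k$ is the set of all cubes $\prod_{l=1}^d\left[\frac{i_l}{2^k},\frac{i_l+1}{2^k}\right)$ with $0\le i_1,\dots,i_d\le 2^k-1$. For distinct points $x,y\in[0,1)^d$ set $w(x,y)=2^{(d-2)(k-1)}$, where $k$ is the smallest integer such that $x$ and $y$ do not belong to the same cube of $\mathcal{D}_k$. For $\mathbf{x}=(x_1,\dots,x_n)\in([0,1)^d)^n$ let $H_n(\mathbf{x})=\sum_{i\ne j}w(x_i,x_j)$ (sum over ordered pairs). The hierarchical Coulomb gas of size $n$ at inverse temperature $\beta$ is the random vector $(X_1,\dots,X_n)$ in $([0,1)^d)^n$ with density $\frac1{Z(n,\beta)}\exp(-\beta H_n(\mathbf{x}))$ with respect to Lebesgue measure, where $Z(n,\beta)$ is the normalizing constant. $N(U)$ denotes the number of indices $i\le n$ with $X_i\in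 U$; $\mathbb{P}$ and $\mathrm{Var}$ refer to this measure. "Surface" means hypersurface in $\mathbb{R}^d$. The dimension $d$ is fixed, and constants may depend on it. *)

theory Defs
  imports "HOL-Probability.Probability"
begin

text \<open>
  The dimension \<open>d\<close> is \<open>CARD('d)\<close>, and coordinates are indexed by the type \<open>'d\<close>.
\<close>

section \<open>Smooth hypersurfaces\<close>

text \<open>
  \<open>Ck_on k W f\<close> is meant for open \<open>W\<close>: the function \<open>f\<close> is of class \<open>C\<^sup>k\<close> on \<open>W\<close>.
\<close>

fun Ck_on :: "nat \<Rightarrow> 'a::real_normed_vector set \<Rightarrow> ('a \<Rightarrow> 'b::real_normed_vector) \<Rightarrow> bool" where
  "Ck_on 0 W f \<longleftrightarrow> continuous_on W f"
| "Ck_on (Suc k) W f \<longleftrightarrow>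
     (\<forall>x\<in>W. f differentiable (at x)) \<and>
     (\<forall>v. Ck_on k W (\<lambda>x. frechet_derivative f (at x) v))"

definition smooth_fun_on :: "'a::real_normed_vector set \<Rightarrow> ('a \<Rightarrow> 'b::real_normed_vector) \<Rightarrow> bool" where
  "smooth_fun_on W f \<longleftrightarrow> (\<forall>k. Ck_on k W f)"

text \<open>
  A smooth (embedded, boundaryless) hypersurface is locally the zero set of a smooth
  real-valued function with nowhere vanishing differential.
\<close>

definition smooth_hypersurface :: "'a::euclidean_space set \<Rightarrow> bool" where
  "smooth_hypersurface S \<longleftrightarrow>
     (\<forall>p\<in>S. \<exists>W (f :: 'a \<Rightarrow> real).
        open W \<and> p \<in> W \<and> smooth_fun_on W f \<and>
        (\<forall>x\<in>W. \<exists>v. frechet_derivative f (at x) v \<noteq> 0) \<and>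
        S \<inter> W = {x \<in> W. f x = 0})"

text \<open>Tangent vectors are the velocities of smooth curves that stay in \<open>S\<close>.\<close>

definition tangent_vectors :: "'a::euclidean_space set \<Rightarrow> 'a \<Rightarrow> 'a set" where
  "tangent_vectors S p =
     {v. \<exists>\<gamma> \<epsilon>. \<epsilon> > 0 \<and> smooth_fun_on {-\<epsilon><..<\<epsilon>} \<gamma> \<and> \<gamma> ` {-\<epsilon><..<\<epsilon>} \<subseteq> S \<and>
           \<gamma> 0 = p \<and> (\<gamma> has_vector_derivative v) (at (0::real))}"

text \<open>
  Orientability of a smooth hypersurface in Euclidean space: existence of a continuous unit
  normal field.
\<close>

definition orientable_hypersurface :: "'a::euclidean_space set \<Rightarrow> bool" where
  "orientable_hypersurface S \<longleftrightarrow>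
     (\<exists>\<nu> :: 'a \<Rightarrow> 'a. continuous_on S \<nu> \<and>
        (\<forall>p\<in>S. norm (\<nu> p) = 1 \<and> (\<forall>v\<in>tangent_vectors S p. \<nu> p \<bullet> v = 0)))"


section \<open>The hierarchical Coulomb gas\<close>

definition unit_cube :: "(real^'d) set" where
  "unit_cube = {x. \<forall>l. 0 \<le> x $ l \<and> x $ l < 1}"

definition dyadic_cubes :: "nat \<Rightarrow> (real^'d) set set" where
  "dyadic_cubes k =
     {{x. \<forall>l. real (i l) / 2 ^ k \<le> x $ l \<and> x $ l < (real (i l) + 1) / 2 ^ k} | i :: 'd \<Rightarrow> nat.
        \<forall>l. i l < 2 ^ k}"

definition separation_level :: "real^'d \<Rightarrow> real^'d \<Rightarrow> nat" where
  "separation_level x y = (LEAST k. \<not> (\<exists>Q\<in>dyadic_cubes k. x \<in> Q \<and> y \<in> Q))"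

text \<open>
  The two subtractions on natural numbers do not truncate for \<open>d \<ge> 2\<close> and distinct points
  of the unit cube: such points lie in the only cube of level \<open>0\<close>, so the level is at
  least \<open>1\<close>.  The value on the diagonal is irrelevant, as it only matters on a null set
  of configurations.
\<close>

definition interaction :: "real^'d \<Rightarrow> real^'d \<Rightarrow> real" where
  "interaction x y = 2 ^ ((CARD('d) - 2) * (separation_level x y - 1))"

text \<open>Configurations of \<open>n\<close> points are indexed by \<open>{..<n}\<close>.\<close>

definition energy :: "nat \<Rightarrow> (nat \<Rightarrow> real^'d) \<Rightarrow> real" where
  "energy n x = (\<Sum>i<n. \<Sum>j\<in>{..<n} - {i}. interaction (x i) (x j))"

definition config_lebesgue :: "nat \<Rightarrow> (nat \<Rightarrow> real^'d) measure" where
  "config_lebesgue n = (\<Pi>\<^sub>M i\<in>{..<n}. restrict_space lborel unit_cube)"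

definition partition_function :: "'d::finite itself \<Rightarrow> nat \<Rightarrow> real \<Rightarrow> real" where
  "partition_function _ n \<beta> =
     (\<integral>x. exp (- \<beta> * energy n x) \<partial>(config_lebesgue n :: (nat \<Rightarrow> real^'d) measure))"

definition coulomb_gas :: "nat \<Rightarrow> real \<Rightarrow> (nat \<Rightarrow> real^'d::finite) measure" where
  "coulomb_gas n \<beta> =
     density (config_lebesgue n)
       (\<lambda>x. ennreal (exp (- \<beta> * energy n x) / partition_function TYPE('d::finite) n \<beta>))"

definition num_points :: "nat \<Rightarrow> (real^'d) set \<Rightarrow> (nat \<Rightarrow> real^'d) \<Rightarrow> real" where
  "num_points n U x = real (card {i. i < n \<and> x i \<in> U})"

end

theory Submission
  imports Defs "HOL-Real_Asymp.Real_Asymp"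
begin

text \<open>
  The interaction of two points is a telescoping sum of \<open>\<delta>\<^sub>k\<close> over the levels \<open>k\<close> at which the points share
  a dyadic cube, where \<open>\<delta>\<^sub>0 = 1\<close> and \<open>\<delta>\<^sub>k = \<theta>\<^sup>k - \<theta>\<^sup>k\<^sup>-\<^sup>1\<close> with \<open>\<theta> = 2\<^sup>d\<^sup>-\<^sup>2\<close>.  So the energy is, up to an additive
  constant, \<open>\<Sum>\<^sub>k \<delta>\<^sub>k \<Sum>\<^sub>Q N(Q)\<^sup>2\<close> over all cubes \<open>Q\<close>.  Keeping only the levels up to \<open>K\<close> makes the energy a
  function of the occupation numbers of the finitely many cubes of level \<open>K\<close>; the gas then becomes a
  finite Gibbs measure with weight \<open>exp (- \<beta> energy)\<close> divided by the factorials of the occupation numbers.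
  The expectation of any Borel function of \<open>N(U)\<close> under the gas is the limit, as \<open>K\<close> grows, of discrete
  expectations for the union of the level \<open>K\<close> cubes inside \<open>U\<close> (lemma
  \<open>gas_expectation_tendsto\<close>).  All estimates below are for the discrete model, uniformly in \<open>K\<close>.

  Log-concavity.  Conditionally on everything outside two sibling cubes, the occupation numbers of the
  siblings, with given sum \<open>s\<close>, have weight \<open>y(a) y(s - a)\<close>, where \<open>y\<close> is the partition function of a cube.
  That function arises from \<open>1/a!\<close> by alternately taking \<open>2\<^sup>d\<close>-fold convolutions and multiplying by the
  Gaussian factor \<open>exp (- \<beta> \<delta>\<^sub>k a\<^sup>2)\<close>.  Both operations preserve log-concavity, so \<open>y\<close> is a log-concave
  sequence times a Gaussian.  Hence the difference of two siblings has second moment at most a constant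
  (lemma \<open>sibling_diff\<close>), and at most the expected number of points of the pair once \<open>\<beta> \<delta>\<^sub>k\<close> is large.

  Symmetry.  Flipping binary digits inside one cube preserves the model.  Therefore \<open>N(A)\<close>, for a union
  \<open>A\<close> of cells, is its mean plus increments attached to the nodes of the tree, and increments of
  different nodes are uncorrelated.  A node contributes only if its cube meets both \<open>A\<close> and the
  complement of \<open>A\<close>.  There are \<open>O(2\<^sup>(\<^sup>d\<^sup>-\<^sup>1\<^sup>)\<^sup>k)\<close> such cubes of level \<open>k\<close>, each contributes \<open>O(1)\<close> as long as its
  expected number of points is at least one, and below that level the contributions decay by the factor
  \<open>2\<^sup>-\<^sup>d\<close> per level.  Summation yields the bound \<open>C n\<^sup>(\<^sup>d\<^sup>-\<^sup>1\<^sup>)\<^sup>/\<^sup>d\<close> for the variance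
  (lemma \<open>surface_variance_bound\<close>), which implies the stated one.

  Anti-concentration.  A fixed number of levels below the one where the expected number of points is
  about one, a cube contains exactly one point with probability bounded below.  A positive fraction of the
  cubes near the boundary have one corner subcube inside \<open>U\<close> and the opposite corner subcube outside.
  Reflecting those cubes independently leaves the law unchanged and changes \<open>N(U)\<close> by a sum of
  independent signs, whose number of nonzero coefficients is of order \<open>n\<^sup>(\<^sup>d\<^sup>-\<^sup>1\<^sup>)\<^sup>/\<^sup>d\<close> with positive probability
  (lemma \<open>anticoncentration\<close>).  The lower bound for the variance follows.

  Geometry.  The upper bound for the number of cubes meeting the boundary follows from the mean value
  theorem in a finite cover by charts.  A piece of the boundary may lie in a dyadic hyperplane, where no cube
  straddles it; so the cubes for the lower bound are taken near a point of the closure of \<open>U\<close> at which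
  \<open>x\<^sub>1 + \<dots> + x\<^sub>d\<close> is maximal.  There the normal is a multiple of \<open>(1,\<dots>,1)\<close>, and the boundary crosses cubes
  transversally to all coordinate directions.
\<close>

section \<open>Log-concave sequences\<close>

text \<open>
  The condition for all \<open>i \<le> j\<close>, instead of only \<open>i + 1 = j\<close>, forbids internal zeros; without division
  it also covers sequences with finite support such as \<open>1, 0, 0, \<dots>\<close>.
\<close>

definition log_concave :: "(nat \<Rightarrow> real) \<Rightarrow> bool" where
  "log_concave f \<longleftrightarrow> (\<forall>i. 0 \<le> f i) \<and> (\<forall>i j. i \<le> j \<longrightarrow> f i * f (Suc j) \<le> f (Suc i) * f j)"

definition convolution :: "(nat \<Rightarrow> real) \<Rightarrow> (nat \<Rightarrow> real) \<Rightarrow> nat \<Rightarrow> real" where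
  "convolution f g n = (\<Sum>a\<le>n. f a * g (n - a))"

lemma log_concave_nonneg: "log_concave f \<Longrightarrow> 0 \<le> f i"
  by (auto simp: log_concave_def)

lemma log_concave_spread:
  assumes "log_concave f"
  shows "f u * f (u + s + t) \<le> f (u + s) * f (u + t)"
proof (induction s arbitrary: u t)
  case 0
  then show ?case by simp
next
  case (Suc s)
  show ?case
  proof (cases t)
    case 0 then show ?thesis by (simp add: mult.commute)
  next
    case (Suc t')
    have "f u * f (Suc (u + s + t)) \<le> f (Suc u) * f (u + s + t)"
      using assms unfolding log_concave_def by (meson le_add1 le_trans)
    then show ?thesis using Suc.IH[of "Suc u" t'] Suc by simp
  qed
qed

text \<open>
  This is the Cauchy-Binet formula for two-by-two minors.  The minor of the convolution is a double sum
  of a product of a minor of \<open>f\<close> and an antisymmetric minor \<open>B\<close> of \<open>g\<close>; after symmetrisation both factors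
  of each summand have the same sign.
\<close>

lemma log_concave_convolution:
  assumes f: "log_concave f" and g: "log_concave g"
  shows "log_concave (convolution f g)"
  unfolding log_concave_def
proof (intro conjI allI impI)
  fix i show "0 \<le> convolution f g i"
    unfolding convolution_def by (intro sum_nonneg mult_nonneg_nonneg log_concave_nonneg f g)
next
  fix i j :: nat assume ij: "i \<le> j"
  \<comment> \<open>Extension by zero, and the shift of \<open>g\<close> by one, let all four convolutions be sums over \<open>{..Suc j}\<close>.\<close>
  define F where "F c x = (if x \<le> c then f (c - x) else 0)" for c x
  define G where "G x = (if x = 0 then 0 else g (x - 1))" for x
  define B where "B x y = g x * G y - G x * g y" for x y
  have conv1: "convolution f g c = (\<Sum>x\<le>Suc j. F c x * g x)" if "c \<le> Suc j" for c
  proof -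
    have "(\<Sum>x\<le>Suc j. F c x * g x) = (\<Sum>x\<le>c. f (c - x) * g x)"
      using that by (intro sum.mono_neutral_cong_right) (auto simp: F_def)
    also have "\<dots> = convolution f g c"
      unfolding convolution_def by (rule sum.reindex_bij_witness[of _ "\<lambda>a. c - a" "\<lambda>a. c - a"]) auto
    finally show ?thesis by simp
  qed
  have conv2: "convolution f g c = (\<Sum>x\<le>Suc j. F (Suc c) x * G x)" if "c \<le> j" for c
  proof -
    have "convolution f g c = (\<Sum>x\<le>c. f (c - x) * g x)"
      unfolding convolution_def by (rule sum.reindex_bij_witness[of _ "\<lambda>a. c - a" "\<lambda>a. c - a"]) auto
    also have "\<dots> = (\<Sum>x\<in>{1..Suc c}. F (Suc c) x * G x)"
      by (rule sum.reindex_bij_witness[of _ "\<lambda>x. x - 1" Suc]) (auto simp: F_def G_def)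
    also have "\<dots> = (\<Sum>x\<le>Suc j. F (Suc c) x * G x)"
      using that by (intro sum.mono_neutral_left) (auto simp: F_def G_def)
    finally show ?thesis .
  qed
  have Bpos: "0 \<le> B x y" if "x \<le> y" for x y
  proof (cases x)
    case 0 then show ?thesis using log_concave_nonneg[OF g] by (auto simp: B_def G_def)
  next
    case (Suc x')
    with that have "y \<noteq> 0" by simp
    then obtain y' where y': "y = Suc y'" using not0_implies_Suc by blast
    have "x' \<le> y'" using Suc y' that by simp
    then have "g x' * g (Suc y') \<le> g (Suc x') * g y'" using g by (auto simp: log_concave_def)
    then show ?thesis using Suc y' by (simp add: B_def G_def)
  qed
  have Banti: "B y x = - B x y" for x y by (simp add: B_def)
  define P where "P x y = F (Suc i) x * F (Suc j) y" for x y
  have Ppos: "P y x \<le> P x y" if xy: "x \<le> y" for x y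
  proof (cases "y \<le> Suc i")
    case True
    then obtain u where u: "Suc i = y + u" using le_Suc_ex[OF True] by blast
    obtain s where s: "y = x + s" using le_Suc_ex[OF xy] by blast
    obtain t where t: "j = i + t" using le_Suc_ex[OF ij] by blast
    have "f u * f (u + s + t) \<le> f (u + s) * f (u + t)" by (rule log_concave_spread[OF f])
    moreover have "Suc i - y = u" "Suc j - x = u + s + t" "Suc i - x = u + s" "Suc j - y = u + t"
      using u s t by simp_all
    ultimately show ?thesis using True xy ij by (simp add: P_def F_def)
  next
    case False
    then show ?thesis using log_concave_nonneg[OF f] by (auto simp: P_def F_def)
  qed
  \<comment> \<open>Twice the minor, so that each summand can be paired with the one for the exchanged indices.\<close>
  have "2 * (convolution f g (Suc i) * convolution f g j - convolution f g i * convolution f g (Suc j))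
      = 2 * ((\<Sum>x\<le>Suc j. F (Suc i) x * g x) * (\<Sum>y\<le>Suc j. F (Suc j) y * G y)
           - (\<Sum>x\<le>Suc j. F (Suc i) x * G x) * (\<Sum>y\<le>Suc j. F (Suc j) y * g y))"
    using conv1[of "Suc i"] conv1[of "Suc j"] conv2[of i] conv2[of j] ij by simp
  also have "\<dots> = 2 * (\<Sum>x\<le>Suc j. \<Sum>y\<le>Suc j. P x y * B x y)"
    unfolding sum_product sum_subtractf[symmetric]
    by (intro arg_cong[where f="\<lambda>z. 2 * z"] sum.cong refl) (simp add: P_def B_def algebra_simps)
  also have "\<dots> = (\<Sum>x\<le>Suc j. \<Sum>y\<le>Suc j. P x y * B x y) + (\<Sum>x\<le>Suc j. \<Sum>y\<le>Suc j. P y x * B y x)"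
    by (subst (3) sum.swap) simp
  also have "\<dots> = (\<Sum>x\<le>Suc j. \<Sum>y\<le>Suc j. (P x y - P y x) * B x y)"
    unfolding sum.distrib[symmetric] by (intro sum.cong refl) (simp add: B_def algebra_simps)
  also have "\<dots> \<ge> 0"
  proof (intro sum_nonneg)
    fix x y
    show "0 \<le> (P x y - P y x) * B x y"
    proof (cases "x \<le> y")
      case True then show ?thesis using Ppos[OF True] Bpos[OF True] by simp
    next
      case False
      then have "y \<le> x" by simp
      from Ppos[OF this] Bpos[OF this] show ?thesis by (simp add: Banti[of y x] mult_nonpos_nonpos)
    qed
  qed
  finally show "convolution f g i * convolution f g (Suc j) \<le> convolution f g (Suc i) * convolution f g j" by simp
qed

text \<open>
  The Gaussian is itself log-concave, because \<open>(j + 1)\<^sup>2 - j\<^sup>2\<close> increases with \<open>j\<close>.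
\<close>

lemma log_concave_gaussian_mult:
  assumes f: "log_concave f" and c: "0 \<le> c"
  shows "log_concave (\<lambda>a. exp (- c * (real a)\<^sup>2) * f a)"
  unfolding log_concave_def
proof (intro conjI allI impI)
  fix i show "0 \<le> exp (- c * (real i)\<^sup>2) * f i" using log_concave_nonneg[OF f] by simp
next
  fix i j :: nat assume ij: "i \<le> j"
  have "exp (- c * (real i)\<^sup>2) * exp (- c * (real (Suc j))\<^sup>2) \<le> exp (- c * (real (Suc i))\<^sup>2) * exp (- c * (real j)\<^sup>2)"
  proof -
    have "(real (Suc i))\<^sup>2 + (real j)\<^sup>2 \<le> (real i)\<^sup>2 + (real (Suc j))\<^sup>2"
      using ij by (simp add: power2_eq_square algebra_simps)
    then have "c * ((real (Suc i))\<^sup>2 + (real j)\<^sup>2) \<le> c * ((real i)\<^sup>2 + (real (Suc j))\<^sup>2)"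
      using c by (rule mult_left_mono)
    then show ?thesis unfolding exp_add[symmetric] by (simp add: algebra_simps)
  qed
  moreover have "f i * f (Suc j) \<le> f (Suc i) * f j" using f ij by (auto simp: log_concave_def)
  ultimately have "(exp (- c * (real i)\<^sup>2) * exp (- c * (real (Suc j))\<^sup>2)) * (f i * f (Suc j))
     \<le> (exp (- c * (real (Suc i))\<^sup>2) * exp (- c * (real j)\<^sup>2)) * (f (Suc i) * f j)"
    by (rule mult_mono) (intro mult_nonneg_nonneg log_concave_nonneg[OF f] exp_ge_zero)+
  then show "exp (- c * (real i)\<^sup>2) * f i * (exp (- c * (real (Suc j))\<^sup>2) * f (Suc j))
     \<le> exp (- c * (real (Suc i))\<^sup>2) * f (Suc i) * (exp (- c * (real j)\<^sup>2) * f j)"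
    by (simp only: ac_simps)
qed

lemma log_concave_inverse_fact: "log_concave (\<lambda>a. 1 / fact a)"
  unfolding log_concave_def
proof (intro conjI allI impI)
  fix i j :: nat assume "i \<le> j"
  have "1 / fact i * (1 / fact (Suc j)) = 1 / (fact i * fact j) * (1 / real (Suc j))" by (simp add: field_simps)
  also have "\<dots> \<le> 1 / (fact i * fact j) * (1 / real (Suc i))"
    using \<open>i \<le> j\<close> by (intro mult_left_mono frac_le) auto
  also have "\<dots> = 1 / fact (Suc i) * (1 / fact j)" by (simp add: field_simps)
  finally show "1 / fact i * (1 / fact (Suc j)) \<le> 1 / fact (Suc i) * (1 / fact j :: real)" .
qed simp

text \<open>
  Up to a factor, this series bounds the second moment of the discrete Gaussian with ratio \<open>r\<close>.
\<close>

definition sq_geom :: "real \<Rightarrow> real" where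
  "sq_geom r = (\<Sum>k. (real k + 1)\<^sup>2 * r ^ k)"

lemma summable_sq_geom:
  assumes "0 < r" "r < 1"
  shows "summable (\<lambda>k. (real k + 1)\<^sup>2 * r ^ k)"
proof (rule summable_comparison_test_bigo)
  show "summable (\<lambda>n. norm (1 / real n ^ 2))" using inverse_power_summable[of 2, where 'a=real] by (simp add: divide_inverse power_inverse)
  show "(\<lambda>k. (real k + 1)\<^sup>2 * r ^ k) \<in> O(\<lambda>n. 1 / real n ^ 2)"
    using assms by real_asymp
qed

lemma sq_geom_le_2:
  assumes "0 < r" "r \<le> 1/8"
  shows "sq_geom r \<le> 2"
proof -
  have le: "(real k + 1)\<^sup>2 * r ^ k \<le> (4 * r) ^ k" for k
  proof -
    have "real k + 1 \<le> 2 ^ k" using less_exp[of k]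
      by (metis Suc_leI add.commute of_nat_Suc of_nat_le_iff of_nat_numeral of_nat_power plus_1_eq_Suc)
    then have "(real k + 1)\<^sup>2 \<le> (2 ^ k)\<^sup>2" by (intro power_mono) auto
    also have "(2 ^ k)\<^sup>2 = (4::real) ^ k" by (simp add: power2_eq_square flip: power_mult_distrib)
    finally show ?thesis using assms by (simp add: power_mult_distrib)
  qed
  have "sq_geom r \<le> (\<Sum>k. (4 * r) ^ k)"
    unfolding sq_geom_def
    by (intro suminf_le le summable_sq_geom summable_geometric) (use assms in auto)
  also have "\<dots> = 1 / (1 - 4 * r)" using assms by (subst suminf_geometric) auto
  also have "\<dots> \<le> 2" using assms by (simp add: field_simps)
  finally show ?thesis .
qed

lemma sum_abs_centered_le:
  fixes g :: "nat \<Rightarrow> real"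
  assumes "\<And>k. 0 \<le> g k"
  shows "(\<Sum>a\<le>s. g (nat \<bar>2 * int a - int s\<bar>)) \<le> 2 * (\<Sum>k\<le>s. g k)"
proof -
  let ?t = "\<lambda>a. nat \<bar>2 * int a - int s\<bar>"
  have half: "(\<Sum>a\<in>A. g (?t a)) \<le> (\<Sum>k\<le>s. g k)" if "inj_on ?t A" "A \<subseteq> {..s}" for A
  proof -
    have "(\<Sum>a\<in>A. g (?t a)) = sum g (?t ` A)" using that by (simp add: sum.reindex o_def)
    also have "\<dots> \<le> sum g {..s}" using that assms by (intro sum_mono2) auto
    finally show ?thesis .
  qed
  have "{..s} = {a. a \<le> s \<and> 2 * a \<ge> s} \<union> {a. a \<le> s \<and> 2 * a < s}" by auto
  then have "(\<Sum>a\<le>s. g (?t a)) = (\<Sum>a\<in>{a. a \<le> s \<and> 2 * a \<ge> s}. g (?t a)) + (\<Sum>a\<in>{a. a \<le> s \<and> 2 * a < s}. g (?t a))"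
    by (simp only:) (rule sum.union_disjoint, auto)
  also have "\<dots> \<le> sum g {..s} + sum g {..s}"
  proof (intro add_mono half)
    show "inj_on ?t {a. a \<le> s \<and> 2 * a \<ge> s}" by (rule inj_on_inverseI[of _ "\<lambda>k. (s + k) div 2"]) auto
    show "inj_on ?t {a. a \<le> s \<and> 2 * a < s}"
    proof (rule inj_onI)
      fix x y assume "x \<in> {a. a \<le> s \<and> 2 * a < s}" "y \<in> {a. a \<le> s \<and> 2 * a < s}" "?t x = ?t y"
      then have "2 * int x - int s = 2 * int y - int s" by (simp add: eq_nat_nat_iff)
      then show "x = y" by simp
    qed
  qed auto
  finally show ?thesis by simp
qed

text \<open>
  The weight \<open>y(a) y(s - a)\<close> is a Gaussian in the difference \<open>t = 2 a - s\<close> times a symmetric function that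
  decreases away from the centre.  Comparing every term with the central one, where \<open>\<bar>t\<bar>\<close> is the parity of
  \<open>s\<close>, leaves the second moment of a discrete Gaussian.  For a narrow Gaussian the difference is
  essentially \<open>0\<close> or \<open>\<plusminus>1\<close>, whose square is at most \<open>s\<close>.
\<close>

lemma gaussian_log_concave_pair:
  assumes u: "log_concave u" and r: "r = exp (- c / 2)" and c: "0 < c" and y: "y = (\<lambda>a. exp (- c * (real a)\<^sup>2) * u a)"
  shows "(\<Sum>a\<le>s. y a * y (s - a) * (real a - real (s - a))\<^sup>2)
           \<le> 2 * sq_geom r * (\<Sum>a\<le>s. y a * y (s - a))"
    and "sq_geom r \<le> 2 \<Longrightarrow> r \<le> 1/2 \<Longrightarrow>
         (\<Sum>a\<le>s. y a * y (s - a) * (real a - real (s - a))\<^sup>2) \<le> (\<Sum>a\<le>s. y a * y (s - a) * real s)"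
proof -
  have r01: "0 < r" "r < 1" using r c by auto
  define p where "p a = y a * y (s - a)" for a
  define a0 where "a0 = s div 2"
  define t where "t a = nat \<bar>2 * int a - int s\<bar>" for a
  define b where "b = s mod 2"
  have un: "0 \<le> u a" for a by (rule log_concave_nonneg[OF u])
  have yn: "0 \<le> y a" for a using un by (simp add: y)
  have pn: "0 \<le> p a" for a by (simp add: p_def yn)
  have t2: "(real a - real (s - a))\<^sup>2 = (real (t a))\<^sup>2" if "a \<le> s" for a
    using that by (simp add: t_def of_nat_diff)
  have p_t: "p a = exp (- c * (real s)\<^sup>2 / 2) * exp (- c * (real (t a))\<^sup>2 / 2) * (u a * u (s - a))" if "a \<le> s" for a
  proof -
    have "(real a)\<^sup>2 + (real (s - a))\<^sup>2 = ((real s)\<^sup>2 + (real (t a))\<^sup>2) / 2"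
      using that t2[OF that, symmetric] by (simp add: of_nat_diff power2_eq_square field_simps)
    then have "- c * ((real a)\<^sup>2 + (real (s - a))\<^sup>2) = - c * (((real s)\<^sup>2 + (real (t a))\<^sup>2) / 2)"
      by (simp only:)
    then have "- c * (real a)\<^sup>2 + - c * (real (s - a))\<^sup>2 = - c * (real s)\<^sup>2 / 2 + - c * (real (t a))\<^sup>2 / 2"
      by (simp add: distrib_left add_divide_distrib)
    then have "exp (- c * (real a)\<^sup>2) * exp (- c * (real (s - a))\<^sup>2) = exp (- c * (real s)\<^sup>2 / 2) * exp (- c * (real (t a))\<^sup>2 / 2)"
      unfolding exp_add[symmetric] by simp
    then show ?thesis by (simp add: p_def y)
  qed
  have ta0: "t a0 = b" "a0 \<le> s"
  proof -
    have "2 * a0 + b = s" by (simp add: a0_def b_def)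
    then have "2 * int a0 - int s = - int b" by linarith
    then show "t a0 = b" by (simp add: t_def)
  qed (simp add: a0_def)
  have h: "u a * u (s - a) \<le> u a0 * u (s - a0)" if "a \<le> s" for a
  proof -
    have *: "u a * u (s - a) \<le> u a0 * u (s - a0)" if "2 * a \<le> s" for a
    proof -
      have "u a * u (a + (a0 - a) + (s - a0 - a)) \<le> u (a + (a0 - a)) * u (a + (s - a0 - a))"
        by (rule log_concave_spread[OF u])
      moreover have "a + (a0 - a) = a0" "a + (s - a0 - a) = s - a0" "a + (a0 - a) + (s - a0 - a) = s - a"
        using that by (auto simp: a0_def)
      ultimately show ?thesis by simp
    qed
    show ?thesis
    proof (cases "2 * a \<le> s")
      case False
      then show ?thesis using *[of "s - a"] \<open>a \<le> s\<close> by (simp add: mult.commute)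
    qed (rule *)
  qed
  have p_le: "p a \<le> exp (- c * ((real (t a))\<^sup>2 - (real b)\<^sup>2) / 2) * p a0" if "a \<le> s" for a
  proof -
    have "exp (- c * (real (t a))\<^sup>2 / 2) = exp (- c * ((real (t a))\<^sup>2 - (real b)\<^sup>2) / 2) * exp (- c * (real b)\<^sup>2 / 2)"
      unfolding exp_add[symmetric] by (simp add: right_diff_distrib diff_divide_distrib)
    then have "p a = exp (- c * ((real (t a))\<^sup>2 - (real b)\<^sup>2) / 2) * (exp (- c * (real s)\<^sup>2 / 2) * exp (- c * (real b)\<^sup>2 / 2) * (u a * u (s - a)))"
      by (simp add: p_t[OF that] ac_simps)
    also have "\<dots> \<le> exp (- c * ((real (t a))\<^sup>2 - (real b)\<^sup>2) / 2) * (exp (- c * (real s)\<^sup>2 / 2) * exp (- c * (real b)\<^sup>2 / 2) * (u a0 * u (s - a0)))"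
      by (intro mult_left_mono h that) auto
    finally show ?thesis using p_t[OF ta0(2)] ta0 by simp
  qed
  \<comment> \<open>For even \<open>s\<close> the central difference is \<open>0\<close>, which gains one more factor \<open>r\<close>.\<close>
  define e where "e = (if b = 0 then r else 1)"
  define g where "g k = (if k = 0 then 0 else (real k)\<^sup>2 * r ^ (k - 1))" for k
  have pt_le: "p a * (real (t a))\<^sup>2 \<le> e * p a0 * g (t a)" if "a \<le> s" for a
  proof (cases "t a = 0")
    case True then show ?thesis by (simp add: g_def)
  next
    case False
    then obtain k where k: "t a = Suc k" using not0_implies_Suc by auto
    have "exp (- c * ((real (t a))\<^sup>2 - (real b)\<^sup>2) / 2) \<le> e * r ^ k"
    proof -
      have "k * 1 \<le> (t a)\<^sup>2 - 1" using k by (simp add: power2_eq_square)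
      then have kk: "real k \<le> (real (t a))\<^sup>2 - 1" using k
        by (simp add: power2_eq_square algebra_simps)
      have "b = 0 \<or> b = 1" by (auto simp: b_def)
      then have "e = exp (- c / 2 * (1 - (real b)\<^sup>2))" by (auto simp: e_def r)
      moreover have "r ^ k = exp (- c / 2 * real k)"
        using exp_of_nat_mult[of k "- c / 2"] by (simp add: r mult.commute)
      ultimately have "e * r ^ k = exp (- c / 2 * (real k + (1 - (real b)\<^sup>2)))"
        by (simp only: exp_add[symmetric] distrib_left add.commute)
      moreover have "- c * ((real (t a))\<^sup>2 - (real b)\<^sup>2) / 2 \<le> - c / 2 * (real k + (1 - (real b)\<^sup>2))"
      proof -
        have "c / 2 * (real k + (1 - (real b)\<^sup>2)) \<le> c / 2 * ((real (t a))\<^sup>2 - (real b)\<^sup>2)"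
          using kk c by (intro mult_left_mono) auto
        then show ?thesis by simp
      qed
      ultimately show ?thesis by simp
    qed
    then have "p a \<le> e * r ^ k * p a0" using p_le[OF that] pn[of a0]
      by (meson mult_right_mono order_trans)
    then have "p a * (real (t a))\<^sup>2 \<le> e * r ^ k * p a0 * (real (t a))\<^sup>2" by (intro mult_right_mono) auto
    then show ?thesis using k by (simp add: g_def ac_simps)
  qed
  have gn: "0 \<le> g k" for k using r01 by (simp add: g_def)
  have gs: "(\<Sum>k\<le>s. g k) \<le> sq_geom r"
  proof -
    have "(\<Sum>k\<le>s. g k) = (\<Sum>k<s. g (Suc k))" by (simp add: sum.atMost_shift g_def)
    also have "\<dots> = (\<Sum>k<s. (real k + 1)\<^sup>2 * r ^ k)" by (intro sum.cong) (auto simp: g_def add.commute)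
    also have "\<dots> \<le> sq_geom r" unfolding sq_geom_def
      using r01 by (intro sum_le_suminf summable_sq_geom) auto
    finally show ?thesis .
  qed
  have e0: "0 \<le> e" using r01 by (simp add: e_def)
  have main: "(\<Sum>a\<le>s. y a * y (s - a) * (real a - real (s - a))\<^sup>2) \<le> e * p a0 * (2 * sq_geom r)"
  proof -
    have "(\<Sum>a\<le>s. y a * y (s - a) * (real a - real (s - a))\<^sup>2) = (\<Sum>a\<le>s. p a * (real (t a))\<^sup>2)"
      by (intro sum.cong refl) (use t2 in \<open>auto simp: p_def\<close>)
    also have "\<dots> \<le> (\<Sum>a\<le>s. e * p a0 * g (t a))" by (intro sum_mono pt_le) auto
    also have "\<dots> = e * p a0 * (\<Sum>a\<le>s. g (t a))" by (simp add: sum_distrib_left)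
    also have "\<dots> \<le> e * p a0 * (2 * sq_geom r)"
      using sum_abs_centered_le[of g s] gs gn e0 pn[of a0] by (intro mult_left_mono) (auto simp: t_def)
    finally show ?thesis .
  qed
  have sg0: "0 \<le> sq_geom r" using gs gn by (meson order_trans sum_nonneg)
  have Z0: "p a0 \<le> (\<Sum>a\<le>s. p a)" using ta0 pn by (intro member_le_sum) auto
  have Z1: "2 * p a0 \<le> (\<Sum>a\<le>s. p a)" if "b = 1"
  proof -
    have s: "s = 2 * a0 + 1" using that unfolding a0_def b_def by presburger
    have "p (Suc a0) = p a0" by (simp add: p_def s mult.commute)
    moreover have "sum p {a0, Suc a0} \<le> sum p {..s}" using s pn by (intro sum_mono2) auto
    ultimately show ?thesis by simp
  qed
  show "(\<Sum>a\<le>s. y a * y (s - a) * (real a - real (s - a))\<^sup>2) \<le> 2 * sq_geom r * (\<Sum>a\<le>s. y a * y (s - a))"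
  proof -
    have "e \<le> 1" using r01 by (simp add: e_def)
    then have "e * p a0 \<le> (\<Sum>a\<le>s. p a)" using Z0 pn[of a0] e0 by (meson mult_left_le_one_le order_trans)
    then have "e * p a0 * (2 * sq_geom r) \<le> (\<Sum>a\<le>s. p a) * (2 * sq_geom r)"
      using sg0 by (intro mult_right_mono) auto
    then have "e * p a0 * (2 * sq_geom r) \<le> 2 * sq_geom r * (\<Sum>a\<le>s. y a * y (s - a))"
      by (simp only: p_def mult.commute)
    with main show ?thesis by (rule order_trans)
  qed
  assume G: "sq_geom r \<le> 2" and rh: "r \<le> 1/2"
  have fin: "(\<Sum>a\<le>s. y a * y (s - a) * (real a - real (s - a))\<^sup>2) \<le> (\<Sum>a\<le>s. y a * y (s - a) * real s)" if "e * p a0 * (2 * sq_geom r) \<le> (\<Sum>a\<le>s. p a) * real s"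
    using order_trans[OF main that] unfolding p_def sum_distrib_right .
  consider "s = 0" | "s = 1" | "b = 1" "s \<ge> 3" | "b = 0" "s \<ge> 2" 
  proof -
    have "b = 0 \<or> b = 1" by (auto simp: b_def)
    moreover have "b = 0" if "s = 2" using that by (simp add: b_def)
    ultimately show ?thesis using that by (cases "s \<ge> 3"; cases "s = 0"; cases "s = 1"; cases "s = 2") auto
  qed
  then show "(\<Sum>a\<le>s. y a * y (s - a) * (real a - real (s - a))\<^sup>2) \<le> (\<Sum>a\<le>s. y a * y (s - a) * real s)"
  proof cases
    case 1 then show ?thesis by simp
  next
    case 2 then show ?thesis by (simp add: atMost_Suc)
  next
    case 3
    have "e * p a0 * (2 * sq_geom r) = (2 * p a0) * sq_geom r" using 3 by (simp add: e_def)
    also have "\<dots> \<le> (\<Sum>a\<le>s. p a) * real s"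
      using Z1 3 G sg0 pn by (intro mult_mono sum_nonneg) auto
    finally show ?thesis by (rule fin)
  next
    case 4
    have "e * p a0 * (2 * sq_geom r) = p a0 * (r * (2 * sq_geom r))" using 4 by (simp add: e_def)
    also have "r * (2 * sq_geom r) \<le> 1/2 * (2 * 2)" using G rh r01 sg0 by (intro mult_mono) auto
    then have "p a0 * (r * (2 * sq_geom r)) \<le> (\<Sum>a\<le>s. p a) * real s"
      using Z0 4 pn sg0 r01 by (intro mult_mono sum_nonneg) auto
    finally show ?thesis by (rule fin)
  qed
qed

section \<open>Occupation vectors on the dyadic tree\<close>

text \<open>
  A cell of level \<open>k\<close> is given by its integer coordinates; the ancestor \<open>j\<close> levels up drops the last
  \<open>j\<close> binary digits of each coordinate.
\<close>

definition cells :: "nat \<Rightarrow> ('d::finite \<Rightarrow> nat) set" where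
  "cells k = {i. \<forall>l. i l < 2 ^ k}"

definition anc :: "nat \<Rightarrow> ('d \<Rightarrow> nat) \<Rightarrow> 'd \<Rightarrow> nat" where
  "anc j i = (\<lambda>l. i l div 2 ^ j)"

definition leaves :: "nat \<Rightarrow> nat \<Rightarrow> ('d::finite \<Rightarrow> nat) \<Rightarrow> ('d \<Rightarrow> nat) set" where
  "leaves K k q = {i \<in> cells K. anc (K - k) i = q}"

lemma cells_PiE: "cells k = PiE UNIV (\<lambda>_. {..<2 ^ k})"
  by (auto simp: cells_def)

lemma finite_cells [simp]: "finite (cells k)"
  by (simp add: cells_PiE finite_PiE)

lemma card_cells: "card (cells k :: ('d::finite \<Rightarrow> nat) set) = 2 ^ (k * CARD('d))"
  by (simp add: cells_PiE card_PiE power_mult)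

lemma cells_0 [simp]: "cells 0 = {\<lambda>_. 0}"
  by (auto simp: cells_def)

lemma anc_0 [simp]: "anc 0 i = i"
  by (simp add: anc_def)

lemma anc_anc: "anc j (anc j' i) = anc (j + j') i"
  by (simp add: anc_def power_add flip: div_mult2_eq) (simp add: mult.commute)

lemma anc_in_cells: "i \<in> cells (k + j) \<Longrightarrow> anc j i \<in> cells k"
  by (auto simp: cells_def anc_def power_add less_mult_imp_div_less)

lemma anc_in_cells': "i \<in> cells K \<Longrightarrow> k \<le> K \<Longrightarrow> anc (K - k) i \<in> cells k"
  using anc_in_cells[of i k "K - k"] by simp

lemma finite_leaves [simp]: "finite (leaves K k q)"
  by (simp add: leaves_def)

lemma leaves_subset: "leaves K k q \<subseteq> cells K"
  by (auto simp: leaves_def)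

lemma leaves_PiE:
  assumes "q \<in> cells k" "k \<le> K"
  shows "leaves K k q = PiE UNIV (\<lambda>l. {q l * 2 ^ (K - k) ..< (q l + 1) * 2 ^ (K - k)})"
proof -
  have "i l < 2 ^ K" if "i l div 2 ^ (K - k) = q l" for i :: "'a \<Rightarrow> nat" and l
  proof -
    have "i l div 2 ^ (K - k) < 2 ^ k" using that assms by (simp add: cells_def)
    then have "i l < 2 ^ k * 2 ^ (K - k)" by (simp add: div_less_iff_less_mult)
    then show ?thesis using assms by (simp flip: power_add)
  qed
  moreover have "i l div 2 ^ (K - k) = q l \<longleftrightarrow> q l * 2 ^ (K - k) \<le> i l \<and> i l < (q l + 1) * 2 ^ (K - k)" for i :: "'a \<Rightarrow> nat" and l
  proof -
    have "i l div 2 ^ (K - k) = q l \<longleftrightarrow> q l \<le> i l div 2 ^ (K - k) \<and> i l div 2 ^ (K - k) < q l + 1" by auto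
    then show ?thesis by (simp only: less_eq_div_iff_mult_less_eq[OF zero_less_power[OF zero_less_numeral]] div_less_iff_less_mult[OF zero_less_power[OF zero_less_numeral]])
  qed
  ultimately show ?thesis
    by (auto simp: leaves_def cells_def anc_def fun_eq_iff PiE_def Pi_def)
qed

lemma card_leaves:
  assumes "q \<in> cells k" "k \<le> K"
  shows "card (leaves K k (q :: 'd::finite \<Rightarrow> nat)) = 2 ^ ((K - k) * CARD('d))"
proof -
  have "card (leaves K k q) = (\<Prod>l\<in>(UNIV::'d set). 2 ^ (K - k))"
    unfolding leaves_PiE[OF assms] by (subst card_PiE) auto
  then show ?thesis by (simp add: power_mult)
qed

lemma leaves_disjoint: "q \<noteq> q' \<Longrightarrow> leaves K k q \<inter> leaves K k q' = {}"
  by (auto simp: leaves_def)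

lemma leaves_UN: "k \<le> K \<Longrightarrow> (\<Union>q\<in>cells k. leaves K k q) = cells K"
  by (auto simp: leaves_def anc_in_cells')

lemma leaves_self: "q \<in> cells K \<Longrightarrow> leaves K K q = {q}"
  by (auto simp: leaves_def)

lemma leaves_UN_leaves:
  assumes "k \<le> k'" "k' \<le> K"
  shows "(\<Union>q'\<in>leaves k' k q. leaves K k' q') = leaves K k q"
proof -
  have "anc (k' - k) (anc (K - k') i) = anc (K - k) i" for i :: "'a \<Rightarrow> nat"
    using assms by (simp add: anc_anc)
  then show ?thesis using assms by (auto simp: leaves_def anc_in_cells')
qed

text \<open>
  Distributions of \<open>n\<close> indistinguishable points over \<open>P\<close>.  Fixing the value \<open>0\<close> outside \<open>P\<close> makes addition
  of functions a bijection in lemma \<open>sum_occupations_Un\<close>.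
\<close>

definition occupations :: "'a set \<Rightarrow> nat \<Rightarrow> ('a \<Rightarrow> nat) set" where
  "occupations P n = {m. (\<forall>i. i \<notin> P \<longrightarrow> m i = 0) \<and> sum m P = n}"

lemma finite_occupations [simp]:
  assumes "finite P" shows "finite (occupations P n)"
proof (rule finite_subset)
  show "occupations P n \<subseteq> {m. \<forall>i. (i \<in> P \<longrightarrow> m i \<in> {..n}) \<and> (i \<notin> P \<longrightarrow> m i = 0)}"
    using assms by (auto simp: occupations_def intro: member_le_sum)
  show "finite \<dots>" using assms by (intro finite_set_of_finite_funs) auto
qed

lemma sum_occupations_Un:
  fixes F :: "('a \<Rightarrow> nat) \<Rightarrow> real"
  assumes P: "finite P" and R: "finite R" and PR: "P \<inter> R = {}"
  shows "(\<Sum>m\<in>occupations (P \<union> R) n. F m) = (\<Sum>a\<le>n. \<Sum>m1\<in>occupations P a. \<Sum>m2\<in>occupations R (n - a). F (\<lambda>i. m1 i + m2 i))"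
proof -
  have "(\<Sum>a\<le>n. \<Sum>m1\<in>occupations P a. \<Sum>m2\<in>occupations R (n - a). F (\<lambda>i. m1 i + m2 i))
      = (\<Sum>a\<le>n. \<Sum>z\<in>occupations P a \<times> occupations R (n - a). F (\<lambda>i. fst z i + snd z i))"
    by (simp add: sum.cartesian_product case_prod_beta)
  also have "\<dots> = (\<Sum>z\<in>(SIGMA a:{..n}. occupations P a \<times> occupations R (n - a)). F (\<lambda>i. fst (snd z) i + snd (snd z) i))"
    using P R by (subst sum.Sigma) (auto simp: case_prod_beta)
  also have "\<dots> = (\<Sum>m\<in>occupations (P \<union> R) n. F m)"
  proof (rule sum.reindex_bij_witness[of _ "\<lambda>m. (sum m P, (\<lambda>i. if i \<in> P then m i else 0), (\<lambda>i. if i \<in> R then m i else 0))"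
        "\<lambda>z i. fst (snd z) i + snd (snd z) i"])
    fix z assume z: "z \<in> (SIGMA a:{..n}. occupations P a \<times> occupations R (n - a))"
    obtain a m1 m2 where zz: "z = (a, m1, m2)" by (metis prod.collapse)
    have 1: "a \<le> n" "\<And>i. i \<notin> P \<Longrightarrow> m1 i = 0" "sum m1 P = a" "\<And>i. i \<notin> R \<Longrightarrow> m2 i = 0" "sum m2 R = n - a"
      using z zz by (auto simp: occupations_def)
    have sP: "(\<Sum>i\<in>P. m1 i + m2 i) = a"
      using 1 PR by (subst 1(3)[symmetric], intro sum.cong) auto
    have sR: "(\<Sum>i\<in>R. m1 i + m2 i) = n - a"
      using 1 PR by (subst 1(5)[symmetric], intro sum.cong) auto
    have "(\<lambda>i. if i \<in> P then m1 i + m2 i else 0) = m1" "(\<lambda>i. if i \<in> R then m1 i + m2 i else 0) = m2"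
      using 1 PR by (auto simp: fun_eq_iff)
    then show "(sum (\<lambda>i. fst (snd z) i + snd (snd z) i) P, (\<lambda>i. if i \<in> P then fst (snd z) i + snd (snd z) i else 0),
         (\<lambda>i. if i \<in> R then fst (snd z) i + snd (snd z) i else 0)) = z"
      using sP by (simp only: zz fst_conv snd_conv)
    show "(\<lambda>i. fst (snd z) i + snd (snd z) i) \<in> occupations (P \<union> R) n"
      using 1 sP sR P R PR by (auto simp: zz occupations_def sum.union_disjoint)
  next
    fix m assume m: "m \<in> occupations (P \<union> R) n"
    have s: "sum m P + sum m R = n" using m P R PR by (simp add: occupations_def sum.union_disjoint)
    show "(sum m P, (\<lambda>i. if i \<in> P then m i else 0), (\<lambda>i. if i \<in> R then m i else 0)) \<in> (SIGMA a:{..n}. occupations P a \<times> occupations R (n - a))"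
      using s by (auto simp: occupations_def)
    show "(\<lambda>i. fst (snd (sum m P, (\<lambda>i. if i \<in> P then m i else 0), (\<lambda>i. if i \<in> R then m i else 0))) i +
       snd (snd (sum m P, (\<lambda>i. if i \<in> P then m i else 0), (\<lambda>i. if i \<in> R then m i else 0))) i) = m"
      using m PR by (auto simp: occupations_def fun_eq_iff)
  qed simp
  finally show ?thesis by simp
qed

definition pts :: "nat \<Rightarrow> nat \<Rightarrow> ('d::finite \<Rightarrow> nat) \<Rightarrow> (('d \<Rightarrow> nat) \<Rightarrow> nat) \<Rightarrow> nat" where
  "pts K k q m = sum m (leaves K k q)"

lemma pts_add: "pts K k q (\<lambda>i. m1 i + m2 i) = pts K k q m1 + pts K k q m2"
  by (simp add: pts_def sum.distrib)

lemma pts_self: "q \<in> cells K \<Longrightarrow> pts K K q m = m q"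
  by (simp add: pts_def leaves_self)

lemma pts_sum_leaves:
  assumes "k \<le> k'" "k' \<le> K"
  shows "(\<Sum>q'\<in>leaves k' k q. pts K k' q' m) = pts K k q m"
  unfolding pts_def leaves_UN_leaves[OF assms, symmetric]
  by (rule sum.UNION_disjoint[symmetric]) (auto simp: leaves_disjoint)

lemma pts_sum_cells:
  assumes "k \<le> K"
  shows "(\<Sum>q\<in>cells k. pts K k q m) = sum m (cells K)"
  unfolding pts_def leaves_UN[OF assms, symmetric]
  by (rule sum.UNION_disjoint[symmetric]) (auto simp: leaves_disjoint)

text \<open>
  The contribution of the levels \<open>k, \<dots>, K\<close>, which is the part that is additive over cubes of level \<open>k\<close>.
\<close>

definition fine_energy :: "(nat \<Rightarrow> real) \<Rightarrow> nat \<Rightarrow> nat \<Rightarrow> (('d::finite \<Rightarrow> nat) \<Rightarrow> nat) \<Rightarrow> real" where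
  "fine_energy \<kappa> K k m = (\<Sum>k'\<in>{k..K}. \<kappa> k' * (\<Sum>q\<in>cells k'. (real (pts K k' q m))\<^sup>2))"

definition fine_weight :: "(nat \<Rightarrow> real) \<Rightarrow> nat \<Rightarrow> nat \<Rightarrow> ('d::finite \<Rightarrow> nat) set \<Rightarrow> (('d \<Rightarrow> nat) \<Rightarrow> nat) \<Rightarrow> real" where
  "fine_weight \<kappa> K k P m = exp (- fine_energy \<kappa> K k m) / (\<Prod>i\<in>P. fact (m i))"

definition block_sum :: "(nat \<Rightarrow> real) \<Rightarrow> nat \<Rightarrow> nat \<Rightarrow> ('d::finite \<Rightarrow> nat) set \<Rightarrow> nat \<Rightarrow> real" where
  "block_sum \<kappa> K k P a = (\<Sum>m\<in>occupations P a. fine_weight \<kappa> K k P m)"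

definition node_union :: "nat \<Rightarrow> nat \<Rightarrow> ('d::finite \<Rightarrow> nat) set \<Rightarrow> ('d \<Rightarrow> nat) set" where
  "node_union K k X = (\<Union>q\<in>X. leaves K k q)"

lemma finite_node_union [simp]: "finite (node_union K k X)"
  by (rule finite_subset[of _ "cells K"]) (auto simp: node_union_def leaves_def)

lemma node_union_disjoint: "X \<inter> X' = {} \<Longrightarrow> node_union K k X \<inter> node_union K k X' = {}"
  by (auto simp: node_union_def leaves_def)

lemma node_union_Un: "node_union K k (X \<union> X') = node_union K k X \<union> node_union K k X'"
  by (auto simp: node_union_def)

lemma pts_outside:
  assumes "m \<in> occupations P a" "leaves K k q \<inter> P = {}"
  shows "pts K k q m = 0"
  using assms by (auto simp: pts_def occupations_def)

lemma pts_outside_union: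
  assumes m: "m \<in> occupations (node_union K k X) a" and "k \<le> k'" "k' \<le> K" "anc (k' - k) q \<notin> X"
  shows "pts K k' q m = 0"
proof (rule pts_outside[OF m])
  have "anc (k' - k) (anc (K - k') i) = anc (K - k) i" for i :: "'a \<Rightarrow> nat"
    using assms by (simp add: anc_anc)
  then show "leaves K k' q \<inter> node_union K k X = {}" using assms by (auto simp: node_union_def leaves_def)
qed

text \<open>
  Points in disjoint families of level \<open>k\<close> cubes share no cube of level \<open>k\<close> or finer.
\<close>

lemma fine_energy_add:
  assumes "m1 \<in> occupations (node_union K k X) a" "m2 \<in> occupations (node_union K k X') b" "X \<inter> X' = {}"
  shows "fine_energy \<kappa> K k (\<lambda>i. m1 i + m2 i) = fine_energy \<kappa> K k m1 + fine_energy \<kappa> K k m2"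
proof -
  have "(real (pts K k' q (\<lambda>i. m1 i + m2 i)))\<^sup>2 = (real (pts K k' q m1))\<^sup>2 + (real (pts K k' q m2))\<^sup>2"
    if "k' \<in> {k..K}" for k' q
  proof (cases "anc (k' - k) q \<in> X")
    case True
    then have "pts K k' q m2 = 0" using assms(2,3) that by (intro pts_outside_union[of m2 K k X' b]) auto
    then show ?thesis by (simp add: pts_add)
  next
    case False
    then have "pts K k' q m1 = 0" using assms(1,3) that by (intro pts_outside_union[of m1 K k X a]) auto
    then show ?thesis by (simp add: pts_add)
  qed
  then show ?thesis unfolding fine_energy_def sum.distrib[symmetric] distrib_left[symmetric]
    by (intro sum.cong refl arg_cong2[where f="(*)"]) auto
qed

lemma prod_fact_add:
  assumes "m1 \<in> occupations P a" "m2 \<in> occupations R b" "P \<inter> R = {}" "finite P" "finite R"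
  shows "(\<Prod>i\<in>P \<union> R. fact (m1 i + m2 i)) = (\<Prod>i\<in>P. fact (m1 i)) * (\<Prod>i\<in>R. fact (m2 i) :: real)"
proof -
  have "(\<Prod>i\<in>P. fact (m1 i + m2 i)) = (\<Prod>i\<in>P. fact (m1 i) :: real)"
    using assms by (intro prod.cong) (auto simp: occupations_def)
  moreover have "(\<Prod>i\<in>R. fact (m1 i + m2 i)) = (\<Prod>i\<in>R. fact (m2 i) :: real)"
    using assms by (intro prod.cong) (auto simp: occupations_def)
  ultimately show ?thesis using assms by (simp add: prod.union_disjoint)
qed

lemma fine_weight_add:
  assumes "m1 \<in> occupations (node_union K k X) a" "m2 \<in> occupations (node_union K k X') b" "X \<inter> X' = {}"
  shows "fine_weight \<kappa> K k (node_union K k X \<union> node_union K k X') (\<lambda>i. m1 i + m2 i)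
       = fine_weight \<kappa> K k (node_union K k X) m1 * fine_weight \<kappa> K k (node_union K k X') m2"
  using fine_energy_add[OF assms] prod_fact_add[OF assms(1,2) node_union_disjoint[OF assms(3)]]
  by (simp add: fine_weight_def exp_diff exp_minus field_simps exp_add)

primrec convolution_pow :: "(nat \<Rightarrow> real) \<Rightarrow> nat \<Rightarrow> nat \<Rightarrow> real" where
  "convolution_pow f 0 = (\<lambda>a. if a = 0 then 1 else 0)"
| "convolution_pow f (Suc r) = convolution f (convolution_pow f r)"

lemma log_concave_convolution_pow: "log_concave f \<Longrightarrow> log_concave (convolution_pow f r)"
  by (induction r) (auto simp: log_concave_convolution, auto simp: log_concave_def)

lemma block_sum_node_union:
  fixes X :: "('d::finite \<Rightarrow> nat) set"
  assumes "finite X" "\<And>q. q \<in> X \<Longrightarrow> block_sum \<kappa> K k (leaves K k q) = y"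
  shows "block_sum \<kappa> K k (node_union K k X) = convolution_pow y (card X)"
  using assms
proof (induction X rule: finite_induct)
  case empty
  have "occupations ({} :: ('d \<Rightarrow> nat) set) a = (if a = 0 then {\<lambda>_. 0} else {})" for a :: nat by (auto simp: occupations_def)
  then show ?case by (simp add: block_sum_def node_union_def fun_eq_iff fine_weight_def fine_energy_def pts_def)
next
  case (insert q X)
  have nu: "node_union K k {q} = leaves K k q" by (simp add: node_union_def)
  have d: "{q} \<inter> X = {}" using insert by auto
  show ?case
  proof
    fix n
    have "block_sum \<kappa> K k (node_union K k (insert q X)) n
        = (\<Sum>m\<in>occupations (node_union K k {q} \<union> node_union K k X) n. fine_weight \<kappa> K k (node_union K k {q} \<union> node_union K k X) m)"
      using node_union_Un[of K k "{q}" X] by (simp add: block_sum_def)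
    also have "\<dots> = (\<Sum>a\<le>n. \<Sum>m1\<in>occupations (node_union K k {q}) a. \<Sum>m2\<in>occupations (node_union K k X) (n - a).
          fine_weight \<kappa> K k (node_union K k {q} \<union> node_union K k X) (\<lambda>i. m1 i + m2 i))"
      by (rule sum_occupations_Un) (use node_union_disjoint[OF d] in auto)
    also have "\<dots> = (\<Sum>a\<le>n. \<Sum>m1\<in>occupations (node_union K k {q}) a. \<Sum>m2\<in>occupations (node_union K k X) (n - a).
          fine_weight \<kappa> K k (node_union K k {q}) m1 * fine_weight \<kappa> K k (node_union K k X) m2)"
      by (intro sum.cong refl fine_weight_add d)
    also have "\<dots> = convolution (block_sum \<kappa> K k (leaves K k q)) (block_sum \<kappa> K k (node_union K k X)) n"
      by (simp add: convolution_def block_sum_def sum_product nu)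
    finally show "block_sum \<kappa> K k (node_union K k (insert q X)) n = convolution_pow y (card (insert q X)) n"
      using insert by simp
  qed
qed

text \<open>
  The partition function of a cube of height \<open>j\<close> above the leaves, without the factor
  \<open>exp (- \<kappa> a\<^sup>2)\<close> of the cube itself; \<open>M\<close> is the number of children.
\<close>

primrec node_partition :: "nat \<Rightarrow> (nat \<Rightarrow> real) \<Rightarrow> nat \<Rightarrow> nat \<Rightarrow> nat \<Rightarrow> real" where
  "node_partition M \<kappa> K 0 = (\<lambda>a. 1 / fact a)"
| "node_partition M \<kappa> K (Suc j) = convolution_pow (\<lambda>a. exp (- \<kappa> (K - j) * (real a)\<^sup>2) * node_partition M \<kappa> K j a) M"

lemma log_concave_node_inner:
  assumes "\<And>k. 0 \<le> \<kappa> k"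
  shows "log_concave (node_partition M \<kappa> K j)"
  by (induction j) (simp_all only: node_partition.simps log_concave_inverse_fact log_concave_convolution_pow log_concave_gaussian_mult[OF _ assms])

lemma fine_energy_Suc:
  assumes "k < K"
  shows "fine_energy \<kappa> K k m = \<kappa> k * (\<Sum>q\<in>cells k. (real (pts K k q m))\<^sup>2) + fine_energy \<kappa> K (Suc k) m"
  using assms unfolding fine_energy_def by (simp add: sum.atLeast_Suc_atMost)

lemma block_sum_leaves:
  fixes q :: "'d::finite \<Rightarrow> nat"
  assumes "j \<le> K" "q \<in> cells (K - j)"
  shows "block_sum \<kappa> K (K - j) (leaves K (K - j) q) a = exp (- \<kappa> (K - j) * (real a)\<^sup>2) * node_partition (2 ^ CARD('d)) \<kappa> K j a"
  using assms
proof (induction j arbitrary: q a)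
  case 0
  define m0 where "m0 = (\<lambda>i. if i = q then a else 0)"
  have "occupations {q} a = {m0}" by (auto simp: occupations_def m0_def)
  moreover have "fine_energy \<kappa> K K m0 = \<kappa> K * (real a)\<^sup>2"
  proof -
    have "(\<Sum>q'\<in>cells K. (real (pts K K q' m0))\<^sup>2) = (\<Sum>q'\<in>cells K. if q' = q then (real a)\<^sup>2 else 0)"
      by (intro sum.cong refl) (auto simp: pts_self m0_def)
    also have "\<dots> = (real a)\<^sup>2" using 0 by simp
    finally show ?thesis by (simp add: fine_energy_def)
  qed
  ultimately show ?case using 0 by (simp add: block_sum_def leaves_self fine_weight_def) (simp add: m0_def)
next
  case (Suc j)
  define k where "k = K - Suc j"
  have k: "K - j = Suc k" "k < K" "K - Suc j = k" using Suc.prems by (auto simp: k_def)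
  have ch: "leaves (Suc k) k q \<subseteq> cells (Suc k)" by (rule leaves_subset)
  have U: "leaves K k q = node_union K (Suc k) (leaves (Suc k) k q)"
    unfolding node_union_def using k by (subst leaves_UN_leaves) auto
  have "block_sum \<kappa> K k (leaves K k q) a = exp (- \<kappa> k * (real a)\<^sup>2) * block_sum \<kappa> K (Suc k) (leaves K k q) a"
  proof -
    have "fine_weight \<kappa> K k (leaves K k q) m = exp (- \<kappa> k * (real a)\<^sup>2) * fine_weight \<kappa> K (Suc k) (leaves K k q) m"
      if m: "m \<in> occupations (leaves K k q) a" for m
    proof -
      have "(\<Sum>q'\<in>cells k. (real (pts K k q' m))\<^sup>2) = (\<Sum>q'\<in>cells k. if q' = q then (real a)\<^sup>2 else 0)"
      proof (intro sum.cong refl)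
        fix q' :: "'d \<Rightarrow> nat"
        show "(real (pts K k q' m))\<^sup>2 = (if q' = q then (real a)\<^sup>2 else 0)"
        proof (cases "q' = q")
          case True then show ?thesis using m by (auto simp: pts_def occupations_def)
        next
          case False then show ?thesis using pts_outside[OF m leaves_disjoint] by auto
        qed
      qed
      also have "\<dots> = (real a)\<^sup>2" using Suc.prems k by simp
      finally have "fine_energy \<kappa> K k m = \<kappa> k * (real a)\<^sup>2 + fine_energy \<kappa> K (Suc k) m" using k by (simp add: fine_energy_Suc)
      then show ?thesis by (simp add: fine_weight_def exp_add[symmetric])
    qed
    then show ?thesis by (simp add: block_sum_def sum_distrib_left)
  qed
  also have "block_sum \<kappa> K (Suc k) (leaves K k q) = convolution_pow (\<lambda>a. exp (- \<kappa> (K - j) * (real a)\<^sup>2) * node_partition (2 ^ CARD('d)) \<kappa> K j a) (card (leaves (Suc k) k q))"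
    unfolding U by (rule block_sum_node_union) (use Suc.IH Suc.prems ch k in \<open>auto simp: fun_eq_iff\<close>)
  also have "card (leaves (Suc k) k q) = 2 ^ CARD('d)"
    using card_leaves[of q k "Suc k"] Suc.prems k by simp
  finally show ?case using k by simp
qed

definition gibbs_weight :: "(nat \<Rightarrow> real) \<Rightarrow> nat \<Rightarrow> (('d::finite \<Rightarrow> nat) \<Rightarrow> nat) \<Rightarrow> real" where
  "gibbs_weight \<kappa> K m = fine_weight \<kappa> K 0 (cells K) m"

definition gibbs_sum :: "(nat \<Rightarrow> real) \<Rightarrow> nat \<Rightarrow> nat \<Rightarrow> ((('d::finite \<Rightarrow> nat) \<Rightarrow> nat) \<Rightarrow> real) \<Rightarrow> real" where
  "gibbs_sum \<kappa> K n F = (\<Sum>m\<in>occupations (cells K) n. gibbs_weight \<kappa> K m * F m)"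

definition node_sequence :: "nat \<Rightarrow> (nat \<Rightarrow> real) \<Rightarrow> nat \<Rightarrow> nat \<Rightarrow> nat \<Rightarrow> real" where
  "node_sequence M \<kappa> K k a = exp (- \<kappa> k * (real a)\<^sup>2) * node_partition M \<kappa> K (K - k) a"

text \<open>
  Splitting the occupation vector into the parts inside the first sibling, inside the second one and
  outside, the coarse levels see the siblings only through the number \<open>s\<close> of points in both.  So the
  expectation is a mixture, over the outside configuration, of sums with weights \<open>y(a) y(s - a)\<close>.
\<close>

lemma sibling_comparison:
  fixes q1 q2 :: "'d::finite \<Rightarrow> nat"
  assumes k: "k < K" and q: "q1 \<in> cells (Suc k)" "q2 \<in> cells (Suc k)" "q1 \<noteq> q2" "anc 1 q1 = anc 1 q2"
    and y: "y = node_sequence (2 ^ CARD('d)) \<kappa> K (Suc k)"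
    and le: "\<And>s. (\<Sum>a\<le>s. y a * y (s - a) * \<phi> a (s - a)) \<le> (\<Sum>a\<le>s. y a * y (s - a) * \<psi> a (s - a))"
  shows "gibbs_sum \<kappa> K n (\<lambda>m. \<phi> (pts K (Suc k) q1 m) (pts K (Suc k) q2 m))
       \<le> gibbs_sum \<kappa> K n (\<lambda>m. \<psi> (pts K (Suc k) q1 m) (pts K (Suc k) q2 m))"
proof -
  define P where "P = node_union K (Suc k) {q1}"
  define R where "R = node_union K (Suc k) {q2}"
  define X where "X = cells (Suc k) - {q1, q2}"
  define O' where "O' = node_union K (Suc k) X"
  have P': "P = leaves K (Suc k) q1" and R': "R = leaves K (Suc k) q2" by (auto simp: P_def R_def node_union_def)
  have PR: "P \<union> R = node_union K (Suc k) {q1, q2}" by (auto simp: P_def R_def node_union_def)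
  have cK: "cells K = O' \<union> (P \<union> R)"
  proof -
    have "cells K = node_union K (Suc k) (cells (Suc k))" using k by (simp add: node_union_def leaves_UN)
    also have "cells (Suc k) = X \<union> {q1, q2}" using q by (auto simp: X_def)
    finally show ?thesis by (simp only: node_union_Un O'_def PR)
  qed
  have fin: "finite P" "finite R" "finite O'" by (auto simp: P_def R_def O'_def)
  have disj: "P \<inter> R = {}" "O' \<inter> (P \<union> R) = {}"
    unfolding PR unfolding P_def R_def O'_def using q by (auto intro!: node_union_disjoint simp: X_def)
  \<comment> \<open>The factor of the weight that depends on the outside configuration \<open>mo\<close> and on \<open>s\<close> only.\<close>
  define G where "G mo s = exp (- (\<Sum>k'\<le>k. \<kappa> k' * (\<Sum>q\<in>cells k'. (real (pts K k' q mo + (if q = anc (Suc k - k') q1 then s else 0)))\<^sup>2))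
       - fine_energy \<kappa> K (Suc k) mo) / (\<Prod>i\<in>O'. fact (mo i))" for mo and s :: nat
  have split: "gibbs_sum \<kappa> K n (\<lambda>m. f (pts K (Suc k) q1 m) (pts K (Suc k) q2 m))
     = (\<Sum>c\<le>n. \<Sum>mo\<in>occupations O' c. G mo (n - c) * (\<Sum>a\<le>n - c. y a * y (n - c - a) * f a (n - c - a)))" for f
  proof -
    have "gibbs_sum \<kappa> K n (\<lambda>m. f (pts K (Suc k) q1 m) (pts K (Suc k) q2 m))
      = (\<Sum>c\<le>n. \<Sum>mo\<in>occupations O' c. \<Sum>m'\<in>occupations (P \<union> R) (n - c). gibbs_weight \<kappa> K (\<lambda>i. mo i + m' i) *
            f (pts K (Suc k) q1 (\<lambda>i. mo i + m' i)) (pts K (Suc k) q2 (\<lambda>i. mo i + m' i)))"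
      unfolding gibbs_sum_def cK by (rule sum_occupations_Un) (use fin disj in auto)
    also have "\<dots> = (\<Sum>c\<le>n. \<Sum>mo\<in>occupations O' c. \<Sum>a\<le>n - c. \<Sum>m1\<in>occupations P a. \<Sum>m2\<in>occupations R (n - c - a).
            gibbs_weight \<kappa> K (\<lambda>i. mo i + (m1 i + m2 i)) *
            f (pts K (Suc k) q1 (\<lambda>i. mo i + (m1 i + m2 i))) (pts K (Suc k) q2 (\<lambda>i. mo i + (m1 i + m2 i))))"
      by (rule sum.cong[OF refl], rule sum.cong[OF refl], rule sum_occupations_Un[OF fin(1,2) disj(1)])
    also have "\<dots> = (\<Sum>c\<le>n. \<Sum>mo\<in>occupations O' c. \<Sum>a\<le>n - c. \<Sum>m1\<in>occupations P a. \<Sum>m2\<in>occupations R (n - c - a).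
            G mo (n - c) * (fine_weight \<kappa> K (Suc k) P m1 * fine_weight \<kappa> K (Suc k) R m2) * f a (n - c - a))"
    proof (rule sum.cong[OF refl], rule sum.cong[OF refl], rule sum.cong[OF refl], rule sum.cong[OF refl], rule sum.cong[OF refl])
      fix c mo a m1 m2
      assume c: "c \<in> {..n}" and mo: "mo \<in> occupations O' c" and a: "a \<in> {..n - c}" and m1: "m1 \<in> occupations P a" and m2: "m2 \<in> occupations R (n - c - a)"
      have m12: "(\<lambda>i. m1 i + m2 i) \<in> occupations (P \<union> R) (n - c)"
      proof -
        have "(\<Sum>i\<in>P. m1 i + m2 i) = a"
        proof -
          have "(\<Sum>i\<in>P. m1 i + m2 i) = sum m1 P"
            using m2 disj by (intro sum.cong refl) (auto simp: occupations_def)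
          then show ?thesis using m1 by (simp add: occupations_def)
        qed
        moreover have "(\<Sum>i\<in>R. m1 i + m2 i) = n - c - a"
        proof -
          have "(\<Sum>i\<in>R. m1 i + m2 i) = sum m2 R"
            using m1 disj by (intro sum.cong refl) (auto simp: occupations_def)
          then show ?thesis using m2 by (simp add: occupations_def)
        qed
        ultimately show ?thesis using m1 m2 a fin disj by (auto simp: occupations_def sum.union_disjoint)
      qed
      have z: "pts K (Suc k) q1 mo = 0" "pts K (Suc k) q2 mo = 0" "pts K (Suc k) q2 m1 = 0" "pts K (Suc k) q1 m2 = 0"
        using mo m1 m2 disj by (auto intro!: pts_outside simp: P' R' Int_commute)
      have pp: "pts K (Suc k) q1 m1 = a" "pts K (Suc k) q2 m2 = n - c - a"
        using m1 m2 by (auto simp: P' R' pts_def occupations_def)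
      have "fine_energy \<kappa> K (Suc k) (\<lambda>i. mo i + (m1 i + m2 i)) = fine_energy \<kappa> K (Suc k) mo + fine_energy \<kappa> K (Suc k) (\<lambda>i. m1 i + m2 i)"
        by (rule fine_energy_add[OF mo[unfolded O'_def] m12[unfolded PR]]) (auto simp: X_def)
      also have "fine_energy \<kappa> K (Suc k) (\<lambda>i. m1 i + m2 i) = fine_energy \<kappa> K (Suc k) m1 + fine_energy \<kappa> K (Suc k) m2"
        by (rule fine_energy_add[OF m1[unfolded P_def] m2[unfolded R_def]]) (use q in auto)
      finally have e1: "fine_energy \<kappa> K (Suc k) (\<lambda>i. mo i + (m1 i + m2 i)) = fine_energy \<kappa> K (Suc k) mo + (fine_energy \<kappa> K (Suc k) m1 + fine_energy \<kappa> K (Suc k) m2)" .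
      have low: "pts K k' q (\<lambda>i. mo i + (m1 i + m2 i)) = pts K k' q mo + (if q = anc (Suc k - k') q1 then n - c else 0)"
        if k': "k' \<le> k" for k' q
      proof -
        have aa: "anc (K - k') i = anc (Suc k - k') (anc (K - Suc k) i)" for i :: "'d \<Rightarrow> nat"
          using k' k by (simp add: anc_anc)
        have aq: "anc (Suc k - k') q2 = anc (Suc k - k') q1"
          using anc_anc[of "k - k'" 1 q1] anc_anc[of "k - k'" 1 q2] q(4) k' by (simp add: Suc_diff_le)
        have "pts K k' q (\<lambda>i. m1 i + m2 i) = (if q = anc (Suc k - k') q1 then n - c else 0)"
        proof (cases "q = anc (Suc k - k') q1")
          case True
          then have "P \<union> R \<subseteq> leaves K k' q" using aq by (auto simp: P' R' leaves_def aa)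
          then have "pts K k' q (\<lambda>i. m1 i + m2 i) = (\<Sum>i\<in>P \<union> R. m1 i + m2 i)"
            unfolding pts_def using m12 by (intro sum.mono_neutral_right) (auto simp: occupations_def)
          then show ?thesis using True m12 by (simp add: occupations_def)
        next
          case False
          then have "leaves K k' q \<inter> (P \<union> R) = {}" using aq by (auto simp: P' R' leaves_def aa)
          then show ?thesis using False pts_outside[OF m12] by auto
        qed
        then show ?thesis by (simp add: pts_add[of K k' q mo "\<lambda>i. m1 i + m2 i"])
      qed
      have "fine_energy \<kappa> K 0 (\<lambda>i. mo i + (m1 i + m2 i)) = (\<Sum>k'\<le>k. \<kappa> k' * (\<Sum>q\<in>cells k'. (real (pts K k' q mo + (if q = anc (Suc k - k') q1 then n - c else 0)))\<^sup>2))
          + fine_energy \<kappa> K (Suc k) (\<lambda>i. mo i + (m1 i + m2 i))"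
      proof -
        have "{0..K} = {..k} \<union> {Suc k..K}" using k by auto
        then have "fine_energy \<kappa> K 0 (\<lambda>i. mo i + (m1 i + m2 i)) = (\<Sum>k'\<in>{..k} \<union> {Suc k..K}. \<kappa> k' * (\<Sum>q\<in>cells k'. (real (pts K k' q (\<lambda>i. mo i + (m1 i + m2 i))))\<^sup>2))"
          by (simp add: fine_energy_def)
        also have "\<dots> = (\<Sum>k'\<le>k. \<kappa> k' * (\<Sum>q\<in>cells k'. (real (pts K k' q (\<lambda>i. mo i + (m1 i + m2 i))))\<^sup>2)) + fine_energy \<kappa> K (Suc k) (\<lambda>i. mo i + (m1 i + m2 i))"
          unfolding fine_energy_def by (rule sum.union_disjoint) auto
        finally show ?thesis using low by simp
      qed
      moreover have "(\<Prod>i\<in>cells K. fact (mo i + (m1 i + m2 i))) = (\<Prod>i\<in>O'. fact (mo i)) * ((\<Prod>i\<in>P. fact (m1 i)) * (\<Prod>i\<in>R. fact (m2 i) :: real))"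
        unfolding cK by (subst prod_fact_add[OF mo m12]; (subst prod_fact_add[OF m1 m2])?) (use fin disj in auto)
      ultimately have "gibbs_weight \<kappa> K (\<lambda>i. mo i + (m1 i + m2 i)) = G mo (n - c) * (fine_weight \<kappa> K (Suc k) P m1 * fine_weight \<kappa> K (Suc k) R m2)"
        unfolding gibbs_weight_def fine_weight_def G_def e1 by (simp add: exp_add exp_diff exp_minus field_simps)
      moreover have "pts K (Suc k) q1 (\<lambda>i. mo i + (m1 i + m2 i)) = a" "pts K (Suc k) q2 (\<lambda>i. mo i + (m1 i + m2 i)) = n - c - a"
        using z pp by (simp_all add: pts_add[of K _ _ mo "\<lambda>i. m1 i + m2 i"] pts_add)
      ultimately show "gibbs_weight \<kappa> K (\<lambda>i. mo i + (m1 i + m2 i)) *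
            f (pts K (Suc k) q1 (\<lambda>i. mo i + (m1 i + m2 i))) (pts K (Suc k) q2 (\<lambda>i. mo i + (m1 i + m2 i)))
          = G mo (n - c) * (fine_weight \<kappa> K (Suc k) P m1 * fine_weight \<kappa> K (Suc k) R m2) * f a (n - c - a)"
        by simp
    qed
    also have "\<dots> = (\<Sum>c\<le>n. \<Sum>mo\<in>occupations O' c. G mo (n - c) * (\<Sum>a\<le>n - c. block_sum \<kappa> K (Suc k) P a * block_sum \<kappa> K (Suc k) R (n - c - a) * f a (n - c - a)))"
      unfolding block_sum_def sum_product by (simp add: sum_distrib_left sum_distrib_right mult.assoc)
    also have "block_sum \<kappa> K (Suc k) P = y"
      using block_sum_leaves[of "K - Suc k" K q1 \<kappa>] k q by (auto simp: P' y node_sequence_def fun_eq_iff)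
    also have "block_sum \<kappa> K (Suc k) R = y"
      using block_sum_leaves[of "K - Suc k" K q2 \<kappa>] k q by (auto simp: R' y node_sequence_def fun_eq_iff)
    finally show ?thesis .
  qed
  have G0: "0 \<le> G mo s" for mo s by (simp add: G_def prod_nonneg)
  show ?thesis unfolding split by (intro sum_mono mult_left_mono le G0)
qed

section \<open>Symmetries and second moments\<close>

definition vxor :: "('d \<Rightarrow> nat) \<Rightarrow> ('d \<Rightarrow> nat) \<Rightarrow> 'd \<Rightarrow> nat" where
  "vxor i b = (\<lambda>l. xor (i l) (b l))"

text \<open>
  The cells below the nodes of \<open>S\<close> at level \<open>k\<close> are moved by xor with a mask that touches only digits
  below level \<open>k\<close>.  This permutes the nodes of every level, so it is a symmetry of the tree.
\<close>

definition flip :: "nat \<Rightarrow> nat \<Rightarrow> ('d \<Rightarrow> nat) set \<Rightarrow> ('d \<Rightarrow> nat) \<Rightarrow> ('d \<Rightarrow> nat) \<Rightarrow> 'd \<Rightarrow> nat" where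
  "flip K k S b i = (if anc (K - k) i \<in> S then vxor i b else i)"

lemma vxor_vxor [simp]: "vxor (vxor i b) b = i"
  by (simp add: vxor_def xor.assoc)

lemma vxor_vxor_left [simp]: "vxor i (vxor i b) = b"
  by (simp add: vxor_def flip: xor.assoc)

lemma anc_vxor: "anc j (vxor i b) = vxor (anc j i) (anc j b)"
  by (simp add: anc_def vxor_def flip: drop_bit_eq_div)

lemma vxor_cells: "i \<in> cells K \<Longrightarrow> b \<in> cells K \<Longrightarrow> vxor i b \<in> cells K"
proof -
  have "xor x y < 2 ^ K" if "x < 2 ^ K" "y < 2 ^ K" for x y :: nat
    using that by (metis take_bit_nat_eq_self_iff take_bit_xor)
  then show "i \<in> cells K \<Longrightarrow> b \<in> cells K \<Longrightarrow> vxor i b \<in> cells K" by (auto simp: cells_def vxor_def)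
qed

lemma anc_eq_0: "b \<in> cells k \<Longrightarrow> k \<le> j \<Longrightarrow> anc j b = (\<lambda>_. 0)"
  by (auto simp: anc_def cells_def fun_eq_iff intro!: div_less intro: less_le_trans)

lemma vxor_0 [simp]: "vxor i (\<lambda>_. 0) = i"
  by (simp add: vxor_def)

lemma cells_mono: "k \<le> k' \<Longrightarrow> cells k \<subseteq> cells k'"
  by (auto simp: cells_def intro: less_le_trans)

lemma anc_flip_ge:
  assumes "k \<le> k'" "k' \<le> K"
  shows "anc (K - k') (flip K k S b i) = flip k' k S (anc (K - k') b) (anc (K - k') i)"
  using assms by (simp add: flip_def anc_anc anc_vxor)

lemma anc_flip_le:
  assumes "k' \<le> k" "k \<le> K" "b \<in> cells (K - k)"
  shows "anc (K - k') (flip K k S b i) = anc (K - k') i"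
  using assms by (simp add: flip_def anc_vxor anc_eq_0)

lemma flip_flip:
  assumes "k \<le> K" "b \<in> cells (K - k)"
  shows "flip K k S b (flip K k S b i) = i"
  using assms anc_flip_le[OF order_refl assms, of S i] by (auto simp: flip_def)

lemma flip_cells: "k \<le> K \<Longrightarrow> b \<in> cells (K - k) \<Longrightarrow> i \<in> cells K \<Longrightarrow> flip K k S b i \<in> cells K"
  using cells_mono[of "K - k" K] by (auto simp: flip_def intro!: vxor_cells)

lemma anc_mask: "k \<le> k' \<Longrightarrow> k' \<le> K \<Longrightarrow> b \<in> cells (K - k) \<Longrightarrow> anc (K - k') b \<in> cells (k' - k)"
  by (rule anc_in_cells) simp

lemma pts_flip_ge:
  assumes k: "k \<le> k'" "k' \<le> K" and b: "b \<in> cells (K - k)"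
  shows "pts K k' q (\<lambda>i. m (flip K k S b i)) = pts K k' (flip k' k S (anc (K - k') b) q) m"
proof -
  have ff: "flip k' k S (anc (K - k') b) (flip k' k S (anc (K - k') b) q) = q" for q
    using k b by (intro flip_flip anc_mask) auto
  have kK: "k \<le> K" using k by simp
  show ?thesis unfolding pts_def
    by (rule sum.reindex_bij_witness[of _ "flip K k S b" "flip K k S b"])
       (use k b kK ff in \<open>auto simp: leaves_def flip_flip flip_cells anc_flip_ge\<close>)
qed

lemma pts_flip_le:
  assumes k: "k' \<le> k" "k \<le> K" and b: "b \<in> cells (K - k)"
  shows "pts K k' q (\<lambda>i. m (flip K k S b i)) = pts K k' q m"
  unfolding pts_def
  by (rule sum.reindex_bij_witness[of _ "flip K k S b" "flip K k S b"])
     (use k b in \<open>auto simp: leaves_def flip_flip flip_cells anc_flip_le\<close>)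

lemma occupations_flip:
  assumes k: "k \<le> K" and b: "b \<in> cells (K - k)" and m: "m \<in> occupations (cells K) n"
  shows "(\<lambda>i. m (flip K k S b i)) \<in> occupations (cells K) n"
proof -
  have "(\<Sum>i\<in>cells K. m (flip K k S b i)) = sum m (cells K)"
    by (rule sum.reindex_bij_witness[of _ "flip K k S b" "flip K k S b"])
       (use k b in \<open>auto simp: flip_flip flip_cells\<close>)
  moreover have "m (flip K k S b i) = 0" if "i \<notin> cells K" for i
    using flip_cells[OF k b, of "flip K k S b i" S] flip_flip[OF k b, of S i] m that by (auto simp: occupations_def)
  ultimately show ?thesis using m by (simp add: occupations_def)
qed

lemma gibbs_weight_flip:
  assumes k: "k \<le> K" and b: "b \<in> cells (K - k)"
  shows "gibbs_weight \<kappa> K (\<lambda>i. m (flip K k S b i)) = gibbs_weight \<kappa> K m"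
proof -
  have "(\<Prod>i\<in>cells K. fact (m (flip K k S b i))) = (\<Prod>i\<in>cells K. fact (m i) :: real)"
    by (rule prod.reindex_bij_witness[of _ "flip K k S b" "flip K k S b"])
       (use k b in \<open>auto simp: flip_flip flip_cells\<close>)
  moreover have "(\<Sum>q\<in>cells k'. (real (pts K k' q (\<lambda>i. m (flip K k S b i))))\<^sup>2) = (\<Sum>q\<in>cells k'. (real (pts K k' q m))\<^sup>2)"
    if "k' \<le> K" for k'
  proof (cases "k' \<le> k")
    case True then show ?thesis using k b by (simp add: pts_flip_le)
  next
    case False
    then have k': "k \<le> k'" by simp
    let ?f = "flip k' k S (anc (K - k') b)"
    show ?thesis
      by (rule sum.reindex_bij_witness[of _ ?f ?f])
         (use k k' that b in \<open>auto simp: flip_flip flip_cells pts_flip_ge anc_mask\<close>)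
  qed
  ultimately show ?thesis by (simp add: gibbs_weight_def fine_weight_def fine_energy_def)
qed

lemma gibbs_sum_flip:
  assumes k: "k \<le> K" and b: "b \<in> cells (K - k)"
  shows "gibbs_sum \<kappa> K n (\<lambda>m. F (\<lambda>i. m (flip K k S b i))) = gibbs_sum \<kappa> K n F"
  unfolding gibbs_sum_def
  by (rule sum.reindex_bij_witness[of _ "\<lambda>m i. m (flip K k S b i)" "\<lambda>m i. m (flip K k S b i)"])
     (use k b in \<open>auto simp: flip_flip occupations_flip gibbs_weight_flip\<close>)

definition avg :: "(nat \<Rightarrow> real) \<Rightarrow> nat \<Rightarrow> nat \<Rightarrow> ((('d::finite \<Rightarrow> nat) \<Rightarrow> nat) \<Rightarrow> real) \<Rightarrow> real" where
  "avg \<kappa> K n F = gibbs_sum \<kappa> K n F / gibbs_sum \<kappa> K n (\<lambda>_ :: ('d \<Rightarrow> nat) \<Rightarrow> nat. 1)"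

lemma gibbs_weight_pos: "0 < gibbs_weight \<kappa> K m"
  by (simp add: gibbs_weight_def fine_weight_def prod_pos)

lemma gibbs_sum_1_pos: "0 < gibbs_sum \<kappa> K n (\<lambda>_ :: ('d::finite \<Rightarrow> nat) \<Rightarrow> nat. 1)"
proof -
  define m :: "('d \<Rightarrow> nat) \<Rightarrow> nat" where "m = (\<lambda>i. if i = (\<lambda>_. 0) then n else 0)"
  have z: "(\<lambda>_. 0) \<in> (cells K :: ('d \<Rightarrow> nat) set)" by (simp add: cells_def)
  then have "m \<in> occupations (cells K) n" by (auto simp: occupations_def m_def)
  then have "occupations (cells K :: ('d \<Rightarrow> nat) set) n \<noteq> {}" by auto
  then show ?thesis unfolding gibbs_sum_def by (intro sum_pos) (auto simp: gibbs_weight_pos)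
qed

lemma avg_add: "avg \<kappa> K n (\<lambda>m. F m + G m) = avg \<kappa> K n F + avg \<kappa> K n G"
  by (simp add: avg_def gibbs_sum_def distrib_left sum.distrib add_divide_distrib)

lemma avg_cmult: "avg \<kappa> K n (\<lambda>m. c * F m) = c * avg \<kappa> K n F"
  by (simp add: avg_def gibbs_sum_def sum_distrib_left mult.left_commute)

lemma avg_diff: "avg \<kappa> K n (\<lambda>m. F m - G m) = avg \<kappa> K n F - avg \<kappa> K n G"
  by (simp add: avg_def gibbs_sum_def right_diff_distrib sum_subtractf diff_divide_distrib)

lemma avg_sum: "avg \<kappa> K n (\<lambda>m. \<Sum>x\<in>A. F x m) = (\<Sum>x\<in>A. avg \<kappa> K n (F x))"
proof -
  have "gibbs_sum \<kappa> K n (\<lambda>m. \<Sum>x\<in>A. F x m) = (\<Sum>x\<in>A. gibbs_sum \<kappa> K n (F x))"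
    unfolding gibbs_sum_def sum_distrib_left by (rule sum.swap)
  then show ?thesis by (simp add: avg_def sum_divide_distrib)
qed

lemma avg_const [simp]: "avg \<kappa> K n (\<lambda>_ :: ('d::finite \<Rightarrow> nat) \<Rightarrow> nat. c) = c"
proof -
  let ?g = "gibbs_sum \<kappa> K n :: ((('d \<Rightarrow> nat) \<Rightarrow> nat) \<Rightarrow> real) \<Rightarrow> real"
  have "?g (\<lambda>_. c) = c * ?g (\<lambda>_. 1)" by (simp add: gibbs_sum_def sum_distrib_left mult.commute)
  moreover have "0 < ?g (\<lambda>_. 1)" by (rule gibbs_sum_1_pos)
  ultimately show ?thesis by (simp add: avg_def)
qed

lemma avg_mono: "(\<And>m. m \<in> occupations (cells K) n \<Longrightarrow> F m \<le> G m) \<Longrightarrow> avg \<kappa> K n F \<le> avg \<kappa> K n G"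
  unfolding avg_def gibbs_sum_def
  by (intro divide_right_mono sum_mono mult_left_mono sum_nonneg) (auto intro: less_imp_le[OF gibbs_weight_pos])

lemma avg_cong: "(\<And>m. m \<in> occupations (cells K) n \<Longrightarrow> F m = G m) \<Longrightarrow> avg \<kappa> K n F = avg \<kappa> K n G"
  by (intro antisym avg_mono) auto

lemma avg_flip:
  assumes k: "k \<le> K" and b: "b \<in> cells (K - k)"
  shows "avg \<kappa> K n (\<lambda>m. F (\<lambda>i. m (flip K k S b i))) = avg \<kappa> K n F"
  using gibbs_sum_flip[OF assms] by (simp add: avg_def)

definition flip_invariant :: "nat \<Rightarrow> nat \<Rightarrow> ('d::finite \<Rightarrow> nat) \<Rightarrow> ((('d \<Rightarrow> nat) \<Rightarrow> nat) \<Rightarrow> 'b) \<Rightarrow> bool" where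
  "flip_invariant K k p G \<longleftrightarrow> (\<forall>m. \<forall>b\<in>cells (K - k). G (\<lambda>i. m (flip K k {p} b i)) = G m)"

text \<open>
  Two descendants of \<open>p\<close> are exchanged by a flip at \<open>p\<close>, hence they have the same joint law with every
  quantity that this flip leaves fixed.
\<close>

lemma avg_move:
  assumes k: "k0 \<le> k" "k \<le> K" and q: "q \<in> leaves k k0 p" "q' \<in> leaves k k0 p" and G: "flip_invariant K k0 p G"
  shows "avg \<kappa> K n (\<lambda>m. \<Phi> (pts K k q m) (G m)) = avg \<kappa> K n (\<lambda>m. \<Phi> (pts K k q' m) (G m))"
proof -
  define c where "c = vxor q q'"
  \<comment> \<open>The mask acts only on digits between the levels \<open>k0\<close> and \<open>k\<close>, because \<open>q\<close> and \<open>q'\<close> agree above.\<close>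
  define b where "b = (\<lambda>l. c l * 2 ^ (K - k))"
  have "anc (k - k0) c = (\<lambda>_. 0)"
    using q by (simp add: c_def leaves_def anc_vxor) (simp add: vxor_def)
  then have c: "c l < 2 ^ (k - k0)" for l
    by (auto simp: anc_def fun_eq_iff dest!: spec[of _ l] simp: div_eq_0_iff)
  have bc: "b \<in> cells (K - k0)"
  proof -
    have "c l * 2 ^ (K - k) < 2 ^ (k - k0) * 2 ^ (K - k)" for l using c by simp
    then show ?thesis using k by (simp add: b_def cells_def flip: power_add)
  qed
  have ab: "anc (K - k) b = c" by (simp add: anc_def b_def)
  have fq: "flip k k0 {p} c q = q'" using q by (simp add: flip_def leaves_def c_def)
  have "avg \<kappa> K n (\<lambda>m. \<Phi> (pts K k q m) (G m)) = avg \<kappa> K n (\<lambda>m. \<Phi> (pts K k q (\<lambda>i. m (flip K k0 {p} b i))) (G (\<lambda>i. m (flip K k0 {p} b i))))"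
    using k bc by (intro avg_flip[symmetric, where F = "\<lambda>m. \<Phi> (pts K k q m) (G m)"]) auto
  also have "\<dots> = avg \<kappa> K n (\<lambda>m. \<Phi> (pts K k q' m) (G m))"
    using G bc k by (simp add: pts_flip_ge[OF k bc] ab fq flip_invariant_def)
  finally show ?thesis .
qed

lemma leaves_root: "q \<in> cells k \<Longrightarrow> q \<in> leaves k 0 (\<lambda>_. 0)"
  by (simp add: leaves_def anc_eq_0)

lemma avg_node:
  fixes q q' :: "'d::finite \<Rightarrow> nat"
  assumes "k \<le> K" "q \<in> cells k" "q' \<in> cells k"
  shows "avg \<kappa> K n (\<lambda>m. f (pts K k q m)) = avg \<kappa> K n (\<lambda>m. f (pts K k q' m))"
  using avg_move[of 0 k K q "\<lambda>_. 0" q' "\<lambda>_. ()" \<kappa> n "\<lambda>a _. f a"]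
    assms leaves_root[OF assms(2)] leaves_root[OF assms(3)]
  by (simp add: flip_invariant_def)

lemma avg_pts:
  fixes q :: "'d::finite \<Rightarrow> nat"
  assumes "k \<le> K" "q \<in> cells k"
  shows "avg \<kappa> K n (\<lambda>m. real (pts K k q m)) = real n / (2 ^ CARD('d)) ^ k"
proof -
  have "real n = avg \<kappa> K n (\<lambda>m. real (sum m (cells K :: ('d \<Rightarrow> nat) set)))"
    by (subst avg_cong[where G = "\<lambda>_. real n"]) (auto simp: occupations_def)
  also have "\<dots> = avg \<kappa> K n (\<lambda>m. \<Sum>q'\<in>(cells k :: ('d \<Rightarrow> nat) set). real (pts K k q' m))"
    by (intro avg_cong) (simp only: of_nat_sum[symmetric] pts_sum_cells[OF assms(1)])
  also have "\<dots> = (\<Sum>q'\<in>(cells k :: ('d \<Rightarrow> nat) set). avg \<kappa> K n (\<lambda>m. real (pts K k q m)))"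
    unfolding avg_sum by (intro sum.cong refl avg_node[where f = real] assms)
  also have "\<dots> = (2 ^ CARD('d)) ^ k * avg \<kappa> K n (\<lambda>m. real (pts K k q m))"
    by (simp add: card_cells mult.commute flip: power_mult)
  finally show ?thesis by (simp add: field_simps)
qed

lemma gibbs_sum_le_imp_avg_le:
  fixes F G :: "(('d::finite \<Rightarrow> nat) \<Rightarrow> nat) \<Rightarrow> real"
  assumes "gibbs_sum \<kappa> K n F \<le> gibbs_sum \<kappa> K n G"
  shows "avg \<kappa> K n F \<le> avg \<kappa> K n G"
proof -
  have "0 < gibbs_sum \<kappa> K n (\<lambda>_ :: ('d \<Rightarrow> nat) \<Rightarrow> nat. 1)" by (rule gibbs_sum_1_pos)
  then show ?thesis using assms by (simp add: avg_def divide_right_mono)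
qed

lemma sq_geom_mono: "0 < r \<Longrightarrow> r \<le> s \<Longrightarrow> s < 1 \<Longrightarrow> sq_geom r \<le> sq_geom s"
  unfolding sq_geom_def by (intro suminf_le summable_sq_geom mult_left_mono power_mono) auto

lemma child_eq:
  assumes "q' \<in> leaves (Suc k) k q" shows "anc 1 q' = q" "q' \<in> cells (Suc k)"
  using assms by (auto simp: leaves_def)

lemma square_sum_le: "(a + b)\<^sup>2 \<le> 2 * a\<^sup>2 + 2 * b\<^sup>2" for a b :: real
  using zero_le_power2[of "a - b"] by (simp add: power2_sum power2_diff)

locale hierarchical_model =
  fixes \<kappa> :: "nat \<Rightarrow> real" and b0 :: real
  assumes b0: "0 < b0" and \<kappa>_nonneg: "\<And>k. 0 \<le> \<kappa> k" and \<kappa>_ge: "\<And>k. 1 \<le> k \<Longrightarrow> b0 \<le> \<kappa> k"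
begin

definition sibling_bound :: real where "sibling_bound = 2 * sq_geom (exp (- b0 / 2))"

lemma sibling_bound_ge: "2 \<le> sibling_bound"
proof -
  have "(\<Sum>k<1. (real k + 1)\<^sup>2 * exp (- b0 / 2) ^ k) \<le> sq_geom (exp (- b0 / 2))"
    unfolding sq_geom_def using b0 by (intro sum_le_suminf summable_sq_geom) auto
  then show ?thesis by (simp add: sibling_bound_def)
qed

text \<open>
  The two regimes of lemma \<open>gaussian_log_concave_pair\<close>: the first holds at all levels below the root, the second
  once the interaction is strong.  The second says that siblings are at least as balanced as under
  independent uniform placement of their points.
\<close>

lemma sibling_diff:
  fixes q1 q2 :: "'d::finite \<Rightarrow> nat"
  assumes k: "k < K" and q: "q1 \<in> cells (Suc k)" "q2 \<in> cells (Suc k)" "anc 1 q1 = anc 1 q2"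
  shows "avg \<kappa> K n (\<lambda>m. (real (pts K (Suc k) q1 m) - real (pts K (Suc k) q2 m))\<^sup>2) \<le> sibling_bound"
    and "exp (- \<kappa> (Suc k) / 2) \<le> 1/8 \<Longrightarrow> q1 \<noteq> q2 \<Longrightarrow>
      avg \<kappa> K n (\<lambda>m. (real (pts K (Suc k) q1 m) - real (pts K (Suc k) q2 m))\<^sup>2)
        \<le> avg \<kappa> K n (\<lambda>m. real (pts K (Suc k) q1 m) + real (pts K (Suc k) q2 m))"
proof -
  define y where "y = node_sequence (2 ^ CARD('d)) \<kappa> K (Suc k)"
  define u where "u = node_partition (2 ^ CARD('d)) \<kappa> K (K - Suc k)"
  define r where "r = exp (- \<kappa> (Suc k) / 2)"
  have kp: "0 < \<kappa> (Suc k)" using \<kappa>_ge[of "Suc k"] b0 by simp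
  have u: "log_concave u" unfolding u_def by (rule log_concave_node_inner[OF \<kappa>_nonneg])
  have yu: "y = (\<lambda>a. exp (- \<kappa> (Suc k) * (real a)\<^sup>2) * u a)" by (simp add: y_def u_def node_sequence_def fun_eq_iff)
  note pair = gaussian_log_concave_pair[OF u r_def kp yu]
  have yn: "0 \<le> y a" for a using log_concave_nonneg[OF u] by (simp add: yu)
  show "avg \<kappa> K n (\<lambda>m. (real (pts K (Suc k) q1 m) - real (pts K (Suc k) q2 m))\<^sup>2) \<le> sibling_bound"
  proof (cases "q1 = q2")
    case True then show ?thesis using sibling_bound_ge by simp
  next
    case False
    have "r \<le> exp (- b0 / 2)" using \<kappa>_ge[of "Suc k"] by (simp add: r_def)
    then have "2 * sq_geom r \<le> sibling_bound" using b0 sq_geom_mono[of r "exp (- b0 / 2)"] by (simp add: sibling_bound_def r_def)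
    then have "(\<Sum>a\<le>s. y a * y (s - a) * (real a - real (s - a))\<^sup>2) \<le> (\<Sum>a\<le>s. y a * y (s - a) * sibling_bound)" for s
      using pair(1)[of s] mult_right_mono[of "2 * sq_geom r" sibling_bound "\<Sum>a\<le>s. y a * y (s - a)"] yn
      by (simp add: sum_nonneg mult.commute[of _ sibling_bound] flip: sum_distrib_left)
    from gibbs_sum_le_imp_avg_le[OF sibling_comparison[OF k q(1,2) False q(3) y_def, of "\<lambda>a b. (real a - real b)\<^sup>2" "\<lambda>a b. sibling_bound", OF this]]
    show ?thesis by simp
  qed
  assume r8: "exp (- \<kappa> (Suc k) / 2) \<le> 1/8" and ne: "q1 \<noteq> q2"
  have "(\<Sum>a\<le>s. y a * y (s - a) * (real a - real (s - a))\<^sup>2) \<le> (\<Sum>a\<le>s. y a * y (s - a) * (real a + real (s - a)))" for s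
  proof -
    have "(\<Sum>a\<le>s. y a * y (s - a) * (real a - real (s - a))\<^sup>2) \<le> (\<Sum>a\<le>s. y a * y (s - a) * real s)"
      using r8 sq_geom_le_2[of r] by (intro pair(2)) (auto simp: r_def)
    also have "\<dots> = (\<Sum>a\<le>s. y a * y (s - a) * (real a + real (s - a)))"
      by (intro sum.cong refl) (auto simp flip: of_nat_add)
    finally show ?thesis .
  qed
  from gibbs_sum_le_imp_avg_le[OF sibling_comparison[OF k q(1,2) ne q(3) y_def, of "\<lambda>a b. (real a - real b)\<^sup>2" "\<lambda>a b. real a + real b", OF this]]
  show "avg \<kappa> K n (\<lambda>m. (real (pts K (Suc k) q1 m) - real (pts K (Suc k) q2 m))\<^sup>2)
        \<le> avg \<kappa> K n (\<lambda>m. real (pts K (Suc k) q1 m) + real (pts K (Suc k) q2 m))" .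
qed

lemma card_children: "q \<in> cells k \<Longrightarrow> card (leaves (Suc k) k (q :: 'd::finite \<Rightarrow> nat)) = 2 ^ CARD('d)"
  using card_leaves[of q k "Suc k"] by simp

text \<open>
  The deviation of a child from the mean of its siblings is the average of its differences to them.
\<close>

lemma child_dev:
  fixes q :: "'d::finite \<Rightarrow> nat"
  assumes k: "k < K" and q: "q \<in> cells k" and q': "q' \<in> leaves (Suc k) k q"
  shows "avg \<kappa> K n (\<lambda>m. (real (pts K (Suc k) q' m) - real (pts K k q m) / 2 ^ CARD('d))\<^sup>2) \<le> sibling_bound"
proof -
  let ?ch = "leaves (Suc k) k q"
  let ?M = "2 ^ CARD('d) :: real"
  let ?N = "\<lambda>q m. real (pts K (Suc k) q m)"
  have card: "real (card ?ch) = ?M" using card_children[OF q] by simp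
  have pt: "(?N q' m - real (pts K k q m) / ?M)\<^sup>2 \<le> (1 / ?M) * (\<Sum>q''\<in>?ch. (?N q' m - ?N q'' m)\<^sup>2)" for m :: "('d \<Rightarrow> nat) \<Rightarrow> nat"
  proof -
    have "real (pts K k q m) = (\<Sum>q''\<in>?ch. ?N q'' m)" using k pts_sum_leaves[of k "Suc k" K m q] by (simp flip: of_nat_sum)
    then have "?N q' m - real (pts K k q m) / ?M = (\<Sum>q''\<in>?ch. ?N q' m - ?N q'' m) / ?M"
      using card by (simp add: sum_subtractf field_simps)
    then have "(?N q' m - real (pts K k q m) / ?M)\<^sup>2 = (\<Sum>q''\<in>?ch. ?N q' m - ?N q'' m)\<^sup>2 / ?M\<^sup>2"
      by (simp add: power_divide)
    also have "\<dots> \<le> ((\<Sum>q''\<in>?ch. (?N q' m - ?N q'' m)\<^sup>2) * real (card ?ch)) / ?M\<^sup>2"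
      by (intro divide_right_mono sum_squared_le_sum_of_squares) auto
    also have "\<dots> = (1 / ?M) * (\<Sum>q''\<in>?ch. (?N q' m - ?N q'' m)\<^sup>2)" by (simp add: card power2_eq_square)
    finally show ?thesis .
  qed
  have "avg \<kappa> K n (\<lambda>m. (?N q' m - real (pts K k q m) / ?M)\<^sup>2) \<le> avg \<kappa> K n (\<lambda>m. (1 / ?M) * (\<Sum>q''\<in>?ch. (?N q' m - ?N q'' m)\<^sup>2))"
    by (intro avg_mono pt)
  also have "\<dots> = (1 / ?M) * (\<Sum>q''\<in>?ch. avg \<kappa> K n (\<lambda>m. (?N q' m - ?N q'' m)\<^sup>2))"
    by (simp only: avg_cmult avg_sum)
  also have "\<dots> \<le> (1 / ?M) * (\<Sum>q''\<in>?ch. sibling_bound)"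
    using child_eq[OF q'] k by (intro mult_left_mono sum_mono sibling_diff(1)) (auto dest: child_eq)
  also have "\<dots> = sibling_bound" using card by simp
  finally show ?thesis .
qed

text \<open>
  Passing to a child divides the deviation of the parent by \<open>2\<^sup>d\<close> and adds a bounded fluctuation, so the
  variances satisfy \<open>V\<^sub>k\<^sub>+\<^sub>1 \<le> 2 C + V\<^sub>k / 2\<close>.
\<close>

lemma node_variance:
  fixes q :: "'d::finite \<Rightarrow> nat"
  assumes "k \<le> K" "q \<in> cells k"
  shows "avg \<kappa> K n (\<lambda>m. (real (pts K k q m) - real n / (2 ^ CARD('d)) ^ k)\<^sup>2) \<le> 4 * sibling_bound"
  using assms
proof (induction k arbitrary: q)
  case 0
  have "leaves K 0 q = cells K" using 0 by (auto simp: leaves_def anc_eq_0)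
  then have "avg \<kappa> K n (\<lambda>m. (real (pts K 0 q m) - real n / (2 ^ CARD('d)) ^ 0)\<^sup>2) = avg \<kappa> K n (\<lambda>_ :: ('d \<Rightarrow> nat) \<Rightarrow> nat. 0)"
    by (intro avg_cong) (simp add: pts_def occupations_def)
  then show ?case using sibling_bound_ge by simp
next
  case (Suc k)
  define p where "p = anc 1 q"
  have p: "p \<in> cells k" using Suc.prems anc_in_cells[of q k 1] by (simp add: p_def)
  have q: "q \<in> leaves (Suc k) k p" using Suc.prems by (simp add: leaves_def p_def)
  let ?M = "2 ^ CARD('d) :: real"
  have M2: "2 \<le> ?M" using power_increasing[of 1 "CARD('d)" "2::real"] by (simp add: Suc_leI)
  have pt: "(x - y)\<^sup>2 \<le> 2 * (x - z / ?M)\<^sup>2 + 1/2 * (z - ?M * y)\<^sup>2" for x y z :: real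
  proof -
    have "(x - y)\<^sup>2 = ((x - z / ?M) + (z - ?M * y) / ?M)\<^sup>2" by (simp add: diff_divide_distrib)
    also have "\<dots> \<le> 2 * (x - z / ?M)\<^sup>2 + 2 * ((z - ?M * y) / ?M)\<^sup>2"
      by (rule square_sum_le)
    also have "((z - ?M * y) / ?M)\<^sup>2 \<le> (z - ?M * y)\<^sup>2 / 4"
      unfolding power_divide using power_mono[of 2 ?M 2] M2 by (intro divide_left_mono) auto
    finally show ?thesis by simp
  qed
  have "avg \<kappa> K n (\<lambda>m. (real (pts K (Suc k) q m) - real n / ?M ^ Suc k)\<^sup>2)
     \<le> avg \<kappa> K n (\<lambda>m. 2 * (real (pts K (Suc k) q m) - real (pts K k p m) / ?M)\<^sup>2 + 1/2 * (real (pts K k p m) - real n / ?M ^ k)\<^sup>2)"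
  proof (intro avg_mono)
    fix m :: "('d \<Rightarrow> nat) \<Rightarrow> nat"
    have "?M * (real n / ?M ^ Suc k) = real n / ?M ^ k" by simp
    then show "(real (pts K (Suc k) q m) - real n / ?M ^ Suc k)\<^sup>2 \<le> 2 * (real (pts K (Suc k) q m) - real (pts K k p m) / ?M)\<^sup>2 + 1/2 * (real (pts K k p m) - real n / ?M ^ k)\<^sup>2"
      using pt[of "real (pts K (Suc k) q m)" "real n / ?M ^ Suc k" "real (pts K k p m)"] by (simp only:)
  qed
  also have "\<dots> = 2 * avg \<kappa> K n (\<lambda>m. (real (pts K (Suc k) q m) - real (pts K k p m) / ?M)\<^sup>2) + 1/2 * avg \<kappa> K n (\<lambda>m. (real (pts K k p m) - real n / ?M ^ k)\<^sup>2)"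
    by (simp only: avg_add avg_cmult)
  also have "\<dots> \<le> 2 * sibling_bound + 1/2 * (4 * sibling_bound)"
    using Suc p q by (intro add_mono mult_left_mono child_dev Suc.IH) auto
  finally show ?case by simp
qed

lemma node_second_moment:
  fixes q :: "'d::finite \<Rightarrow> nat"
  assumes "k \<le> K" "q \<in> cells k"
  shows "avg \<kappa> K n (\<lambda>m. (real (pts K k q m))\<^sup>2) \<le> 8 * sibling_bound + 2 * (real n / (2 ^ CARD('d)) ^ k)\<^sup>2"
proof -
  let ?\<mu> = "real n / (2 ^ CARD('d)) ^ k"
  have "x\<^sup>2 \<le> 2 * (x - ?\<mu>)\<^sup>2 + 2 * ?\<mu>\<^sup>2" for x :: real
    using zero_le_power2[of "(x - ?\<mu>) - ?\<mu>"] by (simp add: power2_eq_square algebra_simps)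
  then have "avg \<kappa> K n (\<lambda>m. (real (pts K k q m))\<^sup>2) \<le> avg \<kappa> K n (\<lambda>m. 2 * (real (pts K k q m) - ?\<mu>)\<^sup>2 + 2 * ?\<mu>\<^sup>2)"
    by (intro avg_mono) 
  also have "\<dots> = 2 * avg \<kappa> K n (\<lambda>m. (real (pts K k q m) - ?\<mu>)\<^sup>2) + 2 * ?\<mu>\<^sup>2"
    by (simp only: avg_add avg_cmult avg_const)
  also have "\<dots> \<le> 2 * (4 * sibling_bound) + 2 * ?\<mu>\<^sup>2"
    using node_variance[OF assms, of n] by (intro add_mono mult_left_mono) auto
  finally show ?thesis by simp
qed

text \<open>
  By symmetry the second moment is an average over the descendants of \<open>q0\<close>, and the sum of the squares of
  their occupation numbers is at most the square of the sum.
\<close>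

lemma deep_second_moment:
  fixes q q0 :: "'d::finite \<Rightarrow> nat"
  assumes k: "k0 \<le> k" "k \<le> K" and q: "q \<in> cells k" "q0 \<in> cells k0"
  shows "(2 ^ CARD('d)) ^ (k - k0) * avg \<kappa> K n (\<lambda>m. (real (pts K k q m))\<^sup>2) \<le> avg \<kappa> K n (\<lambda>m. (real (pts K k0 q0 m))\<^sup>2)"
proof -
  have sq: "(\<Sum>x\<in>A. (f x)\<^sup>2) \<le> (\<Sum>x\<in>A. f x)\<^sup>2" if "finite A" "\<And>x. 0 \<le> f x" for A and f :: "('d \<Rightarrow> nat) \<Rightarrow> real"
    using that by (induction A rule: finite_induct) (auto simp: power2_sum sum_nonneg add_increasing2 intro: add_mono)
  have card: "real (card (leaves k k0 q0)) = (2 ^ CARD('d)) ^ (k - k0)"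
    using card_leaves[OF q(2) k(1)] by (simp add: mult.commute flip: power_mult)
  have "(2 ^ CARD('d)) ^ (k - k0) * avg \<kappa> K n (\<lambda>m. (real (pts K k q m))\<^sup>2) = (\<Sum>q'\<in>leaves k k0 q0. avg \<kappa> K n (\<lambda>m. (real (pts K k q m))\<^sup>2))"
    by (simp add: card)
  also have "\<dots> = avg \<kappa> K n (\<lambda>m. \<Sum>q'\<in>leaves k k0 q0. (real (pts K k q' m))\<^sup>2)"
    unfolding avg_sum using leaves_subset[of k k0 q0] q k
    by (intro sum.cong refl avg_node[where f = "\<lambda>a. (real a)\<^sup>2"]) auto
  also have "\<dots> \<le> avg \<kappa> K n (\<lambda>m. (real (pts K k0 q0 m))\<^sup>2)"
  proof (intro avg_mono)
    fix m :: "('d \<Rightarrow> nat) \<Rightarrow> nat"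
    have "(\<Sum>q'\<in>leaves k k0 q0. (real (pts K k q' m))\<^sup>2) \<le> (\<Sum>q'\<in>leaves k k0 q0. real (pts K k q' m))\<^sup>2"
      by (intro sq) auto
    also have "(\<Sum>q'\<in>leaves k k0 q0. real (pts K k q' m)) = real (pts K k0 q0 m)"
      using pts_sum_leaves[OF k, of m q0] by (simp flip: of_nat_sum)
    finally show "(\<Sum>q'\<in>leaves k k0 q0. (real (pts K k q' m))\<^sup>2) \<le> (real (pts K k0 q0 m))\<^sup>2" .
  qed
  finally show ?thesis .
qed

end

section \<open>The variance as a sum over boundary nodes\<close>

definition dens :: "('d::finite \<Rightarrow> nat) set \<Rightarrow> nat \<Rightarrow> nat \<Rightarrow> ('d \<Rightarrow> nat) \<Rightarrow> real" where
  "dens A K k q = real (card (A \<inter> leaves K k q)) / (2 ^ CARD('d)) ^ (K - k)"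

text \<open>
  The change of the conditional mean of the number of points in \<open>A\<close> when the children of \<open>q\<close> are revealed:
  given the occupation numbers at one level, points are uniformly distributed inside their cubes.
\<close>

definition increment :: "('d::finite \<Rightarrow> nat) set \<Rightarrow> nat \<Rightarrow> nat \<Rightarrow> ('d \<Rightarrow> nat) \<Rightarrow> (('d \<Rightarrow> nat) \<Rightarrow> nat) \<Rightarrow> real" where
  "increment A K k q m = (\<Sum>q'\<in>leaves (Suc k) k q. real (pts K (Suc k) q' m) * (dens A K (Suc k) q' - dens A K k q))"

text \<open>
  The conditional mean of the number of points in \<open>A\<close> given the occupation numbers at level \<open>k\<close>.
\<close>

definition predicted :: "('d::finite \<Rightarrow> nat) set \<Rightarrow> nat \<Rightarrow> nat \<Rightarrow> (('d \<Rightarrow> nat) \<Rightarrow> nat) \<Rightarrow> real" where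
  "predicted A K k m = (\<Sum>q\<in>cells k. real (pts K k q m) * dens A K k q)"

definition mixed :: "('d::finite \<Rightarrow> nat) set \<Rightarrow> nat \<Rightarrow> nat \<Rightarrow> ('d \<Rightarrow> nat) set" where
  "mixed A K k = {q \<in> cells k. A \<inter> leaves K k q \<noteq> {} \<and> \<not> leaves K k q \<subseteq> A}"

lemma card_leaves_real:
  "q \<in> cells k \<Longrightarrow> k \<le> K \<Longrightarrow> real (card (leaves K k (q :: 'd::finite \<Rightarrow> nat))) = (2 ^ CARD('d)) ^ (K - k)"
  by (simp add: card_leaves mult.commute flip: power_mult)

lemma dens_bounds:
  assumes "q \<in> cells k" "k \<le> K"
  shows "0 \<le> dens A K k q" "dens A K k q \<le> 1"
proof -
  have "card (A \<inter> leaves K k q) \<le> card (leaves K k q)" by (intro card_mono) auto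
  then have "real (card (A \<inter> leaves K k q)) \<le> real (card (leaves K k q))" by simp
  then show "dens A K k q \<le> 1" using assms by (simp add: dens_def card_leaves_real)
qed (simp add: dens_def)

lemma sum_dens:
  fixes q :: "'d::finite \<Rightarrow> nat"
  assumes "q \<in> cells k" "k < K"
  shows "(\<Sum>q'\<in>leaves (Suc k) k q. dens A K (Suc k) q') = 2 ^ CARD('d) * dens A K k q"
proof -
  have "A \<inter> leaves K k q = (\<Union>q'\<in>leaves (Suc k) k q. A \<inter> leaves K (Suc k) q')"
    using leaves_UN_leaves[of k "Suc k" K q] assms by auto
  moreover have "card (\<Union>q'\<in>leaves (Suc k) k q. A \<inter> leaves K (Suc k) q') = (\<Sum>q'\<in>leaves (Suc k) k q. card (A \<inter> leaves K (Suc k) q'))"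
    using leaves_disjoint by (intro card_UN_disjoint) (auto simp: leaves_def)
  moreover have "K - k = Suc (K - Suc k)" using assms by simp
  ultimately show ?thesis by (simp add: dens_def flip: sum_divide_distrib of_nat_sum)
qed

text \<open>
  In a cube inside \<open>A\<close> or outside \<open>A\<close> all children have the density of the cube.
\<close>

lemma increment_not_mixed:
  assumes q: "q \<in> cells k" "q \<notin> mixed A K k" and k: "k < K"
  shows "increment A K k q m = 0"
proof -
  have sub: "leaves K (Suc k) q' \<subseteq> leaves K k q" if "q' \<in> leaves (Suc k) k q" for q'
    using leaves_UN_leaves[of k "Suc k" K q] k that by auto
  have "dens A K (Suc k) q' = dens A K k q" if q': "q' \<in> leaves (Suc k) k q" for q'
  proof (cases "A \<inter> leaves K k q = {}")
    case True
    then have "A \<inter> leaves K (Suc k) q' = {}" using sub[OF q'] by auto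
    then show ?thesis using True by (simp add: dens_def)
  next
    case False
    then have "leaves K k q \<subseteq> A" using q by (auto simp: mixed_def)
    then have "A \<inter> leaves K (Suc k) q' = leaves K (Suc k) q'" "A \<inter> leaves K k q = leaves K k q" using sub[OF q'] by auto
    moreover have "q' \<in> cells (Suc k)" using q' by (auto simp: leaves_def)
    ultimately show ?thesis using q k by (simp add: dens_def card_leaves_real)
  qed
  then show ?thesis by (simp add: increment_def)
qed

lemma increment_centered:
  fixes q :: "'d::finite \<Rightarrow> nat"
  assumes "q \<in> cells k" "k < K"
  shows "increment A K k q m = (\<Sum>q'\<in>leaves (Suc k) k q. (real (pts K (Suc k) q' m) - real (pts K k q m) / 2 ^ CARD('d)) * (dens A K (Suc k) q' - dens A K k q))"
proof -
  have card: "real (card (leaves (Suc k) k q)) = 2 ^ CARD('d)"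
    using card_leaves_real[of q k "Suc k"] assms by simp
  have "(\<Sum>q'\<in>leaves (Suc k) k q. (dens A K (Suc k) q' - dens A K k q)) = 0"
    using card by (simp add: sum_subtractf sum_dens[OF assms])
  then have "(\<Sum>q'\<in>leaves (Suc k) k q. real (pts K k q m) / 2 ^ CARD('d) * (dens A K (Suc k) q' - dens A K k q)) = 0"
    by (simp only: sum_distrib_left[symmetric] mult_zero_right)
  then show ?thesis by (simp add: increment_def left_diff_distrib sum_subtractf)
qed

lemma sum_cells_Suc:
  fixes f :: "('d::finite \<Rightarrow> nat) \<Rightarrow> real"
  shows "(\<Sum>q'\<in>cells (Suc k). f q') = (\<Sum>q\<in>cells k. \<Sum>q'\<in>leaves (Suc k) k q. f q')"
  unfolding leaves_UN[of k "Suc k", OF le_SucI[OF order_refl], symmetric]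
  by (rule sum.UNION_disjoint) (auto simp: leaves_disjoint)

lemma predicted_Suc:
  fixes A :: "('d::finite \<Rightarrow> nat) set"
  assumes "k < K"
  shows "predicted A K (Suc k) m = predicted A K k m + (\<Sum>q\<in>cells k. increment A K k q m)"
proof -
  have "real (pts K k q m) = (\<Sum>q'\<in>leaves (Suc k) k q. real (pts K (Suc k) q' m))" for q
    using assms pts_sum_leaves[of k "Suc k" K m q] by (simp flip: of_nat_sum)
  then show ?thesis
    unfolding predicted_def sum_cells_Suc increment_def sum.distrib[symmetric]
    by (intro sum.cong refl) (simp add: sum_distrib_right right_diff_distrib sum_subtractf)
qed

lemma predicted_0:
  fixes A :: "('d::finite \<Rightarrow> nat) set"
  assumes "A \<subseteq> cells K" "m \<in> occupations (cells K) n"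
  shows "predicted A K 0 m = real n * real (card A) / (2 ^ CARD('d)) ^ K"
proof -
  have l: "leaves K 0 (\<lambda>_. 0) = (cells K :: ('d \<Rightarrow> nat) set)" by (auto simp: leaves_def anc_eq_0)
  then have "A \<inter> leaves K 0 (\<lambda>_. 0) = A" using assms by auto
  then show ?thesis using assms by (simp add: predicted_def dens_def pts_def l) (simp add: occupations_def flip: of_nat_sum)
qed

lemma predicted_K:
  fixes A :: "('d::finite \<Rightarrow> nat) set"
  assumes "A \<subseteq> cells K"
  shows "predicted A K K m = (\<Sum>i\<in>A. real (m i))"
proof -
  have "predicted A K K m = (\<Sum>q\<in>cells K. if q \<in> A then real (m q) else 0)"
    unfolding predicted_def by (intro sum.cong refl) (auto simp: pts_self dens_def leaves_self)
  also have "\<dots> = (\<Sum>i\<in>A. real (m i))" using assms by (simp add: sum.If_cases Int_absorb1)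
  finally show ?thesis .
qed

lemma flip_invariant_predicted:
  assumes "k \<le> K"
  shows "flip_invariant K k p (predicted A K k)"
  unfolding flip_invariant_def predicted_def using assms by (simp add: pts_flip_le)

lemma flip_invariant_increment:
  fixes p q :: "'d::finite \<Rightarrow> nat"
  assumes k: "k < K" and pq: "p \<noteq> q"
  shows "flip_invariant K k p (increment A K k q)"
  unfolding flip_invariant_def increment_def
proof (intro allI ballI sum.cong refl arg_cong2[where f = "(*)"] arg_cong[where f = real])
  fix m and b q' :: "'d \<Rightarrow> nat" assume b: "b \<in> cells (K - k)" and q': "q' \<in> leaves (Suc k) k q"
  have "flip (Suc k) k {p} (anc (K - Suc k) b) q' = q'"
    using q' pq by (simp add: flip_def leaves_def)
  then show "pts K (Suc k) q' (\<lambda>i. m (flip K k {p} b i)) = pts K (Suc k) q' m"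
    using k b by (simp add: pts_flip_ge)
qed

text \<open>
  All children of \<open>q\<close> have the same correlation with \<open>G\<close>, and their density deviations sum to zero.
\<close>

lemma increment_orthogonal:
  fixes q :: "'d::finite \<Rightarrow> nat"
  assumes q: "q \<in> cells k" and k: "k < K" and G: "flip_invariant K k q G"
  shows "avg \<kappa> K n (\<lambda>m. increment A K k q m * G m) = 0"
proof -
  let ?ch = "leaves (Suc k) k q"
  have card: "real (card ?ch) = 2 ^ CARD('d)" using card_leaves_real[of q k "Suc k"] assms by simp
  then have "?ch \<noteq> {}" by (intro notI) simp
  then obtain c where c: "c \<in> ?ch" by auto
  have "avg \<kappa> K n (\<lambda>m. increment A K k q m * G m)
     = (\<Sum>q'\<in>?ch. (dens A K (Suc k) q' - dens A K k q) * avg \<kappa> K n (\<lambda>m. real (pts K (Suc k) q' m) * G m))"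
    unfolding increment_def sum_distrib_right avg_sum avg_cmult[symmetric]
    by (intro sum.cong refl avg_cong) simp
  also have "\<dots> = (\<Sum>q'\<in>?ch. (dens A K (Suc k) q' - dens A K k q) * avg \<kappa> K n (\<lambda>m. real (pts K (Suc k) c m) * G m))"
  proof (rule sum.cong[OF refl])
    fix q' assume q': "q' \<in> ?ch"
    have "avg \<kappa> K n (\<lambda>m. real (pts K (Suc k) q' m) * G m) = avg \<kappa> K n (\<lambda>m. real (pts K (Suc k) c m) * G m)"
      using k by (intro avg_move[where \<Phi> = "\<lambda>a g. real a * g", OF _ _ q' c G]) auto
    then show "(dens A K (Suc k) q' - dens A K k q) * avg \<kappa> K n (\<lambda>m. real (pts K (Suc k) q' m) * G m)
        = (dens A K (Suc k) q' - dens A K k q) * avg \<kappa> K n (\<lambda>m. real (pts K (Suc k) c m) * G m)" by simp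
  qed
  also have "\<dots> = 0" using card by (simp add: sum_subtractf sum_dens[OF q k] flip: sum_distrib_right)
  finally show ?thesis .
qed

lemma variance_decomposition:
  fixes A :: "('d::finite \<Rightarrow> nat) set"
  assumes A: "A \<subseteq> cells K" and k: "k \<le> K" and e: "e = real n * real (card A) / (2 ^ CARD('d)) ^ K"
  shows "avg \<kappa> K n (\<lambda>m. (predicted A K k m - e)\<^sup>2) = (\<Sum>j<k. \<Sum>q\<in>mixed A K j. avg \<kappa> K n (\<lambda>m. (increment A K j q m)\<^sup>2))"
  using k
proof (induction k)
  case 0
  have "avg \<kappa> K n (\<lambda>m. (predicted A K 0 m - e)\<^sup>2) = avg \<kappa> K n (\<lambda>_ :: ('d \<Rightarrow> nat) \<Rightarrow> nat. 0)"
    by (intro avg_cong) (simp add: predicted_0[OF A] e)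
  then show ?case by simp
next
  case (Suc k)
  then have k: "k < K" by simp
  let ?I = "increment A K k" and ?F = "\<lambda>m. predicted A K k m - e"
  have F: "flip_invariant K k q ?F" for q
    using flip_invariant_predicted[of k K q A] k by (simp add: flip_invariant_def)
  have "(predicted A K (Suc k) m - e)\<^sup>2 = (?F m)\<^sup>2 + 2 * (\<Sum>q\<in>cells k. ?I q m * ?F m) + (\<Sum>q\<in>cells k. \<Sum>p\<in>cells k. ?I q m * ?I p m)" for m
    unfolding predicted_Suc[OF k] sum_product[symmetric] sum_distrib_right[symmetric]
    by (simp add: power2_eq_square algebra_simps)
  then have "avg \<kappa> K n (\<lambda>m. (predicted A K (Suc k) m - e)\<^sup>2)
     = avg \<kappa> K n (\<lambda>m. (?F m)\<^sup>2) + 2 * (\<Sum>q\<in>cells k. avg \<kappa> K n (\<lambda>m. ?I q m * ?F m)) + (\<Sum>q\<in>cells k. \<Sum>p\<in>cells k. avg \<kappa> K n (\<lambda>m. ?I q m * ?I p m))"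
    by (simp only: avg_add avg_cmult avg_sum)
  also have "(\<Sum>q\<in>cells k. avg \<kappa> K n (\<lambda>m. ?I q m * ?F m)) = 0"
    by (intro sum.neutral ballI increment_orthogonal k F)
  also have "(\<Sum>q\<in>cells k. \<Sum>p\<in>cells k. avg \<kappa> K n (\<lambda>m. ?I q m * ?I p m)) = (\<Sum>q\<in>cells k. \<Sum>p\<in>cells k. if p = q then avg \<kappa> K n (\<lambda>m. (?I q m)\<^sup>2) else 0)"
    by (intro sum.cong refl) (auto simp: power2_eq_square intro!: increment_orthogonal flip_invariant_increment k)
  also have "\<dots> = (\<Sum>q\<in>cells k. avg \<kappa> K n (\<lambda>m. (?I q m)\<^sup>2))" by simp
  also have "\<dots> = (\<Sum>q\<in>mixed A K k. avg \<kappa> K n (\<lambda>m. (?I q m)\<^sup>2))"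
    by (rule sum.mono_neutral_right) (auto simp: mixed_def increment_not_mixed k)
  finally show ?case using Suc by simp
qed

lemma increment_second_moment:
  fixes q :: "'d::finite \<Rightarrow> nat"
  assumes q: "q \<in> cells k" and k: "k < K"
    and B: "\<And>q'. q' \<in> leaves (Suc k) k q \<Longrightarrow> avg \<kappa> K n (\<lambda>m. (real (pts K (Suc k) q' m) - real (pts K k q m) / 2 ^ CARD('d))\<^sup>2) \<le> B"
  shows "avg \<kappa> K n (\<lambda>m. (increment A K k q m)\<^sup>2) \<le> (2 ^ CARD('d))\<^sup>2 * B"
proof -
  let ?ch = "leaves (Suc k) k q"
  let ?x = "\<lambda>q' m. real (pts K (Suc k) q' m) - real (pts K k q m) / 2 ^ CARD('d)"
  have card: "real (card ?ch) = 2 ^ CARD('d)" using card_leaves_real[of q k "Suc k"] assms by simp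
  have "avg \<kappa> K n (\<lambda>m. (increment A K k q m)\<^sup>2) \<le> avg \<kappa> K n (\<lambda>m. 2 ^ CARD('d) * (\<Sum>q'\<in>?ch. (?x q' m)\<^sup>2))"
  proof (intro avg_mono)
    fix m :: "('d \<Rightarrow> nat) \<Rightarrow> nat"
    have "(increment A K k q m)\<^sup>2 \<le> (\<Sum>q'\<in>?ch. (?x q' m * (dens A K (Suc k) q' - dens A K k q))\<^sup>2) * real (card ?ch)"
      unfolding increment_centered[OF q k] by (rule sum_squared_le_sum_of_squares)
    also have "\<dots> \<le> (\<Sum>q'\<in>?ch. (?x q' m)\<^sup>2) * real (card ?ch)"
    proof (intro mult_right_mono sum_mono)
      fix q' assume "q' \<in> ?ch"
      then have q': "q' \<in> cells (Suc k)" by (auto simp: leaves_def)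
      have "\<bar>dens A K (Suc k) q' - dens A K k q\<bar> \<le> 1"
        using dens_bounds[OF q', of K A] dens_bounds[OF q, of K A] k by (auto simp: abs_le_iff)
      then have "(dens A K (Suc k) q' - dens A K k q)\<^sup>2 \<le> 1" by (simp add: abs_square_le_1)
      then show "(?x q' m * (dens A K (Suc k) q' - dens A K k q))\<^sup>2 \<le> (?x q' m)\<^sup>2"
        by (simp add: power_mult_distrib mult_left_le)
    qed auto
    finally show "(increment A K k q m)\<^sup>2 \<le> 2 ^ CARD('d) * (\<Sum>q'\<in>?ch. (?x q' m)\<^sup>2)"
      by (simp add: card mult.commute)
  qed
  also have "\<dots> = 2 ^ CARD('d) * (\<Sum>q'\<in>?ch. avg \<kappa> K n (\<lambda>m. (?x q' m)\<^sup>2))"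
    by (simp only: avg_cmult avg_sum)
  also have "\<dots> \<le> 2 ^ CARD('d) * (\<Sum>q'\<in>?ch. B)" by (intro mult_left_mono sum_mono B) auto
  also have "\<dots> = (2 ^ CARD('d))\<^sup>2 * B" using card by (simp add: power2_eq_square)
  finally show ?thesis .
qed

text \<open>
  The terms grow at least by the factor two up to level \<open>K0\<close> and are halved at each level after it.
\<close>

lemma surface_sum_le:
  fixes x :: real
  assumes "2 \<le> x"
  shows "(\<Sum>k<K. x ^ k * (if k < K0 then 1 else 1 / (2 * x) ^ (k - K0))) \<le> 3 * x ^ K0"
proof -
  \<comment> \<open>The subtracted term is twice the next summand, which makes the bound inductive.\<close>
  have "(\<Sum>k<K. x ^ k * (if k < K0 then 1 else 1 / (2 * x) ^ (k - K0))) \<le> (if K \<le> K0 then x ^ K else x ^ K0 * (3 - 2 * (1/2) ^ (K - K0)))"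
  proof (induction K)
    case 0 then show ?case by simp
  next
    case (Suc K)
    consider "Suc K \<le> K0" | "K0 \<le> K" by linarith
    then show ?case
    proof cases
      case 1
      then have "(\<Sum>k<Suc K. x ^ k * (if k < K0 then 1 else 1 / (2 * x) ^ (k - K0))) \<le> x ^ K + x ^ K" using Suc by simp
      also have "\<dots> \<le> x ^ Suc K" using assms by (simp add: mult_right_mono)
      finally show ?thesis using 1 by simp
    next
      case 2
      have "x ^ K * (1 / (2 * x) ^ (K - K0)) = x ^ K0 * (1/2) ^ (K - K0)"
      proof -
        have "x ^ K = x ^ K0 * x ^ (K - K0)" using 2 by (simp flip: power_add)
        then show ?thesis using assms by (simp add: power_mult_distrib power_divide)
      qed
      moreover have "(\<Sum>k<K. x ^ k * (if k < K0 then 1 else 1 / (2 * x) ^ (k - K0))) \<le> x ^ K0 * (3 - 2 * (1/2) ^ (K - K0))"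
        using Suc 2 by (cases "K = K0") auto
      ultimately have "(\<Sum>k<Suc K. x ^ k * (if k < K0 then 1 else 1 / (2 * x) ^ (k - K0))) \<le> x ^ K0 * (3 - (1/2) ^ (K - K0))"
        using 2 by (simp add: algebra_simps)
      then show ?thesis using 2 by (simp add: Suc_diff_le)
    qed
  qed
  also have "\<dots> \<le> 3 * x ^ K0"
  proof (cases "K \<le> K0")
    case True
    then have "x ^ K \<le> x ^ K0" using assms by (intro power_increasing) auto
    moreover have "0 \<le> x ^ K0" using assms by simp
    ultimately show ?thesis using True by simp
  next
    case False
    have "x ^ K0 * (3 - 2 * (1/2) ^ (K - K0)) \<le> x ^ K0 * 3" using assms by (intro mult_left_mono) auto
    then show ?thesis using False by (simp add: mult.commute)
  qed
  finally show ?thesis .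
qed

context hierarchical_model
begin

definition unit_mean_bound :: "real \<Rightarrow> real" where "unit_mean_bound M = 8 * sibling_bound + 2 * M\<^sup>2"

lemma mean_one_second_moment:
  fixes q :: "'d::finite \<Rightarrow> nat"
  assumes k: "k \<le> K" and q: "q \<in> cells k" and n: "n < (2 ^ CARD('d)) ^ Suc k"
  shows "avg \<kappa> K n (\<lambda>m. (real (pts K k q m))\<^sup>2) \<le> unit_mean_bound (2 ^ CARD('d))"
proof -
  have "real n < (2 ^ CARD('d)) ^ Suc k" using n by (metis of_nat_less_iff of_nat_numeral of_nat_power)
  then have "real n / (2 ^ CARD('d)) ^ k \<le> 2 ^ CARD('d)" by (simp add: field_simps)
  then have "(real n / (2 ^ CARD('d)) ^ k)\<^sup>2 \<le> (2 ^ CARD('d))\<^sup>2" by (intro power_mono) auto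
  then show ?thesis using node_second_moment[OF k q, of n] unfolding unit_mean_bound_def by linarith
qed

text \<open>
  Let \<open>K0\<close> be the level at which the expected number of points of a cube lies between \<open>1\<close> and \<open>2\<^sup>d\<close>.  A
  mixed node above \<open>K0\<close> contributes a bounded amount by lemma \<open>child_dev\<close>; below \<open>K0\<close> its contribution is at most a
  multiple of its second moment, which decays by \<open>2\<^sup>-\<^sup>d\<close> per level.
\<close>

lemma surface_variance_bound:
  fixes A :: "('d::finite \<Rightarrow> nat) set"
  assumes d: "2 \<le> CARD('d)" and A: "A \<subseteq> cells K" and n: "1 \<le> n"
    and mixed: "\<And>k. k \<le> K \<Longrightarrow> real (card (mixed A K k)) \<le> Cb * (2 ^ (CARD('d) - 1)) ^ k"
    and Cb: "0 \<le> Cb"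
  shows "avg \<kappa> K n (\<lambda>m. ((\<Sum>i\<in>A. real (m i)) - real n * real (card A) / (2 ^ CARD('d)) ^ K)\<^sup>2)
     \<le> 3 * (2 ^ CARD('d))\<^sup>2 * unit_mean_bound (2 ^ CARD('d)) * Cb * real n powr ((real CARD('d) - 1) / real CARD('d))"
proof -
  let ?M = "2 ^ CARD('d) :: real"
  let ?x = "2 ^ (CARD('d) - 1) :: real"
  have Mx: "?M = 2 * ?x" using d by (simp flip: power_Suc)
  have M1: "2 \<le> (2::nat) ^ CARD('d)" using power_increasing[of 1 "CARD('d)" "2::nat"] d by simp
  obtain K0 where K0: "(2 ^ CARD('d)) ^ K0 \<le> n" "n < (2 ^ CARD('d)) ^ Suc K0"
    using ex_power_ivl1[OF M1 n] by auto
  have unit_mean_bound: "sibling_bound \<le> unit_mean_bound ?M" "0 \<le> unit_mean_bound ?M" using sibling_bound_ge by (auto simp: unit_mean_bound_def intro!: add_increasing2)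
  define g where "g k = (if k < K0 then 1 else 1 / ?M ^ (k - K0))" for k
  have g0: "0 \<le> g k" for k by (simp add: g_def)
  have inc: "avg \<kappa> K n (\<lambda>m. (increment A K k q m)\<^sup>2) \<le> ?M\<^sup>2 * (unit_mean_bound ?M * g k)" if k: "k < K" and q: "q \<in> cells k" for k and q :: "'d \<Rightarrow> nat"
  proof (rule increment_second_moment[OF q k])
    fix q' assume q': "q' \<in> leaves (Suc k) k q"
    show "avg \<kappa> K n (\<lambda>m. (real (pts K (Suc k) q' m) - real (pts K k q m) / ?M)\<^sup>2) \<le> unit_mean_bound ?M * g k"
    proof (cases "k < K0")
      case True
      then show ?thesis using child_dev[OF k q q', of n] unit_mean_bound by (simp add: g_def)
    next
      case False
      define q0 where "q0 = anc (k - K0) q"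
      have q0: "q0 \<in> cells K0" using q False anc_in_cells[of q K0 "k - K0"] by (simp add: q0_def)
      have "avg \<kappa> K n (\<lambda>m. (real (pts K (Suc k) q' m) - real (pts K k q m) / ?M)\<^sup>2) \<le> avg \<kappa> K n (\<lambda>m. (real (pts K k q m))\<^sup>2)"
      proof (intro avg_mono)
        fix m :: "('d \<Rightarrow> nat) \<Rightarrow> nat"
        have "pts K (Suc k) q' m \<le> (\<Sum>q'\<in>leaves (Suc k) k q. pts K (Suc k) q' m)"
          using q' by (intro member_le_sum) auto
        also have "\<dots> = pts K k q m" using k by (intro pts_sum_leaves) auto
        finally have le: "real (pts K (Suc k) q' m) \<le> real (pts K k q m)" by simp
        have le': "real (pts K k q m) / ?M \<le> real (pts K k q m)"
          using M1 by (simp add: divide_le_eq mult_left_le_one_le) (simp add: mult_le_cancel_left1 one_le_power)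
        have ge': "0 \<le> real (pts K k q m) / ?M" by simp
        have ge: "0 \<le> real (pts K (Suc k) q' m)" by simp
        have "\<bar>real (pts K (Suc k) q' m) - real (pts K k q m) / ?M\<bar> \<le> real (pts K k q m)"
          unfolding abs_le_iff using le le' ge ge' by (intro conjI; linarith)
        then show "(real (pts K (Suc k) q' m) - real (pts K k q m) / ?M)\<^sup>2 \<le> (real (pts K k q m))\<^sup>2"
          by (metis abs_le_square_iff abs_of_nat)
      qed
      also have "\<dots> \<le> avg \<kappa> K n (\<lambda>m. (real (pts K K0 q0 m))\<^sup>2) / ?M ^ (k - K0)"
        using deep_second_moment[of K0 k K q q0 n] False k q q0 by (simp add: pos_le_divide_eq mult.commute)
      also have "\<dots> \<le> unit_mean_bound ?M / ?M ^ (k - K0)"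
        using mean_one_second_moment[OF _ q0 K0(2)] k False by (intro divide_right_mono) auto
      finally show ?thesis using False by (simp add: g_def)
    qed
  qed
  have "avg \<kappa> K n (\<lambda>m. ((\<Sum>i\<in>A. real (m i)) - real n * real (card A) / ?M ^ K)\<^sup>2)
     = (\<Sum>k<K. \<Sum>q\<in>mixed A K k. avg \<kappa> K n (\<lambda>m. (increment A K k q m)\<^sup>2))"
    using variance_decomposition[OF A order_refl refl, of \<kappa> n] by (simp add: predicted_K[OF A])
  also have "\<dots> \<le> (\<Sum>k<K. \<Sum>q\<in>mixed A K k. ?M\<^sup>2 * (unit_mean_bound ?M * g k))"
    by (intro sum_mono inc) (auto simp: mixed_def)
  also have "\<dots> = (\<Sum>k<K. real (card (mixed A K k)) * (?M\<^sup>2 * (unit_mean_bound ?M * g k)))" by simp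
  also have "\<dots> \<le> (\<Sum>k<K. (Cb * ?x ^ k) * (?M\<^sup>2 * (unit_mean_bound ?M * g k)))"
    using unit_mean_bound g0 by (intro sum_mono mult_right_mono mixed) (auto intro!: mult_nonneg_nonneg)
  also have "\<dots> = ?M\<^sup>2 * unit_mean_bound ?M * Cb * (\<Sum>k<K. ?x ^ k * g k)"
    by (simp add: sum_distrib_left ac_simps)
  also have "\<dots> \<le> ?M\<^sup>2 * unit_mean_bound ?M * Cb * (3 * ?x ^ K0)"
  proof (intro mult_left_mono)
    have "2 \<le> ?x" using power_increasing[of 1 "CARD('d) - 1" "2::real"] d by simp
    from surface_sum_le[OF this, of K0 K] show "(\<Sum>k<K. ?x ^ k * g k) \<le> 3 * ?x ^ K0"
      unfolding g_def Mx by simp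
  qed (use unit_mean_bound Cb in auto)
  also have "?x ^ K0 \<le> real n powr ((real CARD('d) - 1) / real CARD('d))"
  proof -
    have "?x ^ K0 = (?M ^ K0) powr ((real CARD('d) - 1) / real CARD('d))"
    proof -
      have "?M ^ K0 = 2 powr real (CARD('d) * K0)"
        by (simp only: powr_realpow[OF zero_less_numeral] power_mult)
      moreover have "?x ^ K0 = 2 powr real ((CARD('d) - 1) * K0)"
        by (simp only: powr_realpow[OF zero_less_numeral] power_mult)
      moreover have "real ((CARD('d) - 1) * K0) = real (CARD('d) * K0) * ((real CARD('d) - 1) / real CARD('d))"
        using d by (simp add: of_nat_diff)
      ultimately show ?thesis by (simp only: powr_powr)
    qed
    also have "?M ^ K0 \<le> real n" using K0(1) by (metis of_nat_le_iff of_nat_numeral of_nat_power)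
    then have "(?M ^ K0) powr ((real CARD('d) - 1) / real CARD('d)) \<le> real n powr ((real CARD('d) - 1) / real CARD('d))"
      using d by (intro powr_mono2) auto
    finally show ?thesis .
  qed
  then have "?M\<^sup>2 * unit_mean_bound ?M * Cb * (3 * ?x ^ K0) \<le> ?M\<^sup>2 * unit_mean_bound ?M * Cb * (3 * real n powr ((real CARD('d) - 1) / real CARD('d)))"
    using unit_mean_bound Cb by (intro mult_left_mono) auto
  finally show ?thesis by (simp add: ac_simps)
qed

end

section \<open>Anti-concentration in the discrete model\<close>

text \<open>
  A sum with signs \<open>\<plusminus>1\<close>; uniform choice of the subset \<open>S\<close> makes the signs independent and fair.
\<close>

definition signed :: "('a \<Rightarrow> real) \<Rightarrow> 'a set \<Rightarrow> 'a set \<Rightarrow> real" where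
  "signed r G S = (\<Sum>x\<in>G. if x \<in> S then - r x else r x)"

lemma sum_Pow_insert:
  fixes f :: "'a set \<Rightarrow> real"
  assumes "finite G" "x \<notin> G"
  shows "(\<Sum>S\<in>Pow (insert x G). f S) = (\<Sum>S\<in>Pow G. f S + f (insert x S))"
proof -
  have "inj_on (insert x) (Pow G)" using assms by (intro inj_onI) (metis Diff_insert_absorb PowD subset_iff)
  moreover have "Pow G \<inter> insert x ` Pow G = {}" using assms by auto
  ultimately show ?thesis using assms
    by (simp add: Pow_insert sum.union_disjoint sum.reindex sum.distrib)
qed

lemma signed_insert:
  assumes "finite G" "x \<notin> G" "S \<subseteq> G"
  shows "signed r (insert x G) S = signed r G S + r x" "signed r (insert x G) (insert x S) = signed r G S - r x"
proof -
  have "(\<Sum>y\<in>G. if y \<in> insert x S then - r y else r y) = signed r G S"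
    unfolding signed_def using assms by (intro sum.cong) auto
  then show "signed r (insert x G) S = signed r G S + r x" "signed r (insert x G) (insert x S) = signed r G S - r x"
    using assms by (auto simp: signed_def)
qed

lemma signed_moments:
  assumes "finite G"
  shows "(\<Sum>S\<in>Pow G. (signed r G S)\<^sup>2) = 2 ^ card G * (\<Sum>x\<in>G. (r x)\<^sup>2)"
    and "(\<Sum>S\<in>Pow G. (signed r G S) ^ 4) \<le> 2 ^ card G * (3 * (\<Sum>x\<in>G. (r x)\<^sup>2)\<^sup>2)"
    and "(\<Sum>S\<in>Pow G. signed r G S) = 0"
  using assms
proof (induction G rule: finite_induct)
  case empty
  { case 1 then show ?case by (simp add: signed_def)
  next case 2 then show ?case by (simp add: signed_def)
  next case 3 then show ?case by (simp add: signed_def) }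
next
  case (insert x G)
  define V where "V = (\<Sum>y\<in>G. (r y)\<^sup>2)"
  have e: "(\<Sum>S\<in>Pow (insert x G). f (signed r (insert x G) S)) = (\<Sum>S\<in>Pow G. f (signed r G S + r x) + f (signed r G S - r x))" for f :: "real \<Rightarrow> real"
    unfolding sum_Pow_insert[OF insert(1,2)]
    by (intro sum.cong refl) (simp add: signed_insert[OF insert(1,2)])
  have c: "real (card (Pow G)) = 2 ^ card G" using insert by (simp add: card_Pow)
  { case 1
    have "(\<Sum>S\<in>Pow (insert x G). (signed r (insert x G) S)\<^sup>2) = (\<Sum>S\<in>Pow G. 2 * (signed r G S)\<^sup>2 + 2 * (r x)\<^sup>2)"
      unfolding e[of "\<lambda>t. t\<^sup>2"] by (intro sum.cong refl) (simp add: power2_sum power2_diff)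
    also have "\<dots> = 2 * (2 ^ card G * V) + 2 ^ card G * (2 * (r x)\<^sup>2)"
      using insert.IH(1) c by (simp add: sum.distrib V_def flip: sum_distrib_left)
    finally show ?case using insert by (simp add: V_def algebra_simps)
  next
    case 2
    have "(\<Sum>S\<in>Pow (insert x G). (signed r (insert x G) S) ^ 4) = (\<Sum>S\<in>Pow G. 2 * (signed r G S) ^ 4 + 12 * (r x)\<^sup>2 * (signed r G S)\<^sup>2 + 2 * (r x) ^ 4)"
      unfolding e[of "\<lambda>t. t ^ 4"] by (intro sum.cong refl) (simp add: power4_eq_xxxx power2_eq_square algebra_simps)
    also have "\<dots> = 2 * (\<Sum>S\<in>Pow G. (signed r G S) ^ 4) + 12 * (r x)\<^sup>2 * (2 ^ card G * V) + 2 ^ card G * (2 * (r x) ^ 4)"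
      using insert.IH(1) c by (simp add: sum.distrib V_def flip: sum_distrib_left)
    also have "\<dots> \<le> 2 * (2 ^ card G * (3 * V\<^sup>2)) + 12 * (r x)\<^sup>2 * (2 ^ card G * V) + 2 ^ card G * (6 * (r x) ^ 4)"
      using insert.IH(2) by (intro add_mono mult_left_mono) (auto simp: V_def)
    also have "\<dots> = 2 ^ Suc (card G) * (3 * (V + (r x)\<^sup>2)\<^sup>2)"
      by (simp add: power2_eq_square power4_eq_xxxx algebra_simps)
    finally show ?case using insert by (simp add: V_def add.commute)
  next
    case 3
    show ?case unfolding e[of "\<lambda>t. t"] using insert.IH(3) by (simp flip: sum_distrib_left) }
qed

text \<open>
  An interval that is short compared with the standard deviation cannot carry almost all mass.
  Otherwise the second moment \<open>W\<close> about its midpoint would come from a set of small probability, against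
  the bound \<open>24 W\<^sup>2\<close> for the fourth moment.
\<close>

lemma signed_anticoncentration:
  fixes v :: real
  assumes G: "finite G" and V: "V = (\<Sum>x\<in>G. (r x)\<^sup>2)" and Vp: "0 < V" and ab: "(b - a)\<^sup>2 \<le> V" "a \<le> b"
  shows "(\<Sum>S\<in>Pow G. if a \<le> v + signed r G S \<and> v + signed r G S \<le> b then 1 else 0) \<le> 2 ^ card G * (47/48 :: real)"
proof -
  define \<delta> where "\<delta> = v - (a + b) / 2"
  define W where "W = V + \<delta>\<^sup>2"
  define T where "T S = signed r G S + \<delta>" for S
  define I where "I S = (if a \<le> v + signed r G S \<and> v + signed r G S \<le> b then 1 else 0 :: real)" for S
  let ?N = "2 ^ card G :: real"
  have Wp: "0 < W" using Vp by (simp add: W_def add_pos_nonneg)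
  have c: "real (card (Pow G)) = ?N" using G by (simp add: card_Pow)
  have m2: "(\<Sum>S\<in>Pow G. (T S)\<^sup>2) = ?N * W"
  proof -
    have "(\<Sum>S\<in>Pow G. (T S)\<^sup>2) = (\<Sum>S\<in>Pow G. (signed r G S)\<^sup>2 + 2 * \<delta> * signed r G S + \<delta>\<^sup>2)"
      by (intro sum.cong refl) (simp add: T_def power2_sum)
    also have "\<dots> = ?N * V + 2 * \<delta> * 0 + ?N * \<delta>\<^sup>2"
      using signed_moments[OF G, of r] c by (simp add: sum.distrib V flip: sum_distrib_left)
    finally show ?thesis by (simp add: W_def distrib_left)
  qed
  have m4: "(\<Sum>S\<in>Pow G. (T S) ^ 4) \<le> ?N * (24 * W\<^sup>2)"
  proof -
    have "(\<Sum>S\<in>Pow G. (T S) ^ 4) \<le> (\<Sum>S\<in>Pow G. 8 * (signed r G S) ^ 4 + 8 * \<delta> ^ 4)"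
    proof (intro sum_mono)
      fix S
      have "(x + y) ^ 4 \<le> 8 * x ^ 4 + 8 * y ^ 4" for x y :: real
      proof -
        have "(x + y) ^ 4 = ((x + y)\<^sup>2)\<^sup>2" by simp
        also have "\<dots> \<le> (2 * x\<^sup>2 + 2 * y\<^sup>2)\<^sup>2" by (intro power_mono square_sum_le) auto
        also have "\<dots> \<le> 2 * (2 * x\<^sup>2)\<^sup>2 + 2 * (2 * y\<^sup>2)\<^sup>2" by (rule square_sum_le)
        finally show ?thesis by (simp add: power_mult_distrib)
      qed
      then show "(T S) ^ 4 \<le> 8 * (signed r G S) ^ 4 + 8 * \<delta> ^ 4" by (simp add: T_def)
    qed
    also have "\<dots> = 8 * (\<Sum>S\<in>Pow G. (signed r G S) ^ 4) + ?N * (8 * \<delta> ^ 4)"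
      using c by (simp add: sum.distrib flip: sum_distrib_left)
    also have "\<dots> \<le> 8 * (?N * (3 * V\<^sup>2)) + ?N * (24 * \<delta> ^ 4)"
      using signed_moments(2)[OF G, of r] by (intro add_mono mult_left_mono) (auto simp: V)
    also have "\<dots> = ?N * (24 * (V\<^sup>2 + \<delta> ^ 4))" by (simp add: algebra_simps)
    also have "V\<^sup>2 + \<delta> ^ 4 \<le> W\<^sup>2"
      using Vp by (simp add: W_def power2_sum flip: power_mult)
    finally show ?thesis by simp
  qed
  \<comment> \<open>On the interval the square is at most \<open>W / 4\<close>; elsewhere the inequality of arithmetic and geometric
    means trades it against the fourth power.  The constants leave \<open>12 (1 - P) \<ge> 1 / 4\<close>.\<close>
  have "(T S)\<^sup>2 \<le> W / 4 + ((T S) ^ 4 / (48 * W) + 12 * W * (1 - I S))" for S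
  proof (cases "I S = 1")
    case True
    then have "a \<le> v + signed r G S" "v + signed r G S \<le> b" by (auto simp: I_def split: if_splits)
    then have "\<bar>T S\<bar> \<le> (b - a) / 2" unfolding abs_le_iff T_def \<delta>_def by (simp add: field_simps)
    then have "(T S)\<^sup>2 \<le> ((b - a) / 2)\<^sup>2" by (metis abs_ge_zero power2_abs power_mono)
    also have "\<dots> \<le> W / 4" using ab by (simp add: W_def power_divide add_increasing2)
    finally show ?thesis using True Wp zero_le_power[of "(T S)\<^sup>2" 2] by (simp add: add_increasing2)
  next
    case False
    then have "I S = 0" by (auto simp: I_def split: if_splits)
    moreover have "(T S)\<^sup>2 \<le> (T S) ^ 4 / (48 * W) + 12 * W"
    proof -
      have "0 \<le> ((T S)\<^sup>2 - 24 * W)\<^sup>2 / (48 * W)" using Wp by simp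
      also have "\<dots> = (T S) ^ 4 / (48 * W) - (T S)\<^sup>2 + 12 * W"
        using Wp by (simp add: power2_diff power2_eq_square power4_eq_xxxx field_simps)
      finally show ?thesis by simp
    qed
    ultimately show ?thesis using Wp by simp
  qed
  then have "(\<Sum>S\<in>Pow G. (T S)\<^sup>2) \<le> (\<Sum>S\<in>Pow G. W / 4 + ((T S) ^ 4 / (48 * W) + 12 * W * (1 - I S)))"
    by (intro sum_mono)
  also have "\<dots> = ?N * (W / 4) + (\<Sum>S\<in>Pow G. (T S) ^ 4) / (48 * W) + 12 * W * (?N - (\<Sum>S\<in>Pow G. I S))"
    using c by (simp add: sum.distrib sum_subtractf flip: sum_distrib_left sum_divide_distrib)
  also have "\<dots> \<le> ?N * (W / 4) + ?N * (24 * W\<^sup>2) / (48 * W) + 12 * W * (?N - (\<Sum>S\<in>Pow G. I S))"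
    using m4 Wp by (intro add_mono divide_right_mono) auto
  also have "\<dots> = W * (?N * (3/4) + 12 * (?N - (\<Sum>S\<in>Pow G. I S)))"
    using Wp by (simp add: power2_eq_square field_simps)
  finally have "W * ?N \<le> W * (?N * (3/4) + 12 * (?N - (\<Sum>S\<in>Pow G. I S)))" by (simp add: m2 mult.commute)
  then have "?N \<le> ?N * (3/4) + 12 * (?N - (\<Sum>S\<in>Pow G. I S))" using Wp by simp
  then have "(\<Sum>S\<in>Pow G. I S) \<le> ?N * (47/48)" by simp
  then show ?thesis by (simp add: I_def)
qed

context hierarchical_model
begin

text \<open>
  The expected number of pairs in a cube splits into pairs in the same child and pairs in different
  children.  By lemma \<open>sibling_diff\<close>, for strong interaction, pairs in a given child are not more frequent than pairs
  in two given different children.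
\<close>

lemma pair_decay:
  fixes q :: "'d::finite \<Rightarrow> nat"
  assumes k: "k < K" and deep: "exp (- \<kappa> (Suc k) / 2) \<le> 1/8" and q: "q \<in> cells k" and c: "c \<in> leaves (Suc k) k q"
  shows "(2 ^ CARD('d))\<^sup>2 * avg \<kappa> K n (\<lambda>m. (real (pts K (Suc k) c m))\<^sup>2 - real (pts K (Suc k) c m))
       \<le> avg \<kappa> K n (\<lambda>m. (real (pts K k q m))\<^sup>2 - real (pts K k q m))"
proof -
  let ?ch = "leaves (Suc k) k q"
  let ?N = "\<lambda>c m. real (pts K (Suc k) c m)"
  let ?E = "\<lambda>c. avg \<kappa> K n (\<lambda>m. (?N c m)\<^sup>2 - ?N c m)"
  have card: "real (card ?ch) = 2 ^ CARD('d)" using card_leaves_real[of q k "Suc k"] q by simp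
  have inC: "x \<in> cells (Suc k)" "anc 1 x = q" if "x \<in> ?ch" for x using that by (auto simp: leaves_def)
  have E: "?E x = ?E c" if "x \<in> ?ch" for x
    using avg_node[of "Suc k" K x c \<kappa> n "\<lambda>a. (real a)\<^sup>2 - real a"] k inC that c by auto
  have term_ge: "?E c \<le> avg \<kappa> K n (\<lambda>m. ?N x m * ?N y m - (if x = y then ?N x m else 0))"
    if xy: "x \<in> ?ch" "y \<in> ?ch" for x y
  proof (cases "x = y")
    case True then show ?thesis using E[OF xy(1)] by (simp add: power2_eq_square)
  next
    case False
    have anc: "anc 1 x = anc 1 y" using inC xy by simp
    have "avg \<kappa> K n (\<lambda>m. (?N x m - ?N y m)\<^sup>2) \<le> avg \<kappa> K n (\<lambda>m. ?N x m + ?N y m)"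
      by (rule sibling_diff(2)[OF k inC(1)[OF xy(1)] inC(1)[OF xy(2)] anc deep False])
    moreover have "avg \<kappa> K n (\<lambda>m. (?N x m - ?N y m)\<^sup>2) - avg \<kappa> K n (\<lambda>m. ?N x m + ?N y m)
       = ?E x + ?E y - 2 * avg \<kappa> K n (\<lambda>m. ?N x m * ?N y m)"
      unfolding avg_cmult[symmetric] avg_diff[symmetric] avg_add[symmetric]
      by (intro avg_cong) (simp add: power2_diff)
    ultimately show ?thesis using E[OF xy(1)] E[OF xy(2)] False by simp
  qed
  have "(2 ^ CARD('d))\<^sup>2 * ?E c = (\<Sum>x\<in>?ch. \<Sum>y\<in>?ch. ?E c)" by (simp add: card power2_eq_square)
  also have "\<dots> \<le> (\<Sum>x\<in>?ch. \<Sum>y\<in>?ch. avg \<kappa> K n (\<lambda>m. ?N x m * ?N y m - (if x = y then ?N x m else 0)))"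
    by (intro sum_mono term_ge)
  also have "\<dots> = avg \<kappa> K n (\<lambda>m. \<Sum>x\<in>?ch. \<Sum>y\<in>?ch. ?N x m * ?N y m - (if x = y then ?N x m else 0))"
    by (simp only: avg_sum)
  also have "\<dots> = avg \<kappa> K n (\<lambda>m. (real (pts K k q m))\<^sup>2 - real (pts K k q m))"
  proof (intro avg_cong)
    fix m :: "('d \<Rightarrow> nat) \<Rightarrow> nat"
    have s: "real (pts K k q m) = (\<Sum>x\<in>?ch. ?N x m)"
      using k pts_sum_leaves[of k "Suc k" K m q] by (simp flip: of_nat_sum)
    show "(\<Sum>x\<in>?ch. \<Sum>y\<in>?ch. ?N x m * ?N y m - (if x = y then ?N x m else 0)) = (real (pts K k q m))\<^sup>2 - real (pts K k q m)"
      unfolding s power2_eq_square sum_product sum_subtractf by simp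
  qed
  finally show ?thesis .
qed

lemma pair_decay_iterated:
  fixes q :: "'d::finite \<Rightarrow> nat"
  assumes deep: "\<And>k. K0 < k \<Longrightarrow> exp (- \<kappa> k / 2) \<le> 1/8" and n: "n < (2 ^ CARD('d)) ^ Suc K0"
  shows "K0 + J \<le> K \<Longrightarrow> q \<in> cells (K0 + J) \<Longrightarrow>
     avg \<kappa> K n (\<lambda>m. (real (pts K (K0 + J) q m))\<^sup>2 - real (pts K (K0 + J) q m)) \<le> unit_mean_bound (2 ^ CARD('d)) / ((2 ^ CARD('d))\<^sup>2) ^ J"
proof (induction J arbitrary: q)
  case 0
  have "avg \<kappa> K n (\<lambda>m. (real (pts K (K0 + 0) q m))\<^sup>2 - real (pts K (K0 + 0) q m)) \<le> avg \<kappa> K n (\<lambda>m. (real (pts K K0 q m))\<^sup>2)"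
    by (intro avg_mono) simp
  also have "\<dots> \<le> unit_mean_bound (2 ^ CARD('d))" using 0 n by (intro mean_one_second_moment) auto
  finally show ?case by simp
next
  case (Suc J)
  define p where "p = anc 1 q"
  have p: "p \<in> cells (K0 + J)" using Suc.prems anc_in_cells[of q "K0 + J" 1] by (simp add: p_def)
  have q: "q \<in> leaves (Suc (K0 + J)) (K0 + J) p" using Suc.prems by (simp add: leaves_def p_def)
  have "(2 ^ CARD('d))\<^sup>2 * avg \<kappa> K n (\<lambda>m. (real (pts K (Suc (K0 + J)) q m))\<^sup>2 - real (pts K (Suc (K0 + J)) q m))
       \<le> avg \<kappa> K n (\<lambda>m. (real (pts K (K0 + J) p m))\<^sup>2 - real (pts K (K0 + J) p m))"
    using Suc.prems by (intro pair_decay p q deep) auto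
  also have "\<dots> \<le> unit_mean_bound (2 ^ CARD('d)) / ((2 ^ CARD('d))\<^sup>2) ^ J" using Suc.prems by (intro Suc.IH p) auto
  finally show ?case by (simp add: field_simps)
qed

text \<open>
  The indicator of \<open>N = 1\<close> is at least \<open>N - N (N - 1)\<close>.  Going \<open>J\<close> levels down divides the mean by \<open>2\<^sup>d\<^sup>J\<close> and the
  expected number of pairs by at least the square of that, so the mean wins for large \<open>J\<close>.
\<close>

lemma single_point_probability:
  fixes q :: "'d::finite \<Rightarrow> nat"
  assumes J: "2 * unit_mean_bound (2 ^ CARD('d)) \<le> (2 ^ CARD('d)) ^ J"
    and deep: "\<And>k. K0 < k \<Longrightarrow> exp (- \<kappa> k / 2) \<le> 1/8"
    and n: "(2 ^ CARD('d)) ^ K0 \<le> n" "n < (2 ^ CARD('d)) ^ Suc K0"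
    and K: "K0 + J \<le> K" and q: "q \<in> cells (K0 + J)"
  shows "1 / (2 * (2 ^ CARD('d)) ^ J) \<le> avg \<kappa> K n (\<lambda>m. if pts K (K0 + J) q m = 1 then 1 else 0)"
proof -
  let ?M = "2 ^ CARD('d) :: real"
  let ?N = "\<lambda>m. real (pts K (K0 + J) q m)"
  have "1 / (2 * ?M ^ J) \<le> 1 / ?M ^ J - unit_mean_bound ?M / (?M\<^sup>2) ^ J"
  proof -
    have "unit_mean_bound ?M / (?M\<^sup>2) ^ J = unit_mean_bound ?M / (?M ^ J * ?M ^ J)" by (simp add: power2_eq_square power_mult_distrib)
    also have "\<dots> \<le> (?M ^ J / 2) / (?M ^ J * ?M ^ J)" using J by (intro divide_right_mono) auto
    also have "\<dots> = 1 / ?M ^ J - 1 / (2 * ?M ^ J)" by (simp add: field_simps)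
    finally show ?thesis by simp
  qed
  also have "1 / ?M ^ J \<le> avg \<kappa> K n ?N"
  proof -
    have "?M ^ K0 \<le> real n" using n(1) by (metis of_nat_le_iff of_nat_numeral of_nat_power)
    then have "1 / ?M ^ J \<le> real n / ?M ^ (K0 + J)" by (simp add: power_add field_simps)
    then show ?thesis using avg_pts[OF K q, of \<kappa> n] by simp
  qed
  then have "1 / ?M ^ J - unit_mean_bound ?M / (?M\<^sup>2) ^ J \<le> avg \<kappa> K n ?N - avg \<kappa> K n (\<lambda>m. (?N m)\<^sup>2 - ?N m)"
    using pair_decay_iterated[OF deep n(2) K q] by linarith
  also have "\<dots> = avg \<kappa> K n (\<lambda>m. ?N m - ((?N m)\<^sup>2 - ?N m))" by (simp only: avg_diff)
  also have "\<dots> \<le> avg \<kappa> K n (\<lambda>m. if pts K (K0 + J) q m = 1 then 1 else 0)"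
  proof (intro avg_mono)
    fix m :: "('d \<Rightarrow> nat) \<Rightarrow> nat"
    define N where "N = pts K (K0 + J) q m"
    have "real N - ((real N)\<^sup>2 - real N) \<le> (if N = 1 then 1 else 0)"
    proof -
      consider "N = 0" | "N = 1" | "2 \<le> N" by linarith
      then show ?thesis
      proof cases
        case 3
        then have "real N * 2 \<le> real N * real N" by (intro mult_left_mono) auto
        then show ?thesis using 3 by (simp add: power2_eq_square)
      qed auto
    qed
    then show "?N m - ((?N m)\<^sup>2 - ?N m) \<le> (if pts K (K0 + J) q m = 1 then 1 else 0)" by (simp add: N_def)
  qed
  finally show ?thesis .
qed

lemma located_single_point_probability:
  fixes q :: "'d::finite \<Rightarrow> nat"
  assumes k: "k + 2 \<le> K" and q: "q \<in> cells k" and c: "c \<in> leaves (k + 2) k q"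
  shows "(2 ^ CARD('d))\<^sup>2 * avg \<kappa> K n (\<lambda>m. if pts K k q m = 1 \<and> pts K (k + 2) c m = 1 then 1 else 0)
      \<ge> avg \<kappa> K n (\<lambda>m. if pts K k q m = 1 then 1 else 0)"
proof -
  let ?f = "\<lambda>a b. if b = (1::nat) \<and> a = (1::nat) then 1 else 0 :: real"
  let ?ch = "leaves (k + 2) k q"
  have card: "real (card ?ch) = (2 ^ CARD('d))\<^sup>2" using card_leaves_real[of q k "k + 2"] q by simp
  have G: "flip_invariant K k q (pts K k q)" using k by (simp add: flip_invariant_def pts_flip_le)
  have "avg \<kappa> K n (\<lambda>m. if pts K k q m = 1 then 1 else 0) \<le> avg \<kappa> K n (\<lambda>m. \<Sum>x\<in>?ch. ?f (pts K (k + 2) x m) (pts K k q m))"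
  proof (intro avg_mono)
    fix m :: "('d \<Rightarrow> nat) \<Rightarrow> nat"
    show "(if pts K k q m = 1 then 1 else 0) \<le> (\<Sum>x\<in>?ch. ?f (pts K (k + 2) x m) (pts K k q m))"
    proof (cases "pts K k q m = 1")
      case True
      then have s: "(\<Sum>x\<in>?ch. pts K (k + 2) x m) = 1" using k pts_sum_leaves[of k "k + 2" K m q] by simp
      then obtain x where x: "x \<in> ?ch" "pts K (k + 2) x m \<noteq> 0" by (metis sum.neutral zero_neq_one)
      have "pts K (k + 2) x m \<le> 1" unfolding s[symmetric] using x by (intro member_le_sum) auto
      then have "?f (pts K (k + 2) x m) (pts K k q m) = 1" using x True by simp
      moreover have "?f (pts K (k + 2) x m) (pts K k q m) \<le> (\<Sum>x\<in>?ch. ?f (pts K (k + 2) x m) (pts K k q m))"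
        using x by (intro member_le_sum) auto
      ultimately show ?thesis using True by simp
    qed (auto intro: sum_nonneg)
  qed
  also have "\<dots> = (\<Sum>x\<in>?ch. avg \<kappa> K n (\<lambda>m. ?f (pts K (k + 2) x m) (pts K k q m)))" by (rule avg_sum)
  also have "\<dots> = (\<Sum>x\<in>?ch. avg \<kappa> K n (\<lambda>m. ?f (pts K (k + 2) c m) (pts K k q m)))"
  proof (rule sum.cong[OF refl])
    fix x assume x: "x \<in> ?ch"
    show "avg \<kappa> K n (\<lambda>m. ?f (pts K (k + 2) x m) (pts K k q m)) = avg \<kappa> K n (\<lambda>m. ?f (pts K (k + 2) c m) (pts K k q m))"
      using k by (intro avg_move[where \<Phi> = ?f, OF _ _ x c G]) auto
  qed
  also have "\<dots> = (2 ^ CARD('d))\<^sup>2 * avg \<kappa> K n (\<lambda>m. ?f (pts K (k + 2) c m) (pts K k q m))" by (simp only: sum_constant card)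
  finally show ?thesis by simp
qed

end

lemma xor_3: "xor (4 * x) 3 = 4 * x + (3::nat)"
proof -
  have "xor (2 * x) 1 = 2 * x + (1::nat)" by (subst xor_rec) simp
  then show ?thesis by (subst xor_rec) simp
qed

context hierarchical_model
begin

text \<open>
  Flipping the last two digits of every coordinate below a node of \<open>G\<close> reflects its cube and exchanges the
  subcubes \<open>4 q\<close> and \<open>4 q + 3\<close>.  If the only point of the cube lies in the first, the flip lowers the count by
  one.  Averaging over all subsets of \<open>G\<close> gives a sum of independent signs, of which at least
  \<open>p1 / 2 * card G\<close> have nonzero coefficients with probability at least \<open>p1 / 2\<close>.
\<close>

theorem anticoncentration:
  fixes A :: "('d::finite \<Rightarrow> nat) set"
  assumes J: "2 * unit_mean_bound (2 ^ CARD('d)) \<le> (2 ^ CARD('d)) ^ J"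
    and deep: "\<And>k. K0 < k \<Longrightarrow> exp (- \<kappa> k / 2) \<le> 1/8"
    and n: "(2 ^ CARD('d)) ^ K0 \<le> n" "n < (2 ^ CARD('d)) ^ Suc K0"
    and K: "K0 + J + 2 \<le> K" and A: "A \<subseteq> cells K" and G: "G \<subseteq> cells (K0 + J)" "G \<noteq> {}"
    and low: "\<And>q. q \<in> G \<Longrightarrow> leaves K (K0 + J + 2) (\<lambda>l. 4 * q l) \<subseteq> A"
    and high: "\<And>q. q \<in> G \<Longrightarrow> leaves K (K0 + J + 2) (\<lambda>l. 4 * q l + 3) \<inter> A = {}"
    and p1: "p1 = 1 / (2 * (2 ^ CARD('d)) ^ J * (2 ^ CARD('d))\<^sup>2)"
    and ab: "a \<le> b" "(b - a)\<^sup>2 \<le> p1 / 8 * real (card G)"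
  shows "avg \<kappa> K n (\<lambda>m. if a \<le> (\<Sum>i\<in>A. real (m i)) \<and> (\<Sum>i\<in>A. real (m i)) \<le> b then 1 else 0) \<le> 1 - p1 / 96"
proof -
  define k where "k = K0 + J"
  define msk :: "'d \<Rightarrow> nat" where "msk = (\<lambda>_. 3 * 2 ^ (K - (k + 2)))"
  have kK: "k + 2 \<le> K" "k \<le> K" using K by (auto simp: k_def)
  have finG: "finite G" by (rule finite_subset[OF G(1) finite_cells])
  have finA: "finite A" by (rule finite_subset[OF A finite_cells])
  have mskc: "msk \<in> cells (K - k)"
  proof -
    have "K - k = 2 + (K - (k + 2))" using kK by simp
    then have "2 ^ (K - k) = (2::nat) ^ 2 * 2 ^ (K - (k + 2))" by (metis power_add)
    then show ?thesis by (simp add: msk_def cells_def)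
  qed
  have amsk: "anc (K - (k + 2)) msk = (\<lambda>_. 3)" by (simp add: anc_def msk_def)
  let ?num = "\<lambda>m. \<Sum>i\<in>A. real (m i)"
  define D where "D q m = (\<Sum>i\<in>A \<inter> leaves K k q. real (m i) - real (m (vxor i msk)))" for q and m :: "('d \<Rightarrow> nat) \<Rightarrow> nat"
  define r where "r m q = D q m / 2" for q and m :: "('d \<Rightarrow> nat) \<Rightarrow> nat"
  have num_flip: "?num (\<lambda>i. m (flip K k S msk i)) = (?num m - (\<Sum>q\<in>G. r m q)) + signed (r m) G S" if S: "S \<subseteq> G" for S and m :: "('d \<Rightarrow> nat) \<Rightarrow> nat"
  proof -
    have decomp: "(\<Sum>i\<in>A. f i) = (\<Sum>q\<in>cells k. \<Sum>i\<in>A \<inter> leaves K k q. f i)" for f :: "('d \<Rightarrow> nat) \<Rightarrow> real"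
    proof -
      have "A = (\<Union>q\<in>cells k. A \<inter> leaves K k q)" using leaves_UN[OF kK(2)] A by blast
      then have "(\<Sum>i\<in>A. f i) = (\<Sum>i\<in>(\<Union>q\<in>cells k. A \<inter> leaves K k q). f i)" by simp
      also have "\<dots> = (\<Sum>q\<in>cells k. \<Sum>i\<in>A \<inter> leaves K k q. f i)"
        by (rule sum.UNION_disjoint) (auto simp: leaves_def)
      finally show ?thesis .
    qed
    have fl: "real (m (flip K k S msk i)) = real (m i) - (if q \<in> S then real (m i) - real (m (vxor i msk)) else 0)" if "i \<in> leaves K k q" for i q
      using that by (simp add: flip_def leaves_def)
    have "?num (\<lambda>i. m (flip K k S msk i)) = (\<Sum>q\<in>cells k. \<Sum>i\<in>A \<inter> leaves K k q. real (m i) - (if q \<in> S then real (m i) - real (m (vxor i msk)) else 0))"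
      unfolding decomp by (intro sum.cong refl fl) auto
    also have "\<dots> = ?num m - (\<Sum>q\<in>cells k. if q \<in> S then D q m else 0)"
      unfolding decomp D_def sum_subtractf[symmetric] by (intro sum.cong refl) (auto simp: sum_subtractf)
    also have "(\<Sum>q\<in>cells k. if q \<in> S then D q m else 0) = (\<Sum>q\<in>G. if q \<in> S then D q m else 0)"
      using S G by (intro sum.mono_neutral_right) (auto simp: k_def)
    also have "\<dots> = (\<Sum>q\<in>G. r m q) - signed (r m) G S"
      unfolding signed_def sum_subtractf[symmetric] by (intro sum.cong refl) (auto simp: r_def)
    finally show ?thesis by simp
  qed
  define ev where "ev q m \<longleftrightarrow> pts K k q m = 1 \<and> pts K (k + 2) (\<lambda>l. 4 * q l) m = 1" for q and m :: "('d \<Rightarrow> nat) \<Rightarrow> nat"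
  have lowleaf: "(\<lambda>l. 4 * q l) \<in> leaves (k + 2) k q" if "q \<in> G" for q
  proof -
    have "q \<in> cells k" using that G by (auto simp: k_def)
    then show ?thesis by (simp add: leaves_def cells_def anc_def power_add)
  qed
  have D1: "D q m = 1" if q: "q \<in> G" and e: "ev q m" for q m
  proof -
    let ?lo = "leaves K (k + 2) (\<lambda>l. 4 * q l)"
    have lo: "?lo \<subseteq> leaves K k q" using leaves_UN_leaves[of k "k + 2" K q] lowleaf[OF q] kK by auto
    have zero: "m i = 0" if "i \<in> leaves K k q - ?lo" for i
    proof -
      have "sum m (leaves K k q) = sum m (leaves K k q - ?lo) + sum m ?lo"
        using lo by (intro sum.subset_diff) auto
      moreover have "sum m (leaves K k q) = 1" "sum m ?lo = 1" using e by (simp_all add: ev_def pts_def)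
      ultimately have "sum m (leaves K k q - ?lo) = 0" by linarith
      then show ?thesis using that by simp
    qed
    have "(\<Sum>i\<in>A \<inter> leaves K k q. real (m i)) = (\<Sum>i\<in>?lo. real (m i))"
      using zero low[OF q] lo finA by (intro sum.mono_neutral_right) (auto simp: k_def)
    also have "\<dots> = 1" using e by (simp add: ev_def pts_def flip: of_nat_sum)
    finally have 1: "(\<Sum>i\<in>A \<inter> leaves K k q. real (m i)) = 1" .
    have 2: "m (vxor i msk) = 0" if i: "i \<in> A \<inter> leaves K k q" for i
    proof (rule zero)
      have fl: "flip K k {q} msk i = vxor i msk" using i by (simp add: flip_def leaves_def)
      have "vxor i msk \<in> leaves K k q"
        using i flip_cells[OF kK(2) mskc, of i "{q}"] anc_flip_le[OF order_refl kK(2) mskc, of "{q}" i] fl by (auto simp: leaves_def)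
      moreover have "vxor i msk \<notin> ?lo"
      proof
        assume "vxor i msk \<in> ?lo"
        then have lo_i: "anc (K - (k + 2)) (vxor i msk) = (\<lambda>l. 4 * q l)" by (simp only: leaves_def mem_Collect_eq)
        have "anc (K - (k + 2)) (vxor (vxor i msk) msk) = vxor (\<lambda>l. 4 * q l) (\<lambda>_. 3)"
          unfolding anc_vxor[of _ "vxor i msk"] lo_i amsk ..
        then have "anc (K - (k + 2)) i = (\<lambda>l. 4 * q l + 3)" by (simp only: vxor_vxor) (simp add: vxor_def xor_3)
        then have "i \<in> leaves K (k + 2) (\<lambda>l. 4 * q l + 3)" using i by (auto simp: leaves_def)
        then show False using i high[OF q] by (auto simp: k_def)
      qed
      ultimately show "vxor i msk \<in> leaves K k q - ?lo" by simp
    qed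
    show ?thesis using 1 2 by (simp add: D_def sum_subtractf)
  qed
  define Y where "Y m = (\<Sum>q\<in>G. if ev q m then 1 else 0 :: real)" for m :: "('d \<Rightarrow> nat) \<Rightarrow> nat"
  define g where "g = real (card G)"
  have gp: "0 < g" using G finG by (simp add: g_def card_gt_0_iff)
  have p1p: "0 < p1" by (simp add: p1)
  define I where "I m = (if a \<le> ?num m \<and> ?num m \<le> b then 1 else 0 :: real)" for m :: "('d \<Rightarrow> nat) \<Rightarrow> nat"
  \<comment> \<open>The mean of \<open>Y\<close> is at least \<open>p1 g\<close> and \<open>Y \<le> g\<close>, so \<open>Y\<close> exceeds half of \<open>p1 g\<close> with probability at least \<open>p1 / 2\<close>.\<close>
  define hit where "hit m = (if p1 / 2 * g \<le> Y m then 1 else 0 :: real)" for m :: "('d \<Rightarrow> nat) \<Rightarrow> nat"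
  have EY: "p1 * g \<le> avg \<kappa> K n Y"
  proof -
    have "p1 \<le> avg \<kappa> K n (\<lambda>m. if ev q m then 1 else 0)" if q: "q \<in> G" for q
    proof -
      have qc: "q \<in> cells k" using q G by (auto simp: k_def)
      have "1 / (2 * (2 ^ CARD('d)) ^ J) \<le> avg \<kappa> K n (\<lambda>m. if pts K k q m = 1 then 1 else 0)"
        unfolding k_def using qc K by (intro single_point_probability J deep n) (auto simp: k_def)
      also have "\<dots> \<le> (2 ^ CARD('d))\<^sup>2 * avg \<kappa> K n (\<lambda>m. if ev q m then 1 else 0)"
        unfolding ev_def by (rule located_single_point_probability[OF kK(1) qc lowleaf[OF q]])
      finally show ?thesis by (simp add: p1 field_simps)
    qed
    then have "(\<Sum>q\<in>G. p1) \<le> (\<Sum>q\<in>G. avg \<kappa> K n (\<lambda>m. if ev q m then 1 else 0))" by (intro sum_mono)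
    then show ?thesis unfolding Y_def avg_sum by (simp add: g_def mult.commute)
  qed
  have hit: "p1 / 2 \<le> avg \<kappa> K n hit"
  proof -
    have "Y m \<le> g * hit m + p1 / 2 * g" for m
    proof -
      have "Y m \<le> (\<Sum>q\<in>G. 1)" unfolding Y_def by (rule sum_mono) simp
      then have "Y m \<le> g" by (simp add: g_def)
      then show ?thesis using gp p1p by (simp add: hit_def add_increasing2)
    qed
    then have "avg \<kappa> K n Y \<le> avg \<kappa> K n (\<lambda>m. g * hit m + p1 / 2 * g)" by (intro avg_mono)
    also have "\<dots> = g * avg \<kappa> K n hit + p1 / 2 * g" by (simp only: avg_add avg_cmult avg_const)
    finally have "g * (p1 / 2) \<le> g * avg \<kappa> K n hit" using EY by (simp add: algebra_simps)
    then show ?thesis using gp by simp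
  qed
  let ?W = "2 ^ card G :: real"
  have avgS: "(\<Sum>S\<in>Pow G. I (\<lambda>i. m (flip K k S msk i))) \<le> ?W * (1 - hit m / 48)" for m
  proof (cases "p1 / 2 * g \<le> Y m")
    case True
    define V where "V = (\<Sum>q\<in>G. (r m q)\<^sup>2)"
    have "Y m / 4 \<le> V"
      unfolding V_def Y_def sum_divide_distrib by (intro sum_mono) (use D1 in \<open>auto simp: r_def power_divide\<close>)
    then have Vge: "p1 / 8 * g \<le> V" using True by simp
    have "(\<Sum>S\<in>Pow G. I (\<lambda>i. m (flip K k S msk i)))
       = (\<Sum>S\<in>Pow G. if a \<le> (?num m - (\<Sum>q\<in>G. r m q)) + signed (r m) G S \<and> (?num m - (\<Sum>q\<in>G. r m q)) + signed (r m) G S \<le> b then 1 else 0)"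
      by (intro sum.cong refl) (simp add: I_def num_flip)
    also have "\<dots> \<le> ?W * (47 / 48)"
    proof (rule signed_anticoncentration[OF finG V_def])
      have "0 < p1 / 8 * g" using p1p gp by simp
      then show "0 < V" using Vge by linarith
      show "(b - a)\<^sup>2 \<le> V" using ab(2) Vge by (simp add: g_def)
    qed (rule ab)
    finally show ?thesis using True by (simp add: hit_def)
  next
    case False
    have "(\<Sum>S\<in>Pow G. I (\<lambda>i. m (flip K k S msk i))) \<le> (\<Sum>S\<in>Pow G. 1)" by (intro sum_mono) (simp add: I_def)
    then show ?thesis using False finG by (simp add: hit_def card_Pow)
  qed
  have "?W * avg \<kappa> K n I = (\<Sum>S\<in>Pow G. avg \<kappa> K n (\<lambda>m. I (\<lambda>i. m (flip K k S msk i))))"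
    using finG by (simp add: avg_flip[OF kK(2) mskc] card_Pow)
  also have "\<dots> = avg \<kappa> K n (\<lambda>m. \<Sum>S\<in>Pow G. I (\<lambda>i. m (flip K k S msk i)))" by (rule avg_sum[symmetric])
  also have "\<dots> \<le> avg \<kappa> K n (\<lambda>m. ?W * (1 - 1/48 * hit m))" using avgS by (intro avg_mono) simp
  also have "\<dots> = ?W * (1 - 1/48 * avg \<kappa> K n hit)" by (simp only: avg_cmult avg_diff avg_const)
  finally have "avg \<kappa> K n I \<le> 1 - 1/48 * avg \<kappa> K n hit" by simp
  then have "avg \<kappa> K n I \<le> 1 - p1 / 96" using hit by linarith
  then show ?thesis unfolding I_def .
qed

end

section \<open>Dyadic cells of point configurations\<close>

definition occ :: "nat \<Rightarrow> (nat \<Rightarrow> 'a) \<Rightarrow> 'a \<Rightarrow> nat" where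
  "occ n c a = card {i \<in> {..<n}. c i = a}"

lemma occ_Suc: "occ (Suc n) (c(n := y)) = (occ n c)(y := Suc (occ n c y))"
proof
  fix a
  have "{i \<in> {..<Suc n}. (c(n := y)) i = a} = {i \<in> {..<n}. c i = a} \<union> (if a = y then {n} else {})" by auto
  then show "occ (Suc n) (c(n := y)) a = ((occ n c)(y := Suc (occ n c y))) a"
    by (auto simp: occ_def)
qed

text \<open>
  An occupation vector arises from \<open>n!\<close> over the product of its factorials many labelled configurations.
  By induction on \<open>n\<close>, adding one point: both sides are sums over the cell that receives it.
\<close>

lemma sum_labelled_configurations:
  fixes F :: "('a \<Rightarrow> nat) \<Rightarrow> real"
  assumes P: "finite P"
  shows "(\<Sum>c\<in>PiE {..<n} (\<lambda>_. P). F (occ n c)) = fact n * (\<Sum>m\<in>occupations P n. F m / (\<Prod>i\<in>P. fact (m i)))"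
proof (induction n arbitrary: F)
  case 0
  have "occupations P 0 = {\<lambda>_. 0}" using P by (auto simp: occupations_def)
  then show ?case by (simp add: occ_def)
next
  case (Suc n)
  define w :: "('a \<Rightarrow> nat) \<Rightarrow> real" where "w m = (\<Prod>i\<in>P. fact (m i))" for m
  have w0: "w m \<noteq> 0" for m by (simp add: w_def P)
  have wS: "w (m(y := Suc (m y))) = real (Suc (m y)) * w m" if "y \<in> P" for m y
  proof -
    have "w (m(y := Suc (m y))) = fact (Suc (m y)) * (\<Prod>i\<in>P - {y}. fact (m i))"
      unfolding w_def using P that by (subst prod.remove[of P y]) (auto intro!: prod.cong)
    also have "\<dots> = real (Suc (m y)) * w m" unfolding w_def using P that by (subst prod.remove[of P y]) auto
    finally show ?thesis .
  qed
  have "(\<Sum>c\<in>PiE {..<Suc n} (\<lambda>_. P). F (occ (Suc n) c)) = (\<Sum>z\<in>P \<times> PiE {..<n} (\<lambda>_. P). F (occ (Suc n) ((snd z)(n := fst z))))"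
  proof -
    have img: "PiE {..<Suc n} (\<lambda>_. P) = (\<lambda>(y, g). g(n := y)) ` (P \<times> PiE {..<n} (\<lambda>_. P))"
      by (simp add: lessThan_Suc PiE_insert_eq)
    have inj: "inj_on (\<lambda>(y, g). g(n := y)) (P \<times> PiE {..<n} (\<lambda>_. P))"
      by (rule inj_combinator) simp
    show ?thesis unfolding img sum.reindex[OF inj] by (simp add: case_prod_beta o_def)
  qed
  also have "\<dots> = (\<Sum>y\<in>P. \<Sum>c\<in>PiE {..<n} (\<lambda>_. P). F ((occ n c)(y := Suc (occ n c y))))"
    by (simp add: sum.cartesian_product case_prod_beta occ_Suc)
  also have "\<dots> = (\<Sum>y\<in>P. fact n * (\<Sum>m\<in>occupations P n. F (m(y := Suc (m y))) / w m))"
    unfolding w_def by (intro sum.cong refl) (rule Suc.IH[of "\<lambda>m. F (m(y := Suc (m y)))" for y])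
  also have "\<dots> = fact n * (\<Sum>y\<in>P. \<Sum>m\<in>occupations P (Suc n). real (m y) * (F m / w m))"
    unfolding sum_distrib_left[symmetric]
  proof (rule arg_cong2[where f = "(*)", OF refl], rule sum.cong[OF refl])
    fix y assume y: "y \<in> P"
    have "(\<Sum>m\<in>occupations P (Suc n). real (m y) * (F m / w m)) = (\<Sum>m\<in>{m\<in>occupations P (Suc n). m y \<noteq> 0}. real (m y) * (F m / w m))"
      using P by (intro sum.mono_neutral_right) auto
    also have "\<dots> = (\<Sum>m\<in>occupations P n. F (m(y := Suc (m y))) / w m)"
    proof (rule sum.reindex_bij_witness[of _ "\<lambda>m. m(y := Suc (m y))" "\<lambda>m. m(y := m y - 1)"])
      fix m assume m: "m \<in> {m\<in>occupations P (Suc n). m y \<noteq> 0}"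
      then show "(m(y := m y - 1))(y := Suc ((m(y := m y - 1)) y)) = m" by auto
      have "sum m P = m y + sum m (P - {y})" using P y by (intro sum.remove)
      moreover have "sum (m(y := m y - 1)) P = m y - 1 + sum m (P - {y})"
        using P y by (subst sum.remove[of P y]) (auto intro!: sum.cong)
      ultimately show "m(y := m y - 1) \<in> occupations P n" using m y by (auto simp: occupations_def)
      show "F ((m(y := m y - 1))(y := Suc ((m(y := m y - 1)) y))) / w (m(y := m y - 1)) = real (m y) * (F m / w m)"
      proof -
        have mm: "(m(y := m y - 1))(y := Suc ((m(y := m y - 1)) y)) = m" using m by auto
        have "w m = real (m y) * w (m(y := m y - 1))" using wS[OF y, of "m(y := m y - 1)"] m unfolding mm by simp
        then show ?thesis unfolding mm using m w0 by simp
      qed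
    next
      fix m assume m: "m \<in> occupations P n"
      show "(m(y := Suc (m y)))(y := (m(y := Suc (m y))) y - 1) = m" by auto
      have "sum m P = m y + sum m (P - {y})" using P y by (intro sum.remove)
      moreover have "sum (m(y := Suc (m y))) P = Suc (m y) + sum m (P - {y})"
        using P y by (subst sum.remove[of P y]) (auto intro!: sum.cong)
      ultimately show "m(y := Suc (m y)) \<in> {m\<in>occupations P (Suc n). m y \<noteq> 0}" using m y by (auto simp: occupations_def)
    qed
    finally show "(\<Sum>m\<in>occupations P n. F (m(y := Suc (m y))) / w m) = (\<Sum>m\<in>occupations P (Suc n). real (m y) * (F m / w m))" by simp
  qed
  also have "(\<Sum>y\<in>P. \<Sum>m\<in>occupations P (Suc n). real (m y) * (F m / w m)) = (\<Sum>m\<in>occupations P (Suc n). real (Suc n) * (F m / w m))"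
  proof (subst sum.swap, rule sum.cong[OF refl])
    fix m assume "m \<in> occupations P (Suc n)"
    then have "(\<Sum>y\<in>P. real (m y)) = real (Suc n)" by (simp add: occupations_def flip: of_nat_sum)
    then show "(\<Sum>y\<in>P. real (m y) * (F m / w m)) = real (Suc n) * (F m / w m)" by (simp only: sum_distrib_right[symmetric])
  qed
  finally show ?case by (simp add: w_def sum_distrib_left algebra_simps)
qed

definition cellof :: "nat \<Rightarrow> real^'d \<Rightarrow> 'd \<Rightarrow> nat" where
  "cellof K x = (\<lambda>l. nat \<lfloor>2 ^ K * x $ l\<rfloor>)"

definition cube :: "nat \<Rightarrow> ('d \<Rightarrow> nat) \<Rightarrow> (real^'d) set" where
  "cube K i = {x. \<forall>l. real (i l) / 2 ^ K \<le> x $ l \<and> x $ l < (real (i l) + 1) / 2 ^ K}"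

lemma in_cube_iff:
  assumes "x \<in> unit_cube"
  shows "x \<in> cube K i \<longleftrightarrow> cellof K x = i"
proof -
  have "real (i l) / 2 ^ K \<le> x $ l \<and> x $ l < (real (i l) + 1) / 2 ^ K \<longleftrightarrow> nat \<lfloor>2 ^ K * x $ l\<rfloor> = i l" for l
  proof -
    have "0 \<le> x $ l" using assms by (simp add: unit_cube_def)
    then have fl: "0 \<le> \<lfloor>2 ^ K * x $ l\<rfloor>" by simp
    have "nat \<lfloor>2 ^ K * x $ l\<rfloor> = i l \<longleftrightarrow> \<lfloor>2 ^ K * x $ l\<rfloor> = int (i l)" by (simp only: nat_eq_iff fl if_True)
    also have "\<dots> \<longleftrightarrow> real (i l) \<le> 2 ^ K * x $ l \<and> 2 ^ K * x $ l < real (i l) + 1"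
      by (simp add: floor_eq_iff)
    finally show ?thesis by (simp add: field_simps)
  qed
  then show ?thesis by (auto simp: cube_def cellof_def fun_eq_iff)
qed

lemma cellof_cells: "x \<in> unit_cube \<Longrightarrow> cellof K x \<in> cells K"
  by (auto simp: unit_cube_def cellof_def cells_def nat_less_iff floor_less_iff)

lemma in_own_cube: "x \<in> unit_cube \<Longrightarrow> x \<in> cube K (cellof K x)"
  by (simp add: in_cube_iff)

lemma cellof_anc:
  assumes "k \<le> K"
  shows "cellof k x = anc (K - k) (cellof K x)"
proof
  fix l
  have "2 ^ K = (2::real) ^ k * 2 ^ (K - k)" using assms by (simp flip: power_add)
  then have "2 ^ k * x $ l = (2 ^ K * x $ l) / real_of_int (2 ^ (K - k))" by simp
  then have "\<lfloor>2 ^ k * x $ l\<rfloor> = \<lfloor>2 ^ K * x $ l\<rfloor> div 2 ^ (K - k)"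
    by (metis floor_divide_real_eq_div zero_le_numeral zero_le_power)
  then show "cellof k x l = anc (K - k) (cellof K x) l"
    by (simp add: cellof_def anc_def nat_div_distrib' nat_power_eq)
qed

lemma cube_subset_unit: "i \<in> cells K \<Longrightarrow> cube K i \<subseteq> unit_cube"
proof
  fix x assume i: "i \<in> cells K" and x: "x \<in> cube K i"
  show "x \<in> unit_cube" unfolding unit_cube_def
  proof (intro CollectI allI conjI)
    fix l
    have 1: "real (i l) / 2 ^ K \<le> x $ l" "x $ l < (real (i l) + 1) / 2 ^ K" using x by (auto simp: cube_def)
    then show "0 \<le> x $ l" by (meson divide_nonneg_nonneg of_nat_0_le_iff order_trans zero_le_numeral zero_le_power)
    have "i l + 1 \<le> 2 ^ K" using i by (simp add: cells_def Suc_leI)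
    then have "real (i l + 1) \<le> real (2 ^ K)" by (simp only: of_nat_le_iff)
    then have "real (i l) + 1 \<le> 2 ^ K" by simp
    then have "(real (i l) + 1) / 2 ^ K \<le> 1" by simp
    then show "x $ l < 1" using 1 by linarith
  qed
qed

lemma dyadic_cubes_eq: "dyadic_cubes k = cube k ` cells k"
  by (auto simp: dyadic_cubes_def cube_def cells_def)

lemma same_cube_iff:
  assumes "x \<in> unit_cube" "y \<in> unit_cube"
  shows "(\<exists>Q\<in>dyadic_cubes k. x \<in> Q \<and> y \<in> Q) \<longleftrightarrow> cellof k x = cellof k y"
  using assms in_cube_iff[of x k] in_cube_iff[of y k] cellof_cells[of x k]
  by (auto simp: dyadic_cubes_eq)

lemma cube_diameter:
  fixes x y :: "real^'d"
  assumes "x \<in> cube K i" "y \<in> cube K i"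
  shows "dist x y \<le> real CARD('d) / 2 ^ K"
proof -
  have "norm (x - y) \<le> (\<Sum>l\<in>UNIV. \<bar>(x - y) $ l\<bar>)" by (rule norm_le_l1_cart)
  also have "\<dots> \<le> (\<Sum>l\<in>(UNIV::'d set). 1 / 2 ^ K)"
  proof (intro sum_mono)
    fix l
    have "real (i l) / 2 ^ K \<le> x $ l" "x $ l < real (i l) / 2 ^ K + 1 / 2 ^ K"
      "real (i l) / 2 ^ K \<le> y $ l" "y $ l < real (i l) / 2 ^ K + 1 / 2 ^ K"
      using assms by (auto simp: cube_def add_divide_distrib)
    then show "\<bar>(x - y) $ l\<bar> \<le> 1 / 2 ^ K" by (simp add: abs_le_iff)
  qed
  finally show ?thesis by (simp add: dist_norm)
qed

lemma small_cubes:
  assumes "0 < e"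
  shows "\<forall>\<^sub>F K in sequentially. real CARD('d::finite) / 2 ^ K < e"
proof -
  have "(\<lambda>K. real CARD('d) * (1/2) ^ K) \<longlonglongrightarrow> real CARD('d) * 0"
    by (intro tendsto_mult_left LIMSEQ_power_zero) auto
  from order_tendstoD(2)[OF this, of e] assms show ?thesis by (simp add: power_divide)
qed

lemma cellof_separates:
  fixes x y :: "real^'d"
  assumes "x \<in> unit_cube" "y \<in> unit_cube" "x \<noteq> y"
  shows "\<exists>k. cellof k x \<noteq> cellof k y"
proof (rule ccontr)
  assume "\<nexists>k. cellof k x \<noteq> cellof k y"
  then have "x \<in> cube k (cellof k x)" "y \<in> cube k (cellof k x)" for k
    using in_own_cube assms by metis+
  then have "dist x y \<le> real CARD('d) / 2 ^ k" for k by (rule cube_diameter)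
  then show False using small_cubes[of "dist x y", where 'd = 'd] assms
    by (auto simp: eventually_sequentially not_less[symmetric])
qed

text \<open>
  The weights \<open>\<delta>\<^sub>k\<close>, whose partial sums up to level \<open>j\<close> are \<open>\<theta>\<^sup>j\<close>.
\<close>

definition level_weight :: "real \<Rightarrow> nat \<Rightarrow> real" where
  "level_weight \<theta> k = (case k of 0 \<Rightarrow> 1 | Suc j \<Rightarrow> \<theta> ^ Suc j - \<theta> ^ j)"

lemma sum_level_weight: "(\<Sum>k\<le>j. level_weight \<theta> k) = \<theta> ^ j"
  by (induction j) (auto simp: level_weight_def)

definition trunc_interaction :: "nat \<Rightarrow> real^'d::finite \<Rightarrow> real^'d \<Rightarrow> real" where
  "trunc_interaction K x y = (\<Sum>k\<le>K. level_weight (2 ^ (CARD('d) - 2)) k * of_bool (cellof k x = cellof k y))"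

lemma trunc_interaction_eventually:
  fixes x y :: "real^'d::finite"
  assumes xy: "x \<in> unit_cube" "y \<in> unit_cube" "x \<noteq> y"
  shows "\<forall>\<^sub>F K in sequentially. trunc_interaction K x y = interaction x y"
proof -
  define s where "s = separation_level x y"
  have s: "s = (LEAST k. cellof k x \<noteq> cellof k y)"
    using same_cube_iff[OF xy(1,2)] by (simp add: s_def separation_level_def)
  have ne: "cellof s x \<noteq> cellof s y" unfolding s using cellof_separates[OF xy] by (rule LeastI_ex)
  have eq: "cellof k x = cellof k y" if "k < s" for k
    using not_less_Least that unfolding s by blast
  have ne': "cellof k x \<noteq> cellof k y" if "s \<le> k" for k
    using ne cellof_anc[OF that] by metis
  have "cellof 0 x = cellof 0 y" using cellof_cells[of x 0] cellof_cells[of y 0] xy by simp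
  then obtain j where j: "s = Suc j" using ne by (cases s) auto
  have "trunc_interaction K x y = interaction x y" if "s \<le> K" for K
  proof -
    have "trunc_interaction K x y = (\<Sum>k\<le>j. level_weight (2 ^ (CARD('d) - 2)) k * of_bool (cellof k x = cellof k y))"
      unfolding trunc_interaction_def using that j ne' by (intro sum.mono_neutral_right) auto
    also have "\<dots> = (\<Sum>k\<le>j. level_weight (2 ^ (CARD('d) - 2)) k)"
      using eq j by (intro sum.cong refl) auto
    also have "\<dots> = interaction x y" unfolding sum_level_weight interaction_def s_def[symmetric] j by (simp add: power_mult)
    finally show ?thesis .
  qed
  then show ?thesis by (auto simp: eventually_sequentially)
qed

definition trunc_energy :: "nat \<Rightarrow> nat \<Rightarrow> (nat \<Rightarrow> real^'d::finite) \<Rightarrow> real" where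
  "trunc_energy K n x = (\<Sum>i<n. \<Sum>j\<in>{..<n} - {i}. trunc_interaction K (x i) (x j))"

lemma pts_occ:
  fixes x :: "nat \<Rightarrow> real^'d"
  assumes "k \<le> K" "\<And>i. i < n \<Longrightarrow> x i \<in> unit_cube"
  shows "pts K k q (occ n (\<lambda>i. cellof K (x i))) = card {i\<in>{..<n}. cellof k (x i) = q}"
proof -
  have "{i\<in>{..<n}. cellof k (x i) = q} = (\<Union>a\<in>leaves K k q. {i\<in>{..<n}. cellof K (x i) = a})"
    using assms cellof_anc[OF assms(1)] by (auto simp: leaves_def cellof_cells)
  then have "card {i\<in>{..<n}. cellof k (x i) = q} = (\<Sum>a\<in>leaves K k q. card {i\<in>{..<n}. cellof K (x i) = a})"
    by (simp only:) (rule card_UN_disjoint, auto)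
  then show ?thesis by (simp add: pts_def occ_def)
qed

text \<open>
  Counting the ordered pairs of points that share a cube of level \<open>k\<close> gives
  \<open>\<Sum>\<^sub>q N(q)\<^sup>2 - n\<close>.
\<close>

lemma trunc_energy_eq:
  fixes x :: "nat \<Rightarrow> real^'d::finite"
  assumes x: "\<And>i. i < n \<Longrightarrow> x i \<in> unit_cube"
  shows "\<beta> * trunc_energy K n x = fine_energy (\<lambda>k. \<beta> * level_weight (2 ^ (CARD('d) - 2)) k) K 0 (occ n (\<lambda>i. cellof K (x i)))
           - \<beta> * real n * (2 ^ (CARD('d) - 2)) ^ K"
proof -
  let ?w = "level_weight (2 ^ (CARD('d) - 2))"
  let ?m = "occ n (\<lambda>i. cellof K (x i))"
  have lev: "(\<Sum>i<n. \<Sum>j\<in>{..<n} - {i}. of_bool (cellof k (x i) = cellof k (x j))) = (\<Sum>q\<in>cells k. (real (pts K k q ?m))\<^sup>2) - real n"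
    if k: "k \<le> K" for k
  proof -
    have "(\<Sum>i<n. \<Sum>j\<in>{..<n} - {i}. of_bool (cellof k (x i) = cellof k (x j))) = (\<Sum>i<n. (\<Sum>j<n. of_bool (cellof k (x i) = cellof k (x j))) - 1 :: real)"
    proof (intro sum.cong refl)
      fix i assume i: "i \<in> {..<n}"
      have "(\<Sum>j<n. f j) = f i + (\<Sum>j\<in>{..<n} - {i}. f j)" for f :: "nat \<Rightarrow> real" by (rule sum.remove) (use i in auto)
      from this[of "\<lambda>j. of_bool (cellof k (x i) = cellof k (x j))"]
      show "(\<Sum>j\<in>{..<n} - {i}. of_bool (cellof k (x i) = cellof k (x j))) = (\<Sum>j<n. of_bool (cellof k (x i) = cellof k (x j))) - (1 :: real)"
        by (simp only: of_bool_eq simp_thms)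
    qed
    also have "\<dots> = (\<Sum>i<n. \<Sum>j<n. of_bool (cellof k (x i) = cellof k (x j))) - real n" by (simp add: sum_subtractf)
    also have "(\<Sum>i<n. \<Sum>j<n. of_bool (cellof k (x i) = cellof k (x j))) = (\<Sum>q\<in>cells k. (real (pts K k q ?m))\<^sup>2)"
    proof -
      have "(\<Sum>q\<in>cells k. (real (pts K k q ?m))\<^sup>2) = (\<Sum>q\<in>cells k. (\<Sum>i<n. of_bool (cellof k (x i) = q)) * (\<Sum>j<n. of_bool (cellof k (x j) = q)))"
        by (intro sum.cong refl) (simp add: pts_occ[OF k x] power2_eq_square Int_def)
      also have "\<dots> = (\<Sum>q\<in>cells k. \<Sum>i<n. \<Sum>j<n. of_bool (cellof k (x i) = q) * of_bool (cellof k (x j) = q))"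
        by (simp only: sum_product)
      also have "\<dots> = (\<Sum>i<n. \<Sum>j<n. \<Sum>q\<in>cells k. of_bool (cellof k (x i) = q) * of_bool (cellof k (x j) = q))"
        by (subst sum.swap, intro sum.cong refl, subst sum.swap) simp
      also have "\<dots> = (\<Sum>i<n. \<Sum>j<n. of_bool (cellof k (x i) = cellof k (x j)))"
      proof (intro sum.cong refl)
        fix i j assume "i \<in> {..<n}"
        then have "cellof k (x i) \<in> cells k" using x by (simp add: cellof_cells)
        then have "(\<Sum>q\<in>cells k. of_bool (cellof k (x i) = q) * of_bool (cellof k (x j) = q)) = (\<Sum>q\<in>cells k. if q = cellof k (x i) then of_bool (cellof k (x j) = q) else 0 :: real)"
          by (intro sum.cong refl) auto
        then show "(\<Sum>q\<in>cells k. of_bool (cellof k (x i) = q) * of_bool (cellof k (x j) = q)) = (of_bool (cellof k (x i) = cellof k (x j)) :: real)"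
          using \<open>cellof k (x i) \<in> cells k\<close> by (simp add: eq_commute)
      qed
      finally show ?thesis by simp
    qed
    finally show ?thesis .
  qed
  have "trunc_energy K n x = (\<Sum>i<n. \<Sum>j\<in>{..<n} - {i}. \<Sum>k\<le>K. ?w k * of_bool (cellof k (x i) = cellof k (x j)))"
    by (simp add: trunc_energy_def trunc_interaction_def)
  also have "\<dots> = (\<Sum>k\<le>K. \<Sum>i<n. \<Sum>j\<in>{..<n} - {i}. ?w k * of_bool (cellof k (x i) = cellof k (x j)))"
    by (subst (2) sum.swap) (subst sum.swap, rule refl)
  also have "\<dots> = (\<Sum>k\<le>K. ?w k * ((\<Sum>q\<in>cells k. (real (pts K k q ?m))\<^sup>2) - real n))"
  proof (rule sum.cong[OF refl])
    fix k assume "k \<in> {..K}"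
    then have "k \<le> K" by simp
    from lev[OF this] show "(\<Sum>i<n. \<Sum>j\<in>{..<n} - {i}. ?w k * of_bool (cellof k (x i) = cellof k (x j))) = ?w k * ((\<Sum>q\<in>cells k. (real (pts K k q ?m))\<^sup>2) - real n)"
      by (simp only: sum_distrib_left[symmetric])
  qed
  also have "\<dots> = (\<Sum>k\<le>K. ?w k * (\<Sum>q\<in>cells k. (real (pts K k q ?m))\<^sup>2)) - real n * (2 ^ (CARD('d) - 2)) ^ K"
    by (simp add: right_diff_distrib sum_subtractf sum_level_weight mult.commute flip: sum_distrib_left)
  finally show ?thesis by (simp add: fine_energy_def atLeast0AtMost sum_distrib_left right_diff_distrib mult.assoc)
qed

section \<open>The reference measure on configurations\<close>

lemma cube_measurable [measurable]: "cube K (i :: 'd::finite \<Rightarrow> nat) \<in> sets borel"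
proof -
  have "cube K i = (\<Inter>l. {x. real (i l) / 2 ^ K \<le> x $ l} \<inter> {x. x $ l < (real (i l) + 1) / 2 ^ K})"
    by (auto simp: cube_def)
  moreover have "{x :: real^'d. c \<le> x $ l} \<in> sets borel" for c l
    by (intro borel_closed closed_Collect_le continuous_intros)
  moreover have "{x :: real^'d. x $ l < c} \<in> sets borel" for c l
    by (intro borel_open open_Collect_less continuous_intros)
  ultimately show ?thesis by auto
qed

text \<open>
  The half-open cube lies between an open and a closed box of the same volume.
\<close>

lemma emeasure_cube: "emeasure lborel (cube K (i :: 'd::finite \<Rightarrow> nat)) = ennreal ((1 / 2 ^ K) ^ CARD('d))"
proof -
  define a b :: "real^'d" where "a = (\<chi> l. real (i l) / 2 ^ K)" and "b = (\<chi> l. (real (i l) + 1) / 2 ^ K)"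
  have prod: "(\<Prod>e\<in>Basis. (b - a) \<bullet> e) = (1 / 2 ^ K) ^ CARD('d)"
  proof -
    have "(b - a) \<bullet> e = 1 / 2 ^ K" if "e \<in> Basis" for e
      using that by (auto simp: Basis_vec_def a_def b_def inner_axis diff_divide_distrib[symmetric])
    then have "(\<Prod>e\<in>Basis. (b - a) \<bullet> e) = (\<Prod>e\<in>(Basis :: (real^'d) set). 1 / 2 ^ K)" by (intro prod.cong) auto
    then show ?thesis by simp
  qed
  have ab: "a \<bullet> e \<le> b \<bullet> e" if "e \<in> Basis" for e
    using that by (auto simp: Basis_vec_def a_def b_def inner_axis divide_right_mono)
  have sub: "box a b \<subseteq> cube K i" "cube K i \<subseteq> cbox a b"
    by (auto simp: a_def b_def cube_def mem_box_cart less_imp_le)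
  have "emeasure lborel (box a b) \<le> emeasure lborel (cube K i)" "emeasure lborel (cube K i) \<le> emeasure lborel (cbox a b)"
    using sub by (auto intro!: emeasure_mono)
  then show ?thesis using ab by (simp add: emeasure_lborel_box emeasure_lborel_cbox prod antisym)
qed

abbreviation cube_space :: "(real^'d::finite) measure" where
  "cube_space \<equiv> restrict_space lborel unit_cube"

lemma unit_cube_eq: "unit_cube = (cube 0 (\<lambda>_. 0) :: (real^'d) set)"
  by (auto simp: unit_cube_def cube_def)

lemma unit_cube_measurable [measurable]: "(unit_cube :: (real^'d::finite) set) \<in> sets borel"
  unfolding unit_cube_eq by measurable

lemma space_cube_space [simp]: "space cube_space = unit_cube"
  by (simp add: space_restrict_space)

lemma prob_space_cube_space: "prob_space (cube_space :: (real^'d::finite) measure)"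
proof
  show "emeasure cube_space (space (cube_space :: (real^'d) measure)) = 1"
    using emeasure_cube[of 0 "\<lambda>_ :: 'd. 0"] by (simp add: emeasure_restrict_space unit_cube_eq)
qed

lemma measure_cube_space:
  assumes "i \<in> cells K"
  shows "measure cube_space (cube K (i :: 'd::finite \<Rightarrow> nat)) = (1 / 2 ^ CARD('d)) ^ K"
proof -
  have "emeasure cube_space (cube K i) = ennreal ((1 / 2 ^ K) ^ CARD('d))"
    using cube_subset_unit[OF assms] emeasure_cube[of K i] by (subst emeasure_restrict_space) auto
  then have "measure cube_space (cube K i) = (1 / 2 ^ K) ^ CARD('d)" by (simp add: measure_def)
  then show ?thesis by (simp add: power_divide mult.commute flip: power_mult)
qed

lemma cube_in_sets: "i \<in> cells K \<Longrightarrow> cube K (i :: 'd::finite \<Rightarrow> nat) \<in> sets cube_space"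
  using cube_subset_unit[of i K] by (subst sets_restrict_space_iff) auto

lemma finite_product_cube_space: "finite_product_prob_space (\<lambda>_. cube_space :: (real^'d::finite) measure) {..<n::nat}"
proof -
  interpret p: prob_space "cube_space :: (real^'d) measure" by (rule prob_space_cube_space)
  interpret product_sigma_finite "\<lambda>_::nat. cube_space :: (real^'d) measure"
    by unfold_locales
  show ?thesis by unfold_locales auto
qed

lemma prob_space_config: "prob_space (config_lebesgue n :: (nat \<Rightarrow> real^'d::finite) measure)"
proof -
  interpret finite_product_prob_space "\<lambda>_. cube_space :: (real^'d) measure" "{..<n}" by (rule finite_product_cube_space)
  show ?thesis unfolding config_lebesgue_def by unfold_locales
qed

lemma space_config: "space (config_lebesgue n) = PiE {..<n} (\<lambda>_. unit_cube :: (real^'d::finite) set)"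
  by (simp add: config_lebesgue_def space_PiM)

lemma config_in_cube: "x \<in> space (config_lebesgue n) \<Longrightarrow> i < n \<Longrightarrow> x i \<in> (unit_cube :: (real^'d::finite) set)"
  by (auto simp: space_config)

lemma measure_config_PiE:
  assumes "\<And>i. i < n \<Longrightarrow> X i \<in> sets (cube_space :: (real^'d::finite) measure)"
  shows "measure (config_lebesgue n) (PiE {..<n} X) = (\<Prod>i<n. measure (cube_space :: (real^'d) measure) (X i))"
proof -
  interpret finite_product_prob_space "\<lambda>_. cube_space :: (real^'d) measure" "{..<n}" by (rule finite_product_cube_space)
  show ?thesis unfolding config_lebesgue_def using assms by (intro finite_measure_PiM_emb) auto
qed

definition cell_box :: "nat \<Rightarrow> nat \<Rightarrow> (nat \<Rightarrow> 'd \<Rightarrow> nat) \<Rightarrow> (nat \<Rightarrow> real^'d::finite) set" where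
  "cell_box K n c = PiE {..<n} (\<lambda>i. cube K (c i))"

lemma cell_box_sets:
  assumes "c \<in> PiE {..<n} (\<lambda>_. cells K)"
  shows "cell_box K n c \<in> sets (config_lebesgue n :: (nat \<Rightarrow> real^'d::finite) measure)"
  unfolding cell_box_def config_lebesgue_def
  using assms by (intro sets_PiM_I_finite) (auto intro!: cube_in_sets)

lemma measure_cell_box:
  assumes "c \<in> PiE {..<n} (\<lambda>_. cells K)"
  shows "measure (config_lebesgue n :: (nat \<Rightarrow> real^'d::finite) measure) (cell_box K n c) = ((1 / 2 ^ CARD('d)) ^ K) ^ n"
proof -
  have "measure (config_lebesgue n :: (nat \<Rightarrow> real^'d) measure) (cell_box K n c) = (\<Prod>i<n. measure (cube_space :: (real^'d) measure) (cube K (c i)))"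
    unfolding cell_box_def using assms by (intro measure_config_PiE cube_in_sets) auto
  also have "\<dots> = (\<Prod>i<n. (1 / 2 ^ CARD('d)) ^ K)"
    using assms by (intro prod.cong refl measure_cube_space) auto
  finally show ?thesis by simp
qed

definition cellvec :: "nat \<Rightarrow> nat \<Rightarrow> (nat \<Rightarrow> real^'d::finite) \<Rightarrow> nat \<Rightarrow> 'd \<Rightarrow> nat" where
  "cellvec K n x = (\<lambda>i\<in>{..<n}. cellof K (x i))"

lemma cellvec_PiE: "x \<in> space (config_lebesgue n) \<Longrightarrow> cellvec K n x \<in> PiE {..<n} (\<lambda>_. cells K)"
  by (auto simp: cellvec_def intro!: cellof_cells config_in_cube)

lemma cell_box_iff:
  assumes "x \<in> space (config_lebesgue n)" "c \<in> PiE {..<n} (\<lambda>_. cells K)"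
  shows "x \<in> cell_box K n c \<longleftrightarrow> cellvec K n x = c"
proof -
  have "x \<in> cell_box K n c \<longleftrightarrow> (\<forall>i<n. x i \<in> cube K (c i))" using assms by (auto simp: cell_box_def space_config PiE_def)
  also have "\<dots> \<longleftrightarrow> (\<forall>i<n. cellof K (x i) = c i)" using assms by (auto simp: in_cube_iff config_in_cube)
  also have "\<dots> \<longleftrightarrow> cellvec K n x = c" using assms by (auto simp: cellvec_def fun_eq_iff PiE_def extensional_def)
  finally show ?thesis .
qed

lemma cell_function_sum:
  fixes F :: "(nat \<Rightarrow> 'd::finite \<Rightarrow> nat) \<Rightarrow> real"
  assumes "x \<in> space (config_lebesgue n)"
  shows "F (cellvec K n x) = (\<Sum>c\<in>PiE {..<n} (\<lambda>_. cells K). F c * indicator (cell_box K n c) x)"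
proof -
  have "(\<Sum>c\<in>PiE {..<n} (\<lambda>_. cells K). F c * indicator (cell_box K n c) x) = (\<Sum>c\<in>PiE {..<n} (\<lambda>_. cells K). if c = cellvec K n x then F c else 0)"
  proof (rule sum.cong[OF refl])
    fix c :: "nat \<Rightarrow> 'd \<Rightarrow> nat" assume c: "c \<in> PiE {..<n} (\<lambda>_. cells K)"
    show "F c * indicator (cell_box K n c) x = (if c = cellvec K n x then F c else 0)"
    proof (cases "c = cellvec K n x")
      case True
      then have "x \<in> cell_box K n c" using cell_box_iff[OF assms c] by blast
      then show ?thesis using True by simp
    next
      case False
      then have "x \<notin> cell_box K n c" using cell_box_iff[OF assms c] by blast
      then show ?thesis using False by simp
    qed
  qed
  also have "\<dots> = F (cellvec K n x)" using cellvec_PiE[OF assms] by (simp add: finite_PiE)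
  finally show ?thesis by simp
qed

lemma cell_function_measurable:
  fixes F :: "(nat \<Rightarrow> 'd::finite \<Rightarrow> nat) \<Rightarrow> real"
  shows "(\<lambda>x. F (cellvec K n x)) \<in> borel_measurable (config_lebesgue n)"
proof -
  have "(\<lambda>x. \<Sum>c\<in>PiE {..<n} (\<lambda>_. cells K). F c * indicator (cell_box K n c) x) \<in> borel_measurable (config_lebesgue n)"
    by (intro borel_measurable_sum borel_measurable_times borel_measurable_const borel_measurable_indicator cell_box_sets)
  then show ?thesis by (rule measurable_cong[THEN iffD1, rotated]) (simp add: cell_function_sum)
qed

lemma cell_function_integral:
  fixes F :: "(nat \<Rightarrow> 'd::finite \<Rightarrow> nat) \<Rightarrow> real"
  shows "(\<integral>x. F (cellvec K n x) \<partial>config_lebesgue n) = ((1 / 2 ^ CARD('d)) ^ K) ^ n * (\<Sum>c\<in>PiE {..<n} (\<lambda>_. cells K). F c)"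
proof -
  interpret prob_space "config_lebesgue n :: (nat \<Rightarrow> real^'d) measure" by (rule prob_space_config)
  have "(\<integral>x. F (cellvec K n x) \<partial>config_lebesgue n) = (\<integral>x. (\<Sum>c\<in>PiE {..<n} (\<lambda>_. cells K). F c * indicator (cell_box K n c) x) \<partial>config_lebesgue n)"
    by (intro Bochner_Integration.integral_cong refl cell_function_sum)
  also have "\<dots> = (\<Sum>c\<in>PiE {..<n} (\<lambda>_. cells K). (\<integral>x. F c * indicator (cell_box K n c) x \<partial>config_lebesgue n))"
    by (intro Bochner_Integration.integral_sum integrable_mult_right integrable_real_indicator cell_box_sets)
       (auto simp: less_top[symmetric])
  also have "\<dots> = (\<Sum>c\<in>PiE {..<n} (\<lambda>_. cells K). F c * ((1 / 2 ^ CARD('d)) ^ K) ^ n)"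
    by (intro sum.cong refl) (simp add: cell_box_sets measure_cell_box sets.Int_space_eq2)
  finally show ?thesis by (simp only: sum_distrib_right mult.commute)
qed

text \<open>
  Two points share a cell of level \<open>K\<close> with probability \<open>2\<^sup>-\<^sup>d\<^sup>K\<close>.
\<close>

lemma AE_distinct_points:
  "AE x in (config_lebesgue n :: (nat \<Rightarrow> real^'d::finite) measure). \<forall>i\<in>{..<n}. \<forall>j\<in>{..<n}. i \<noteq> j \<longrightarrow> x i \<noteq> x j"
proof -
  let ?\<mu> = "config_lebesgue n :: (nat \<Rightarrow> real^'d) measure"
  interpret prob_space ?\<mu> by (rule prob_space_config)
  have "AE x in ?\<mu>. x i \<noteq> x j" if ij: "i < n" "j < n" "i \<noteq> j" for i j
  proof -
    have full: "measure (cube_space :: (real^'d) measure) unit_cube = 1"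
    proof -
      interpret c: prob_space "cube_space :: (real^'d) measure" by (rule prob_space_cube_space)
      show ?thesis using c.prob_space by simp
    qed
    \<comment> \<open>Both points lie in the cell \<open>q\<close>.\<close>
    define B where "B K q = PiE {..<n} (\<lambda>k. if k = i \<or> k = j then cube K q else (unit_cube :: (real^'d) set))" for K q
    have Bs: "B K q \<in> sets ?\<mu>" if "q \<in> cells K" for K q
      unfolding B_def config_lebesgue_def using that cube_subset_unit[OF that] by (intro sets_PiM_I_finite) (auto intro!: cube_in_sets simp: sets_restrict_space_iff)
    have mB: "measure ?\<mu> (B K q) = ((1 / 2 ^ CARD('d)) ^ K)\<^sup>2" if q: "q \<in> cells K" for K q
    proof -
      have "measure ?\<mu> (B K q) = (\<Prod>k<n. measure (cube_space :: (real^'d) measure) (if k = i \<or> k = j then cube K q else unit_cube))"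
        unfolding B_def using q cube_subset_unit[OF q] by (intro measure_config_PiE) (auto intro!: cube_in_sets simp: sets_restrict_space_iff)
      also have "\<dots> = (\<Prod>k<n. if k \<in> {i, j} then (1 / 2 ^ CARD('d)) ^ K else 1)"
        using measure_cube_space[OF q] full by (intro prod.cong refl) auto
      also have "\<dots> = (\<Prod>k\<in>{i, j}. (1 / 2 ^ CARD('d)) ^ K)"
        using ij by (subst prod.inter_restrict[symmetric]) (auto intro!: prod.cong)
      also have "\<dots> = ((1 / 2 ^ CARD('d)) ^ K)\<^sup>2" using ij by (simp add: power2_eq_square)
      finally show ?thesis .
    qed
    define N where "N = (\<Inter>K. \<Union>q\<in>cells K. B K q)"
    have Ns: "N \<in> sets ?\<mu>" unfolding N_def using Bs by (intro sets.countable_INT' sets.finite_UN) auto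
    have mN: "measure ?\<mu> N \<le> (1 / 2 ^ CARD('d)) ^ K" for K
    proof -
      have "measure ?\<mu> N \<le> measure ?\<mu> (\<Union>q\<in>cells K. B K q)"
        unfolding N_def using Bs by (intro finite_measure_mono sets.finite_UN) auto
      also have "\<dots> \<le> (\<Sum>q\<in>cells K. measure ?\<mu> (B K q))"
        using Bs by (intro finite_measure_subadditive_finite) auto
      also have "\<dots> = (\<Sum>q\<in>(cells K :: ('d \<Rightarrow> nat) set). ((1 / 2 ^ CARD('d)) ^ K)\<^sup>2)" by (intro sum.cong refl mB)
      also have "\<dots> = (1 / 2 ^ CARD('d)) ^ K"
        by (simp add: card_cells power2_eq_square power_divide mult.commute flip: power_mult)
      finally show ?thesis .
    qed
    have "(\<lambda>K. (1 / 2 ^ CARD('d)) ^ K :: real) \<longlonglongrightarrow> 0" by (intro LIMSEQ_power_zero) (simp add: power_divide[symmetric])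
    then have "measure ?\<mu> N \<le> 0" using mN by (intro LIMSEQ_le_const) auto
    then have "emeasure ?\<mu> N = 0" by (simp add: emeasure_eq_measure measure_le_0_iff)
    then show ?thesis
    proof (intro AE_I[of _ _ N] Ns)
      show "{x \<in> space ?\<mu>. \<not> x i \<noteq> x j} \<subseteq> N"
      proof
        fix x assume x: "x \<in> {x \<in> space ?\<mu>. \<not> x i \<noteq> x j}"
        then have xi: "x i \<in> unit_cube" using config_in_cube ij by auto
        have "x \<in> B K (cellof K (x i))" for K
          using x in_own_cube[OF xi, of K] by (auto simp: B_def space_config PiE_def)
        then show "x \<in> N" using cellof_cells[OF xi] by (auto simp: N_def)
      qed
    qed auto
  qed
  then show ?thesis by (intro AE_finite_allI) auto
qed

section \<open>The gas as a limit of discrete models\<close>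

lemma config_component_measurable:
  assumes "i < n"
  shows "(\<lambda>x. x i) \<in> borel_measurable (config_lebesgue n :: (nat \<Rightarrow> real^'d::finite) measure)"
proof -
  have "(\<lambda>x. x i) \<in> measurable (config_lebesgue n) (cube_space :: (real^'d) measure)"
    unfolding config_lebesgue_def by (rule measurable_component_singleton) (use assms in auto)
  moreover have "(\<lambda>x. x) \<in> measurable (cube_space :: (real^'d) measure) borel"
    by (rule measurable_restrict_space1) simp
  ultimately show ?thesis by (rule measurable_compose)
qed

lemma interaction_measurable:
  assumes "i < n" "j < n"
  shows "(\<lambda>x. interaction (x i) (x j)) \<in> borel_measurable (config_lebesgue n :: (nat \<Rightarrow> real^'d::finite) measure)"
proof -
  let ?M = "config_lebesgue n :: (nat \<Rightarrow> real^'d) measure"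
  have [measurable]: "(\<lambda>x. x i) \<in> borel_measurable ?M" "(\<lambda>x. x j) \<in> borel_measurable ?M"
    using assms by (auto intro: config_component_measurable)
  have *: "Measurable.pred ?M (\<lambda>x. \<exists>c\<in>cells k. x i \<in> cube k c \<and> x j \<in> cube k c)" for k
    by (rule pred_intros_finite) (auto)
  have "Measurable.pred ?M (\<lambda>x. \<not> (\<exists>Q\<in>dyadic_cubes k. x i \<in> Q \<and> x j \<in> Q))" for k
    using * [of k] by (simp add: dyadic_cubes_eq)
  then have sep: "(\<lambda>x. separation_level (x i) (x j)) \<in> measurable ?M (count_space UNIV)"
    unfolding separation_level_def by (rule measurable_Least)
  show ?thesis unfolding interaction_def
    by (rule measurable_compose[OF sep]) simp
qed

lemma energy_measurable: "energy n \<in> borel_measurable (config_lebesgue n :: (nat \<Rightarrow> real^'d::finite) measure)"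
  unfolding energy_def[abs_def] by (intro borel_measurable_sum interaction_measurable) auto

lemma num_points_measurable:
  assumes "open U"
  shows "num_points n U \<in> borel_measurable (config_lebesgue n :: (nat \<Rightarrow> real^'d::finite) measure)"
proof -
  have "num_points n U = (\<lambda>x. \<Sum>i<n. indicator U (x i))"
  proof
    fix x
    have "{i. i < n \<and> x i \<in> U} = {i\<in>{..<n}. x i \<in> U}" by auto
    then show "num_points n U x = (\<Sum>i<n. indicator U (x i))"
      by (simp add: num_points_def indicator_def Int_def)
  qed
  moreover have "(\<lambda>x. indicator U (x i) :: real) \<in> borel_measurable (config_lebesgue n)" if "i < n" for i
    using config_component_measurable[OF that] by (rule measurable_compose) (use borel_open[OF assms] in auto)
  ultimately show ?thesis by simp
qed

definition inner_cells :: "(real^'d::finite) set \<Rightarrow> nat \<Rightarrow> ('d \<Rightarrow> nat) set" where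
  "inner_cells U K = {i \<in> cells K. cube K i \<subseteq> U}"

text \<open>
  Since \<open>U\<close> is open, the small cells around a point of \<open>U\<close> lie in \<open>U\<close>.
\<close>

lemma inner_cells_eventually:
  fixes x :: "real^'d::finite"
  assumes "open U" "x \<in> unit_cube"
  shows "\<forall>\<^sub>F K in sequentially. cellof K x \<in> inner_cells U K \<longleftrightarrow> x \<in> U"
proof (cases "x \<in> U")
  case True
  then obtain e where e: "0 < e" "ball x e \<subseteq> U" using assms open_contains_ball by blast
  have "cellof K x \<in> inner_cells U K" if "real CARD('d) / 2 ^ K < e" for K
  proof -
    have "dist x y < e" if y: "y \<in> cube K (cellof K x)" for y
      using cube_diameter[OF in_own_cube[OF assms(2)] y] \<open>real CARD('d) / 2 ^ K < e\<close> by linarith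
    then have "cube K (cellof K x) \<subseteq> ball x e" by auto
    then show ?thesis using e assms by (auto simp: inner_cells_def cellof_cells)
  qed
  then show ?thesis using small_cubes[OF e(1), where 'd = 'd] True by (auto elim: eventually_mono)
next
  case False
  then have "cellof K x \<notin> inner_cells U K" for K using in_own_cube[OF assms(2), of K] by (auto simp: inner_cells_def)
  then show ?thesis using False by simp
qed

definition inner_count :: "(real^'d::finite) set \<Rightarrow> nat \<Rightarrow> (('d \<Rightarrow> nat) \<Rightarrow> nat) \<Rightarrow> real" where
  "inner_count U K m = (\<Sum>i\<in>inner_cells U K. real (m i))"

lemma inner_count_occ: "inner_count U K (occ n c) = real (card {i. i < n \<and> c i \<in> inner_cells U K})"
proof -
  have "finite (inner_cells U K)" by (rule finite_subset[of _ "cells K"]) (auto simp: inner_cells_def)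
  moreover have "{i. i < n \<and> c i \<in> inner_cells U K} = (\<Union>a\<in>inner_cells U K. {i\<in>{..<n}. c i = a})" by auto
  ultimately have "card {i. i < n \<and> c i \<in> inner_cells U K} = (\<Sum>a\<in>inner_cells U K. card {i\<in>{..<n}. c i = a})"
    by (simp only:) (rule card_UN_disjoint, auto)
  then show ?thesis by (simp add: inner_count_def occ_def)
qed

lemma inner_count_eventually:
  fixes x :: "nat \<Rightarrow> real^'d::finite"
  assumes U: "open U" and x: "x \<in> space (config_lebesgue n)"
  shows "\<forall>\<^sub>F K in sequentially. inner_count U K (occ n (cellvec K n x)) = num_points n U x"
proof -
  have "\<forall>\<^sub>F K in sequentially. \<forall>i\<in>{..<n}. cellof K (x i) \<in> inner_cells U K \<longleftrightarrow> x i \<in> U"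
    using config_in_cube[OF x] by (intro eventually_ball_finite ballI inner_cells_eventually U) auto
  then show ?thesis
  proof eventually_elim
    case (elim K)
    then have "{i. i < n \<and> cellvec K n x i \<in> inner_cells U K} = {i. i < n \<and> x i \<in> U}" by (auto simp: cellvec_def)
    then show ?case by (simp add: inner_count_occ num_points_def)
  qed
qed

abbreviation gas_weights :: "'d::finite itself \<Rightarrow> real \<Rightarrow> nat \<Rightarrow> real" where
  "gas_weights _ \<beta> \<equiv> (\<lambda>k. \<beta> * level_weight (2 ^ (CARD('d) - 2)) k)"

lemma trunc_weight_eq:
  fixes x :: "nat \<Rightarrow> real^'d::finite"
  assumes x: "x \<in> space (config_lebesgue n)"
  shows "exp (- \<beta> * trunc_energy K n x) = exp (\<beta> * real n * (2 ^ (CARD('d) - 2)) ^ K) * exp (- fine_energy (gas_weights TYPE('d) \<beta>) K 0 (occ n (cellvec K n x)))"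
proof -
  have "occ n (cellvec K n x) = occ n (\<lambda>i. cellof K (x i))" by (auto simp: occ_def cellvec_def fun_eq_iff intro!: arg_cong[where f = card])
  then show ?thesis using trunc_energy_eq[of n x \<beta> K] config_in_cube[OF x] by (simp add: exp_add[symmetric])
qed

lemma trunc_integral:
  fixes \<Phi> :: "(('d::finite \<Rightarrow> nat) \<Rightarrow> nat) \<Rightarrow> real"
  shows "(\<integral>x. \<Phi> (occ n (cellvec K n x)) * exp (- \<beta> * trunc_energy K n x) \<partial>config_lebesgue n)
     = (exp (\<beta> * real n * (2 ^ (CARD('d) - 2)) ^ K) * ((1 / 2 ^ CARD('d)) ^ K) ^ n * fact n) * gibbs_sum (gas_weights TYPE('d) \<beta>) K n \<Phi>"
proof -
  let ?e = "exp (\<beta> * real n * (2 ^ (CARD('d) - 2)) ^ K)"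
  let ?F = "\<lambda>m. ?e * (\<Phi> m * exp (- fine_energy (gas_weights TYPE('d) \<beta>) K 0 m))"
  have "(\<integral>x. \<Phi> (occ n (cellvec K n x)) * exp (- \<beta> * trunc_energy K n x) \<partial>config_lebesgue n)
     = (\<integral>x. ?F (occ n (cellvec K n x)) \<partial>config_lebesgue n)"
    by (intro Bochner_Integration.integral_cong refl) (simp only: trunc_weight_eq mult.left_commute)
  also have "\<dots> = ((1 / 2 ^ CARD('d)) ^ K) ^ n * (\<Sum>c\<in>PiE {..<n} (\<lambda>_. cells K). ?F (occ n c))"
    by (rule cell_function_integral)
  also have "(\<Sum>c\<in>PiE {..<n} (\<lambda>_. cells K). ?F (occ n c)) = fact n * (\<Sum>m\<in>occupations (cells K) n. ?F m / (\<Prod>i\<in>cells K. fact (m i)))"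
    by (rule sum_labelled_configurations) simp
  also have "(\<Sum>m\<in>occupations (cells K) n. ?F m / (\<Prod>i\<in>cells K. fact (m i))) = ?e * gibbs_sum (gas_weights TYPE('d) \<beta>) K n \<Phi>"
    unfolding gibbs_sum_def sum_distrib_left by (intro sum.cong refl) (simp add: gibbs_weight_def fine_weight_def)
  finally show ?thesis by simp
qed

lemma avg_eq_trunc_integrals:
  fixes \<Phi> :: "(('d::finite \<Rightarrow> nat) \<Rightarrow> nat) \<Rightarrow> real"
  shows "avg (gas_weights TYPE('d) \<beta>) K n \<Phi> =
     (\<integral>x. \<Phi> (occ n (cellvec K n x)) * exp (- \<beta> * trunc_energy K n x) \<partial>config_lebesgue n) /
     (\<integral>x. exp (- \<beta> * trunc_energy K n x) \<partial>(config_lebesgue n :: (nat \<Rightarrow> real^'d) measure))"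
  using trunc_integral[where \<Phi> = \<Phi> and n = n and K = K and \<beta> = \<beta>]
    trunc_integral[where \<Phi> = "\<lambda>_ :: ('d \<Rightarrow> nat) \<Rightarrow> nat. 1" and n = n and K = K and \<beta> = \<beta>]
  by (simp add: avg_def)

lemma trunc_energy_eventually:
  "AE x in (config_lebesgue n :: (nat \<Rightarrow> real^'d::finite) measure). \<forall>\<^sub>F K in sequentially. trunc_energy K n x = energy n x"
  using AE_distinct_points AE_space
proof eventually_elim
  case (elim x)
  have "\<forall>\<^sub>F K in sequentially. \<forall>i\<in>{..<n}. \<forall>j\<in>{..<n} - {i}. trunc_interaction K (x i) (x j) = interaction (x i) (x j)"
    using elim config_in_cube[OF elim(2)] by (intro eventually_ball_finite ballI trunc_interaction_eventually) auto
  then show ?case by eventually_elim (simp add: trunc_energy_def energy_def)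
qed

lemma level_weight_nonneg: "1 \<le> \<theta> \<Longrightarrow> 0 \<le> level_weight \<theta> k"
  by (cases k) (auto simp: level_weight_def mult_right_mono)

lemma trunc_energy_nonneg: "0 \<le> trunc_energy K n (x :: nat \<Rightarrow> real^'d::finite)"
  unfolding trunc_energy_def trunc_interaction_def
  by (intro sum_nonneg mult_nonneg_nonneg level_weight_nonneg) auto

lemma trunc_measurable:
  "(\<lambda>x. \<Phi> (occ n (cellvec K n x)) * exp (- \<beta> * trunc_energy K n x)) \<in> borel_measurable (config_lebesgue n :: (nat \<Rightarrow> real^'d::finite) measure)"
proof -
  have "(\<lambda>x. \<Phi> (occ n (cellvec K n x)) * (exp (\<beta> * real n * (2 ^ (CARD('d) - 2)) ^ K) * exp (- fine_energy (gas_weights TYPE('d) \<beta>) K 0 (occ n (cellvec K n x))))) \<in> borel_measurable (config_lebesgue n :: (nat \<Rightarrow> real^'d::finite) measure)"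
    by (rule cell_function_measurable[where F = "\<lambda>c. \<Phi> (occ n c) * (exp (\<beta> * real n * (2 ^ (CARD('d) - 2)) ^ K) * exp (- fine_energy (gas_weights TYPE('d) \<beta>) K 0 (occ n c)))"])
  then show ?thesis by (rule measurable_cong[THEN iffD1, rotated]) (simp only: trunc_weight_eq)
qed

lemma bounded_on_counts:
  fixes \<phi> :: "real \<Rightarrow> real"
  assumes "j \<le> n" shows "\<bar>\<phi> (real j)\<bar> \<le> (\<Sum>j\<le>n. \<bar>\<phi> (real j)\<bar>)"
  using assms by (intro member_le_sum[of j "{..n}" "\<lambda>j. \<bar>\<phi> (real j)\<bar>"]) auto

text \<open>
  For distinct points both the truncated energy and the count of inner cells are eventually constant in
  \<open>K\<close>, and the integrands are bounded because the truncated energy is nonnegative.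
\<close>

lemma trunc_integral_tendsto:
  fixes U :: "(real^'d::finite) set" and \<phi> :: "real \<Rightarrow> real"
  assumes U: "open U" and \<beta>: "0 < \<beta>" and \<phi>: "\<phi> \<in> borel_measurable borel"
  shows "(\<lambda>K. \<integral>x. \<phi> (inner_count U K (occ n (cellvec K n x))) * exp (- \<beta> * trunc_energy K n x) \<partial>config_lebesgue n)
     \<longlonglongrightarrow> (\<integral>x. \<phi> (num_points n U x) * exp (- \<beta> * energy n x) \<partial>config_lebesgue n)"
proof (rule integral_dominated_convergence)
  let ?\<mu> = "config_lebesgue n :: (nat \<Rightarrow> real^'d) measure"
  let ?B = "\<Sum>j\<le>n. \<bar>\<phi> (real j)\<bar>"
  interpret prob_space ?\<mu> by (rule prob_space_config)
  have [measurable]: "num_points n U \<in> borel_measurable ?\<mu>" "energy n \<in> borel_measurable ?\<mu>" "\<phi> \<in> borel_measurable borel"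
    using num_points_measurable[OF U] energy_measurable \<phi> by auto
  show "(\<lambda>x. \<phi> (num_points n U x) * exp (- \<beta> * energy n x)) \<in> borel_measurable ?\<mu>" by measurable
  show "(\<lambda>x. \<phi> (inner_count U K (occ n (cellvec K n x))) * exp (- \<beta> * trunc_energy K n x)) \<in> borel_measurable ?\<mu>" for K
    by (rule trunc_measurable[where \<Phi> = "\<lambda>m. \<phi> (inner_count U K m)"])
  show "integrable ?\<mu> (\<lambda>_. ?B)" by simp
  show "AE x in ?\<mu>. (\<lambda>K. \<phi> (inner_count U K (occ n (cellvec K n x))) * exp (- \<beta> * trunc_energy K n x))
     \<longlonglongrightarrow> \<phi> (num_points n U x) * exp (- \<beta> * energy n x)"
    using trunc_energy_eventually AE_space
  proof eventually_elim
    case (elim x)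
    have "\<forall>\<^sub>F K in sequentially. \<phi> (inner_count U K (occ n (cellvec K n x))) * exp (- \<beta> * trunc_energy K n x) = \<phi> (num_points n U x) * exp (- \<beta> * energy n x)"
      using elim(1) inner_count_eventually[OF U elim(2)] by eventually_elim simp
    then show ?case by (rule tendsto_eventually)
  qed
  show "AE x in ?\<mu>. norm (\<phi> (inner_count U K (occ n (cellvec K n x))) * exp (- \<beta> * trunc_energy K n x)) \<le> ?B" for K
  proof (rule AE_I2)
    fix x assume "x \<in> space ?\<mu>"
    have "card {i. i < n \<and> cellvec K n x i \<in> inner_cells U K} \<le> card {..<n}" by (intro card_mono) auto
    then have 1: "\<bar>\<phi> (inner_count U K (occ n (cellvec K n x)))\<bar> \<le> ?B"
      unfolding inner_count_occ by (intro bounded_on_counts) simp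
    have "exp (- \<beta> * trunc_energy K n x) \<le> 1" using trunc_energy_nonneg[of K n x] \<beta> by simp
    then have "\<bar>\<phi> (inner_count U K (occ n (cellvec K n x)))\<bar> * exp (- \<beta> * trunc_energy K n x) \<le> ?B * 1"
      using 1 by (intro mult_mono) (auto intro: sum_nonneg)
    then show "norm (\<phi> (inner_count U K (occ n (cellvec K n x))) * exp (- \<beta> * trunc_energy K n x)) \<le> ?B"
      by (simp add: abs_mult)
  qed
qed

lemma partition_function_pos: 
  assumes "0 < \<beta>" shows "0 < partition_function TYPE('d::finite) n \<beta>"
proof -
  let ?\<mu> = "config_lebesgue n :: (nat \<Rightarrow> real^'d) measure"
  interpret prob_space ?\<mu> by (rule prob_space_config)
  have [measurable]: "energy n \<in> borel_measurable ?\<mu>" by (rule energy_measurable)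
  have e0: "0 \<le> energy n x" for x :: "nat \<Rightarrow> real^'d"
    unfolding energy_def interaction_def by (intro sum_nonneg) simp
  have int: "integrable ?\<mu> (\<lambda>x. exp (- \<beta> * energy n x))"
    by (rule integrable_const_bound[where B = 1]) (use e0 assms in auto)
  have "(\<integral>x. exp (- \<beta> * energy n x) \<partial>?\<mu>) \<noteq> 0"
  proof
    assume "(\<integral>x. exp (- \<beta> * energy n x) \<partial>?\<mu>) = 0"
    then have "AE x in ?\<mu>. exp (- \<beta> * energy n x) = 0"
      using integral_nonneg_eq_0_iff_AE[OF int] by simp
    then show False by simp
  qed
  moreover have "0 \<le> (\<integral>x. exp (- \<beta> * energy n x) \<partial>?\<mu>)" by simp
  ultimately show ?thesis unfolding partition_function_def by linarith
qed

lemma gas_integral: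
  fixes f :: "(nat \<Rightarrow> real^'d::finite) \<Rightarrow> real"
  assumes "0 < \<beta>" and f: "f \<in> borel_measurable (config_lebesgue n)"
  shows "(\<integral>x. f x \<partial>coulomb_gas n \<beta>) = (\<integral>x. f x * exp (- \<beta> * energy n x) \<partial>config_lebesgue n) / partition_function TYPE('d) n \<beta>"
proof -
  have [measurable]: "energy n \<in> borel_measurable (config_lebesgue n :: (nat \<Rightarrow> real^'d) measure)" by (rule energy_measurable)
  have Z: "0 < partition_function TYPE('d) n \<beta>" by (rule partition_function_pos[OF assms(1)])
  have "(\<integral>x. f x \<partial>coulomb_gas n \<beta>) = (\<integral>x. (exp (- \<beta> * energy n x) / partition_function TYPE('d) n \<beta>) *\<^sub>R f x \<partial>config_lebesgue n)"
    unfolding coulomb_gas_def using Z by (intro integral_density f) auto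
  also have "\<dots> = (\<integral>x. f x * exp (- \<beta> * energy n x) / partition_function TYPE('d) n \<beta> \<partial>config_lebesgue n)"
    by (intro Bochner_Integration.integral_cong refl) simp
  finally show ?thesis by simp
qed

lemma gas_expectation_tendsto:
  fixes U :: "(real^'d::finite) set" and \<phi> :: "real \<Rightarrow> real"
  assumes U: "open U" and \<beta>: "0 < \<beta>" and \<phi>: "\<phi> \<in> borel_measurable borel"
  shows "(\<lambda>K. avg (gas_weights TYPE('d) \<beta>) K n (\<lambda>m. \<phi> (inner_count U K m))) \<longlonglongrightarrow> (\<integral>x. \<phi> (num_points n U x) \<partial>coulomb_gas n \<beta>)"
proof -
  have num: "(\<lambda>x. \<phi> (num_points n U x)) \<in> borel_measurable (config_lebesgue n :: (nat \<Rightarrow> real^'d) measure)"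
    by (rule measurable_compose[OF num_points_measurable[OF U] \<phi>])
  have Z: "(\<lambda>K. \<integral>x. exp (- \<beta> * trunc_energy K n x) \<partial>(config_lebesgue n :: (nat \<Rightarrow> real^'d) measure)) \<longlonglongrightarrow> partition_function TYPE('d) n \<beta>"
    using trunc_integral_tendsto[OF U \<beta>, of "\<lambda>_. 1" n] by (simp add: partition_function_def)
  show ?thesis
    unfolding avg_eq_trunc_integrals gas_integral[OF \<beta> num]
    by (intro tendsto_divide Z trunc_integral_tendsto[OF U \<beta> \<phi>] less_imp_neq[OF partition_function_pos[OF \<beta>], symmetric])
qed

lemma prob_space_gas:
  assumes \<beta>: "0 < \<beta>" shows "prob_space (coulomb_gas n \<beta> :: (nat \<Rightarrow> real^'d::finite) measure)"
proof
  let ?\<mu> = "config_lebesgue n :: (nat \<Rightarrow> real^'d) measure"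
  interpret prob_space ?\<mu> by (rule prob_space_config)
  have [measurable]: "energy n \<in> borel_measurable ?\<mu>" by (rule energy_measurable)
  let ?Z = "partition_function TYPE('d) n \<beta>"
  have Z: "0 < ?Z" by (rule partition_function_pos[OF \<beta>])
  have e0: "0 \<le> energy n x" for x :: "nat \<Rightarrow> real^'d"
    unfolding energy_def interaction_def by (intro sum_nonneg) simp
  have int: "integrable ?\<mu> (\<lambda>x. exp (- \<beta> * energy n x))"
    by (rule integrable_const_bound[where B = 1]) (use e0 \<beta> in auto)
  have "emeasure (coulomb_gas n \<beta> :: (nat \<Rightarrow> real^'d) measure) (space (coulomb_gas n \<beta>)) = (\<integral>\<^sup>+ x. ennreal (exp (- \<beta> * energy n x) / ?Z) \<partial>?\<mu>)"
    unfolding coulomb_gas_def by (subst emeasure_density) (auto intro!: nn_integral_cong)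
  also have "\<dots> = ennreal (\<integral>x. exp (- \<beta> * energy n x) / ?Z \<partial>?\<mu>)"
    using int Z by (intro nn_integral_eq_integral) auto
  also have "\<dots> = 1" using Z by (simp add: partition_function_def)
  finally show "emeasure (coulomb_gas n \<beta> :: (nat \<Rightarrow> real^'d) measure) (space (coulomb_gas n \<beta>)) = 1" .
qed

section \<open>Cells that meet the boundary\<close>

lemma cube_mono_anc:
  assumes "i \<in> cells K" "k \<le> K"
  shows "cube K i \<subseteq> cube k (anc (K - k) i)"
proof
  fix x assume x: "x \<in> cube K i"
  then have "x \<in> unit_cube" using cube_subset_unit[OF assms(1)] by auto
  then show "x \<in> cube k (anc (K - k) i)"
    using x in_cube_iff[of x K i] in_cube_iff[of x k "anc (K - k) i"] cellof_anc[OF assms(2), of x] by simp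
qed

lemma cube_nonempty: "cube K i \<noteq> {}"
proof -
  have "(\<chi> l. real (i l) / 2 ^ K) \<in> cube K i" by (simp add: cube_def divide_strict_right_mono)
  then show ?thesis by auto
qed

lemma convex_cube: "convex (cube K i :: (real^'d::finite) set)"
proof -
  have "cube K i = (\<Inter>l. {x. real (i l) / 2 ^ K \<le> axis l 1 \<bullet> x} \<inter> {x. axis l 1 \<bullet> x < (real (i l) + 1) / 2 ^ K})"
    by (auto simp: cube_def inner_axis inner_commute)
  then show ?thesis
    by (auto intro!: convex_INT convex_Int convex_halfspace_lt convex_halfspace_ge)
qed

text \<open>
  A connected set that meets \<open>U\<close> and its complement meets the frontier.
\<close>

lemma mixed_meets_frontier:
  fixes U :: "(real^'d::finite) set"
  assumes q: "q \<in> mixed (inner_cells U K) K k" and k: "k \<le> K"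
  shows "cube k q \<inter> frontier U \<noteq> {}"
proof (rule connected_Int_frontier)
  have sub: "cube K i \<subseteq> cube k q" if "i \<in> leaves K k q" for i
    using cube_mono_anc[of i K k] k that by (auto simp: leaves_def)
  obtain i where i: "i \<in> inner_cells U K" "i \<in> leaves K k q" using q by (auto simp: mixed_def)
  then have "cube K i \<subseteq> U" by (simp add: inner_cells_def)
  then show "cube k q \<inter> U \<noteq> {}" using sub[OF i(2)] cube_nonempty[of K i] by blast
  obtain j where j: "j \<in> leaves K k q" "j \<notin> inner_cells U K" using q by (auto simp: mixed_def)
  then have "\<not> cube K j \<subseteq> U" by (auto simp: inner_cells_def leaves_def)
  then show "cube k q - U \<noteq> {}" using sub[OF j(1)] by blast
  show "connected (cube k q)" using convex_cube by (rule convex_connected)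
qed

lemma smooth_imp_C1:
  assumes "smooth_fun_on W f"
  shows "\<And>x. x \<in> W \<Longrightarrow> f differentiable (at x)" "\<And>v. continuous_on W (\<lambda>x. frechet_derivative f (at x) v)"
proof -
  have "Ck_on (Suc 0) W f" using assms unfolding smooth_fun_on_def by blast
  then show "\<And>x. x \<in> W \<Longrightarrow> f differentiable (at x)" "\<And>v. continuous_on W (\<lambda>x. frechet_derivative f (at x) v)"
    by auto
qed

definition partial :: "(real^'d::finite \<Rightarrow> real) \<Rightarrow> 'd \<Rightarrow> real^'d \<Rightarrow> real" where
  "partial f l x = frechet_derivative f (at x) (axis l 1)"

lemma frechet_derivative_partials:
  fixes f :: "real^'d::finite \<Rightarrow> real"
  assumes "f differentiable (at x)"
  shows "frechet_derivative f (at x) h = (\<Sum>l\<in>UNIV. h $ l * partial f l x)"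
proof -
  have lin: "linear (frechet_derivative f (at x))" by (rule linear_frechet_derivative[OF assms])
  have "frechet_derivative f (at x) h = frechet_derivative f (at x) (\<Sum>l\<in>UNIV. h $ l *\<^sub>R axis l 1)"
    using basis_expansion[of h] by (simp add: scalar_mult_eq_scaleR)
  also have "\<dots> = (\<Sum>l\<in>UNIV. h $ l * partial f l x)"
    using lin by (simp add: linear_sum linear_scale partial_def)
  finally show ?thesis .
qed

text \<open>
  The mean value theorem along the segment, written in partial derivatives.
\<close>

lemma mean_value_partials:
  fixes f :: "real^'d::finite \<Rightarrow> real"
  assumes B: "convex B" and f: "\<And>x. x \<in> B \<Longrightarrow> f differentiable (at x)" and xy: "x \<in> B" "y \<in> B"
  shows "\<exists>z\<in>B. f y - f x = (\<Sum>l\<in>UNIV. (y $ l - x $ l) * partial f l z)"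
proof -
  define \<gamma> where "\<gamma> t = x + t *\<^sub>R (y - x)" for t :: real
  have inB: "\<gamma> t \<in> B" if "0 \<le> t" "t \<le> 1" for t
  proof -
    have "\<gamma> t = (1 - t) *\<^sub>R x + t *\<^sub>R y" by (simp add: \<gamma>_def algebra_simps)
    then show ?thesis using B xy that by (simp add: convexD_alt)
  qed
  have der: "((\<lambda>t. f (\<gamma> t)) has_real_derivative frechet_derivative f (at (\<gamma> t)) (y - x)) (at t)" if t: "0 \<le> t" "t \<le> 1" for t
  proof -
    have 1: "(\<gamma> has_derivative (\<lambda>h. h *\<^sub>R (y - x))) (at t)"
      unfolding \<gamma>_def[abs_def] by (auto intro!: derivative_eq_intros)
    have 2: "(f has_derivative frechet_derivative f (at (\<gamma> t))) (at (\<gamma> t))"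
      using f[OF inB[OF t]] by (simp add: frechet_derivative_works)
    have lin: "linear (frechet_derivative f (at (\<gamma> t)))" by (rule linear_frechet_derivative[OF f[OF inB[OF t]]])
    have "((\<lambda>t. f (\<gamma> t)) has_derivative (\<lambda>h. frechet_derivative f (at (\<gamma> t)) (h *\<^sub>R (y - x)))) (at t)"
      using diff_chain_at[OF 1 2] by (simp add: o_def)
    then show ?thesis using lin by (simp add: has_field_derivative_def linear_scale mult.commute[of _ "frechet_derivative f (at (\<gamma> t)) (y - x)"])
  qed
  obtain t where t: "0 < t" "t < 1" "f (\<gamma> 1) - f (\<gamma> 0) = (1 - 0) * frechet_derivative f (at (\<gamma> t)) (y - x)"
    using MVT2[of 0 1 "\<lambda>t. f (\<gamma> t)" "\<lambda>t. frechet_derivative f (at (\<gamma> t)) (y - x)"] der by auto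
  have "\<gamma> t \<in> B" using t by (intro inB) auto
  moreover have "f y - f x = (\<Sum>l\<in>UNIV. (y $ l - x $ l) * partial f l (\<gamma> t))"
    using t frechet_derivative_partials[OF f[OF \<open>\<gamma> t \<in> B\<close>]] by (simp add: \<gamma>_def)
  ultimately show ?thesis by blast
qed

definition touched :: "nat \<Rightarrow> (real^'d::finite) set \<Rightarrow> ('d \<Rightarrow> nat) set" where
  "touched k S = {q \<in> cells k. cube k q \<inter> S \<noteq> {}}"

lemma card_columns:
  "card {q \<in> (cells k :: ('d::finite \<Rightarrow> nat) set). q l = 0} = (2 ^ (CARD('d) - 1)) ^ k"
proof -
  have "{q \<in> (cells k :: ('d \<Rightarrow> nat) set). q l = 0} = PiE UNIV (\<lambda>m. if m = l then {0} else {..<2 ^ k})"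
  proof (rule set_eqI)
    fix q :: "'d \<Rightarrow> nat"
    have "(\<forall>m. q m \<in> (if m = l then {0} else {..<2 ^ k})) \<longleftrightarrow> (\<forall>m. q m < 2 ^ k) \<and> q l = 0" (is "?L \<longleftrightarrow> ?R")
    proof
      assume L: ?L
      have "q m < 2 ^ k" for m using spec[OF L, of m] by (cases "m = l") simp_all
      then show ?R using spec[OF L, of l] by simp
    qed simp
    then show "q \<in> {q \<in> cells k. q l = 0} \<longleftrightarrow> q \<in> PiE UNIV (\<lambda>m. if m = l then {0} else {..<2 ^ k})"
      by (simp only: PiE_iff cells_def mem_Collect_eq) simp
  qed
  then have "card {q \<in> (cells k :: ('d \<Rightarrow> nat) set). q l = 0} = (\<Prod>m\<in>(UNIV::'d set). if m = l then 1 else 2 ^ k)"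
    by (simp add: card_PiE if_distrib cong: if_cong)
  also have "\<dots> = (\<Prod>m\<in>UNIV - {l}. 2 ^ k)"
    by (subst prod.remove[of UNIV l]) (auto intro!: prod.cong)
  also have "\<dots> = (2 ^ k) ^ (CARD('d) - 1)" by (simp add: card_Diff_singleton)
  finally show ?thesis by (simp add: mult.commute flip: power_mult)
qed

text \<open>
  The cells are grouped into columns in direction \<open>l\<close>; within a column the members of \<open>S\<close> lie in an interval of
  length \<open>D\<close>.
\<close>

lemma card_by_columns:
  fixes S :: "('d::finite \<Rightarrow> nat) set"
  assumes S: "S \<subseteq> cells k"
    and col: "\<And>q q'. q \<in> S \<Longrightarrow> q' \<in> S \<Longrightarrow> (\<And>m. m \<noteq> l \<Longrightarrow> q m = q' m) \<Longrightarrow> q' l \<le> q l + D"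
  shows "card S \<le> (D + 1) * (2 ^ (CARD('d) - 1)) ^ k"
proof -
  define F where "F c = {q \<in> S. q(l := 0) = c}" for c
  have finS: "finite S" by (rule finite_subset[OF S finite_cells])
  let ?C = "{q \<in> (cells k :: ('d \<Rightarrow> nat) set). q l = 0}"
  have SF: "S = (\<Union>c\<in>?C. F c)" using S by (auto simp: F_def cells_def)
  have cF: "card (F c) \<le> D + 1" for c
  proof (cases "F c = {}")
    case False
    have finF: "finite (F c)" using finS by (simp add: F_def)
    have eq: "q = c(l := q l)" if "q \<in> F c" for q using that by (auto simp: F_def)
    have same: "q m = q' m" if "q \<in> F c" "q' \<in> F c" "m \<noteq> l" for q q' m
      using eq[OF that(1)] eq[OF that(2)] that(3) by (metis fun_upd_other)
    define b where "b = Min ((\<lambda>q. q l) ` F c)"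
    have "b \<in> (\<lambda>q. q l) ` F c" unfolding b_def using finF False by (intro Min_in) auto
    then obtain q0 where q0: "q0 \<in> F c" "q0 l = b" by auto
    have "(\<lambda>q. q l) ` F c \<subseteq> {b..b + D}"
    proof
      fix y assume "y \<in> (\<lambda>q. q l) ` F c"
      then obtain q where q: "q \<in> F c" "y = q l" by auto
      have "b \<le> q l" unfolding b_def using finF q by (intro Min_le) auto
      moreover have "q l \<le> q0 l + D" using q q0 same by (intro col) (auto simp: F_def)
      ultimately show "y \<in> {b..b + D}" using q q0 by simp
    qed
    moreover have "inj_on (\<lambda>q. q l) (F c)"
    proof (rule inj_onI)
      fix q q' assume "q \<in> F c" "q' \<in> F c" "q l = q' l"
      then show "q = q'" using eq[of q] eq[of q'] by simp
    qed
    ultimately have "card (F c) \<le> card {b..b + D}" by (intro card_inj_on_le) auto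
    then show ?thesis by simp
  qed simp
  have "card S \<le> (\<Sum>c\<in>?C. card (F c))" by (subst SF, rule card_UN_le) simp
  also have "\<dots> \<le> (\<Sum>c\<in>?C. D + 1)" by (intro sum_mono cF)
  also have "\<dots> = (D + 1) * (2 ^ (CARD('d) - 1)) ^ k" by (simp add: card_columns)
  finally show ?thesis .
qed

text \<open>
  Where the partial derivative in direction \<open>l\<close> is bounded away from zero, two zeros of \<open>f\<close> over the same cell
  of the other coordinates differ in coordinate \<open>l\<close> by at most a multiple of the cell size.  So every
  column contains a bounded number of cells that meet the zero set.
\<close>

lemma local_touched_bound:
  fixes f :: "real^'d::finite \<Rightarrow> real"
  assumes B: "convex B" and f: "\<And>x. x \<in> B \<Longrightarrow> f differentiable (at x)"
    and a: "0 < a" and low: "\<And>x. x \<in> B \<Longrightarrow> a \<le> \<bar>partial f l x\<bar>" and up: "\<And>x m. x \<in> B \<Longrightarrow> \<bar>partial f m x\<bar> \<le> b"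
    and S: "S \<subseteq> {x \<in> B. f x = 0}"
  shows "\<exists>T. \<forall>k. real (card (touched k S)) \<le> T * (2 ^ (CARD('d) - 1)) ^ k"
proof -
  define D where "D = nat \<lceil>real CARD('d) * b / a\<rceil> + 1"
  have "card (touched k S) \<le> (D + 1) * (2 ^ (CARD('d) - 1)) ^ k" for k
  proof (rule card_by_columns)
    show "touched k S \<subseteq> cells k" by (auto simp: touched_def)
    fix q q' assume q: "q \<in> touched k S" "q' \<in> touched k S" and same: "\<And>m. m \<noteq> l \<Longrightarrow> q m = q' m"
    obtain x where x: "x \<in> cube k q" "x \<in> S" using q by (auto simp: touched_def)
    obtain y where y: "y \<in> cube k q'" "y \<in> S" using q by (auto simp: touched_def)
    have xyB: "x \<in> B" "y \<in> B" "f x = 0" "f y = 0" using x y S by auto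
    obtain z where z: "z \<in> B" "f y - f x = (\<Sum>m\<in>UNIV. (y $ m - x $ m) * partial f m z)"
      using mean_value_partials[OF B f xyB(1,2)] by blast
    have b0: "0 \<le> b" using up[OF z(1), of l] by linarith
    let ?h = "1 / 2 ^ k :: real"
    have "(\<Sum>m\<in>UNIV. (y $ m - x $ m) * partial f m z) = (y $ l - x $ l) * partial f l z + (\<Sum>m\<in>UNIV - {l}. (y $ m - x $ m) * partial f m z)"
      by (rule sum.remove) auto
    then have "(y $ l - x $ l) * partial f l z = - (\<Sum>m\<in>UNIV - {l}. (y $ m - x $ m) * partial f m z)"
      using z xyB by simp
    then have "\<bar>y $ l - x $ l\<bar> * \<bar>partial f l z\<bar> = \<bar>\<Sum>m\<in>UNIV - {l}. (y $ m - x $ m) * partial f m z\<bar>"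
      by (metis abs_minus_cancel abs_mult)
    also have "\<dots> \<le> (\<Sum>m\<in>UNIV - {l}. \<bar>(y $ m - x $ m) * partial f m z\<bar>)" by (rule sum_abs)
    also have "\<dots> \<le> (\<Sum>m\<in>UNIV - {l}. ?h * b)"
    proof (intro sum_mono)
      fix m assume "m \<in> UNIV - {l}"
      then have qm: "q m = q' m" using same by auto
      have "real (q m) / 2 ^ k \<le> x $ m" "x $ m < real (q m) / 2 ^ k + ?h"
        "real (q m) / 2 ^ k \<le> y $ m" "y $ m < real (q m) / 2 ^ k + ?h"
        using spec[OF x(1)[unfolded cube_def mem_Collect_eq], of m] spec[OF y(1)[unfolded cube_def mem_Collect_eq], of m]
        unfolding qm by (simp_all add: add_divide_distrib)
      then have "\<bar>y $ m - x $ m\<bar> \<le> ?h" by linarith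
      then show "\<bar>(y $ m - x $ m) * partial f m z\<bar> \<le> ?h * b"
        unfolding abs_mult using up[OF z(1), of m] by (intro mult_mono) auto
    qed
    also have "\<dots> \<le> real CARD('d) * (?h * b)"
    proof -
      have "card (UNIV - {l}) \<le> CARD('d)" by (intro card_mono) auto
      then have "real (card (UNIV - {l})) * (?h * b) \<le> real CARD('d) * (?h * b)" using b0 by (intro mult_right_mono) auto
      then show ?thesis by (simp only: sum_constant)
    qed
    finally have "\<bar>y $ l - x $ l\<bar> * a \<le> real CARD('d) * (?h * b)"
      using low[OF z(1)] by (meson abs_ge_zero mult_left_mono order_trans)
    then have "\<bar>y $ l - x $ l\<bar> \<le> real CARD('d) * (?h * b) / a" using a by (simp add: field_simps)
    also have "\<dots> = (real CARD('d) * b / a) * ?h" by simp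
    finally have yx: "y $ l - x $ l \<le> (real CARD('d) * b / a) * ?h" by linarith
    have "real (q' l) / 2 ^ k \<le> y $ l" "x $ l < (real (q l) + 1) / 2 ^ k" using x y by (auto simp: cube_def)
    then have "real (q' l) / 2 ^ k < (real (q l) + 1) / 2 ^ k + (real CARD('d) * b / a) / 2 ^ k" using yx by simp
    then have less: "real (q' l) / 2 ^ k < (real (q l) + 1 + real CARD('d) * b / a) / 2 ^ k"
      by (simp only: add_divide_distrib)
    have "u < v" if "u / 2 ^ k < v / 2 ^ k" for u v :: real using that by (simp add: divide_less_cancel)
    from this[OF less] have "real (q' l) < real (q l) + 1 + real CARD('d) * b / a" .
    also have "\<dots> \<le> real (q l) + 1 + real_of_int \<lceil>real CARD('d) * b / a\<rceil>" by simp
    also have "\<dots> \<le> real (q l + D)" by (simp add: D_def)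
    finally show "q' l \<le> q l + D" by simp
  qed
  then have "real (card (touched k S)) \<le> real ((D + 1) * (2 ^ (CARD('d) - 1)) ^ k)" for k
    by (simp only: of_nat_le_iff)
  then have "real (card (touched k S)) \<le> real (D + 1) * (2 ^ (CARD('d) - 1)) ^ k" for k
    by (simp only: of_nat_mult of_nat_power of_nat_numeral)
  then show ?thesis by blast
qed

lemma frontier_touched_bound:
  fixes S :: "(real^'d::finite) set"
  assumes S: "compact S" "smooth_hypersurface S"
  shows "\<exists>T\<ge>0. \<forall>k. real (card (touched k S)) \<le> T * (2 ^ (CARD('d) - 1)) ^ k"
proof -
  have "\<exists>V. open V \<and> p \<in> V \<and> (\<exists>T. \<forall>k. real (card (touched k (S \<inter> V))) \<le> T * (2 ^ (CARD('d) - 1)) ^ k)" if p: "p \<in> S" for p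
  proof -
    obtain W and f :: "real^'d \<Rightarrow> real" where W: "open W" "p \<in> W" "smooth_fun_on W f"
      and nz: "\<forall>x\<in>W. \<exists>v. frechet_derivative f (at x) v \<noteq> 0" and SW: "S \<inter> W = {x \<in> W. f x = 0}"
      using S(2) p unfolding smooth_hypersurface_def by blast
    note C1 = smooth_imp_C1[OF W(3)]
    obtain v where v: "frechet_derivative f (at p) v \<noteq> 0" using nz W by blast
    have "\<exists>l. partial f l p \<noteq> 0"
    proof (rule ccontr)
      assume "\<nexists>l. partial f l p \<noteq> 0"
      then show False using v frechet_derivative_partials[OF C1(1)[OF W(2)], of v] by simp
    qed
    then obtain l where l: "partial f l p \<noteq> 0" by blast
    define a where "a = \<bar>partial f l p\<bar> / 2"
    define b where "b = (\<Sum>m\<in>UNIV. \<bar>partial f m p\<bar>) + 1"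
    have a: "0 < a" using l by (simp add: a_def)
    have cont: "isCont (\<lambda>x. partial f m x) p" for m
      using C1(2)[of "axis m 1"] W unfolding partial_def by (simp add: continuous_on_eq_continuous_at)
    have tn: "((\<lambda>x. partial f m x) \<longlongrightarrow> partial f m p) (nhds p)" for m
      using cont[of m] by (simp add: isCont_def tendsto_at_iff_tendsto_nhds)
    have near: "\<forall>\<^sub>F x in nhds p. \<bar>partial f m x\<bar> < c" if "\<bar>partial f m p\<bar> < c" for m c
      using order_tendstoD(2)[OF tendsto_rabs[OF tn] that] .
    have 1: "\<forall>\<^sub>F x in nhds p. a < \<bar>partial f l x\<bar>"
      using l by (intro order_tendstoD(1)[OF tendsto_rabs[OF tn]]) (simp add: a_def)
    have 2: "\<forall>\<^sub>F x in nhds p. \<forall>m\<in>UNIV. \<bar>partial f m x\<bar> < b"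
    proof (intro eventually_ball_finite ballI near)
      fix m
      have "\<bar>partial f m p\<bar> \<le> (\<Sum>m\<in>UNIV. \<bar>partial f m p\<bar>)" by (intro member_le_sum) auto
      then show "\<bar>partial f m p\<bar> < b" by (simp add: b_def)
    qed simp
    have 3: "\<forall>\<^sub>F x in nhds p. x \<in> W" using W by (simp add: eventually_nhds_in_open)
    have "\<forall>\<^sub>F x in nhds p. x \<in> W \<and> a < \<bar>partial f l x\<bar> \<and> (\<forall>m. \<bar>partial f m x\<bar> < b)"
      using 1 2 3 by eventually_elim auto
    then obtain r where r: "0 < r" "\<And>x. dist x p < r \<Longrightarrow> x \<in> W \<and> a < \<bar>partial f l x\<bar> \<and> (\<forall>m. \<bar>partial f m x\<bar> < b)"
      unfolding eventually_nhds_metric by blast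
    have in_ball: "x \<in> W \<and> a < \<bar>partial f l x\<bar> \<and> (\<forall>m. \<bar>partial f m x\<bar> < b)" if "x \<in> ball p r" for x
      using r(2)[of x] that by (simp add: dist_commute)
    have "\<exists>T. \<forall>k. real (card (touched k (S \<inter> ball p r))) \<le> T * (2 ^ (CARD('d) - 1)) ^ k"
    proof (rule local_touched_bound[where B = "ball p r" and f = f and a = a and b = b and l = l])
      show "S \<inter> ball p r \<subseteq> {x \<in> ball p r. f x = 0}" using SW in_ball by blast
    qed (use in_ball C1(1) a in \<open>auto intro: less_imp_le\<close>)
    then show ?thesis using r(1) by (intro exI[of _ "ball p r"]) auto
  qed
  then obtain V T where V: "\<And>p. p \<in> S \<Longrightarrow> open (V p)" "\<And>p. p \<in> S \<Longrightarrow> p \<in> V p"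
    and T: "\<And>p k. p \<in> S \<Longrightarrow> real (card (touched k (S \<inter> V p))) \<le> T p * (2 ^ (CARD('d) - 1)) ^ k"
    by metis
  obtain P where P: "P \<subseteq> S" "finite P" "S \<subseteq> (\<Union>p\<in>P. V p)"
    using compactE_image[OF S(1), of S V] V by blast
  have "real (card (touched k S)) \<le> (\<Sum>p\<in>P. \<bar>T p\<bar>) * (2 ^ (CARD('d) - 1)) ^ k" for k
  proof -
    have "touched k S \<subseteq> (\<Union>p\<in>P. touched k (S \<inter> V p))" using P by (fastforce simp: touched_def)
    moreover have "finite (\<Union>p\<in>P. touched k (S \<inter> V p))" using P by (auto simp: touched_def)
    ultimately have "card (touched k S) \<le> card (\<Union>p\<in>P. touched k (S \<inter> V p))" by (rule card_mono[rotated])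
    also have "\<dots> \<le> (\<Sum>p\<in>P. card (touched k (S \<inter> V p)))" using P by (intro card_UN_le)
    finally have "real (card (touched k S)) \<le> (\<Sum>p\<in>P. real (card (touched k (S \<inter> V p))))" by (simp flip: of_nat_sum)
    also have "\<dots> \<le> (\<Sum>p\<in>P. \<bar>T p\<bar> * (2 ^ (CARD('d) - 1)) ^ k)"
    proof (intro sum_mono)
      fix p assume "p \<in> P"
      then have "real (card (touched k (S \<inter> V p))) \<le> T p * (2 ^ (CARD('d) - 1)) ^ k" using T P by auto
      also have "\<dots> \<le> \<bar>T p\<bar> * (2 ^ (CARD('d) - 1)) ^ k" by (intro mult_right_mono) auto
      finally show "real (card (touched k (S \<inter> V p))) \<le> \<bar>T p\<bar> * (2 ^ (CARD('d) - 1)) ^ k" .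
    qed
    finally show ?thesis by (simp add: sum_distrib_right)
  qed
  moreover have "0 \<le> (\<Sum>p\<in>P. \<bar>T p\<bar>)" by (intro sum_nonneg) auto
  ultimately show ?thesis by blast
qed

section \<open>A monotone chart at an extreme boundary point\<close>

definition coord_sum :: "real^'d::finite \<Rightarrow> real" where
  "coord_sum x = (\<Sum>l\<in>UNIV. x $ l)"

lemma coord_sum_linear: "coord_sum (x + y) = coord_sum x + coord_sum y" "coord_sum (c *\<^sub>R x) = c * coord_sum x"
  "coord_sum (x - y) = coord_sum x - coord_sum y"
  by (simp_all add: coord_sum_def sum.distrib sum_distrib_left sum_subtractf)

lemma coord_sum_axis: "coord_sum (axis l 1) = 1"
  by (simp add: coord_sum_def axis_def)

lemma bounded_unit_cube: "bounded (unit_cube :: (real^'d::finite) set)"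
proof (rule bounded_subset[OF bounded_cbox])
  show "unit_cube \<subseteq> cbox (\<chi> l. (0::real)) (\<chi> l. (1::real))" by (auto simp: unit_cube_def mem_box_cart less_imp_le)
qed

lemma exists_extreme_point:
  fixes U :: "(real^'d::finite) set"
  assumes "open U" "U \<noteq> {}" "U \<subseteq> unit_cube"
  shows "\<exists>p\<in>frontier U. \<forall>x\<in>closure U. coord_sum x \<le> coord_sum p"
proof -
  have cpt: "compact (closure U)" using bounded_subset[OF bounded_unit_cube assms(3)] by (simp add: compact_closure)
  have ne: "closure U \<noteq> {}" using assms by simp
  have cont: "continuous_on (closure U) coord_sum" unfolding coord_sum_def[abs_def] by (intro continuous_intros)
  obtain p where p: "p \<in> closure U" "\<And>x. x \<in> closure U \<Longrightarrow> coord_sum x \<le> coord_sum p"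
    using continuous_attains_sup[OF cpt ne cont] by blast
  have "p \<notin> U"
  proof
    assume "p \<in> U"
    then obtain e where e: "0 < e" "ball p e \<subseteq> U" using assms(1) open_contains_ball by blast
    obtain l :: 'd where True by simp
    have "dist p (p + (e/2) *\<^sub>R axis l 1) = e / 2" using e by (simp add: dist_norm)
    then have "p + (e/2) *\<^sub>R axis l 1 \<in> U" using e by auto
    then have "coord_sum (p + (e/2) *\<^sub>R axis l 1) \<le> coord_sum p" using p(2) closure_subset by blast
    then show False using e by (simp add: coord_sum_linear coord_sum_axis)
  qed
  then show ?thesis using p assms(1) by (auto simp: frontier_def interior_open)
qed

lemma directional_sign:
  fixes f :: "real^'d::finite \<Rightarrow> real"
  assumes f: "f differentiable (at p)" and pos: "frechet_derivative f (at p) v > 0"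
  shows "\<exists>d>0. \<forall>t>0. t < d \<longrightarrow> f p < f (p + t *\<^sub>R v)"
proof -
  have 1: "((\<lambda>t. p + t *\<^sub>R v) has_derivative (\<lambda>h. h *\<^sub>R v)) (at (0::real))"
    by (auto intro!: derivative_eq_intros)
  have 2: "(f has_derivative frechet_derivative f (at p)) (at (p + 0 *\<^sub>R v))"
    using f by (simp add: frechet_derivative_works)
  have "((\<lambda>t. f (p + t *\<^sub>R v)) has_derivative (\<lambda>h. frechet_derivative f (at p) (h *\<^sub>R v))) (at 0)"
    using diff_chain_at[OF 1 2] by (simp add: o_def)
  then have "((\<lambda>t. f (p + t *\<^sub>R v)) has_real_derivative frechet_derivative f (at p) v) (at 0)"
    using linear_frechet_derivative[OF f]
    by (simp add: has_field_derivative_def linear_scale mult.commute[of _ "frechet_derivative f (at p) v"])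
  from DERIV_pos_inc_right[OF this pos] show ?thesis by auto
qed

lemma frechet_derivative_uminus:
  fixes f :: "real^'d::finite \<Rightarrow> real"
  assumes "f differentiable (at p)"
  shows "(\<lambda>x. - f x) differentiable (at p)" "frechet_derivative (\<lambda>x. - f x) (at p) v = - frechet_derivative f (at p) v"
proof -
  have "((\<lambda>x. - f x) has_derivative (\<lambda>h. - frechet_derivative f (at p) h)) (at p)"
    using assms by (intro has_derivative_minus) (simp add: frechet_derivative_works)
  from fun_cong[OF frechet_derivative_at[OF this], of v] this show "(\<lambda>x. - f x) differentiable (at p)" "frechet_derivative (\<lambda>x. - f x) (at p) v = - frechet_derivative f (at p) v"
    by (auto simp: differentiable_def)
qed

text \<open>
  If two partial derivatives differ, some directions \<open>v1\<close> and \<open>v2\<close>, both increasing the coordinate sum, have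
  derivatives of opposite sign.  A short segment from \<open>p + t v1\<close> to \<open>p + t v2\<close> then contains a zero of \<open>f\<close>,
  that is a frontier point with larger coordinate sum than \<open>p\<close>.
\<close>

lemma extreme_gradient:
  fixes U :: "(real^'d::finite) set" and f :: "real^'d \<Rightarrow> real"
  assumes p: "p \<in> frontier U" "\<And>x. x \<in> closure U \<Longrightarrow> coord_sum x \<le> coord_sum p"
    and W: "open W" "p \<in> W" and f: "\<And>x. x \<in> W \<Longrightarrow> f differentiable (at x)" and SW: "frontier U \<inter> W = {x \<in> W. f x = 0}"
  shows "partial f l p = partial f m p"
proof (rule ccontr)
  have fp: "f differentiable (at p)" using f W by simp
  let ?D = "frechet_derivative f (at p)"
  have lin: "linear ?D" by (rule linear_frechet_derivative[OF fp])
  have no: False if v: "coord_sum v1 > 0" "coord_sum v2 > 0" "?D v1 > 0" "?D v2 < 0" for v1 v2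
  proof -
    obtain e where e: "0 < e" "ball p e \<subseteq> W" using W open_contains_ball by blast
    obtain d1 where d1: "d1 > 0" "\<And>t. t > 0 \<Longrightarrow> t < d1 \<Longrightarrow> f p < f (p + t *\<^sub>R v1)"
      using directional_sign[OF fp v(3)] by blast
    have "frechet_derivative (\<lambda>x. - f x) (at p) v2 > 0" using v(4) frechet_derivative_uminus[OF fp] by simp
    from directional_sign[OF frechet_derivative_uminus(1)[OF fp] this]
    obtain d2 where d2: "d2 > 0" "\<And>t. t > 0 \<Longrightarrow> t < d2 \<Longrightarrow> f p > f (p + t *\<^sub>R v2)" by auto
    have np: "0 < norm v1 + norm v2 + 1" by (simp add: add_nonneg_pos)
    define c where "c = e / (norm v1 + norm v2 + 1)"
    define m0 where "m0 = min (min d1 d2) c"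
    have "0 < c" using e(1) np by (simp add: c_def)
    then have "0 < m0" "m0 \<le> d1" "m0 \<le> d2" "m0 \<le> c" using d1(1) d2(1) by (auto simp: m0_def)
    then have "0 < m0 / 2" "m0 / 2 < d1" "m0 / 2 < d2" "m0 / 2 < c" by linarith+
    then obtain t where t: "0 < t" "t < d1" "t < d2" "t < e / (norm v1 + norm v2 + 1)" unfolding c_def by blast
    have te: "t * (norm v1 + norm v2 + 1) < e" using t(4) np by (simp add: pos_less_divide_eq)
    have tv: "t * norm v1 < e" "t * norm v2 < e"
    proof -
      have "t * norm v1 \<le> t * (norm v1 + norm v2 + 1)" "t * norm v2 \<le> t * (norm v1 + norm v2 + 1)"
        using t(1) by (auto intro!: mult_left_mono)
      then show "t * norm v1 < e" "t * norm v2 < e" using te by linarith+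
    qed
    define a1 a2 where "a1 = p + t *\<^sub>R v1" and "a2 = p + t *\<^sub>R v2"
    have "a1 \<in> ball p e" "a2 \<in> ball p e" using tv t(1) by (auto simp: a1_def a2_def dist_norm)
    then have seg: "closed_segment a1 a2 \<subseteq> W" using e closed_segment_subset[of a1 "ball p e" a2] by auto
    have "continuous_on W f" using f W(1) differentiable_imp_continuous_on by (metis differentiable_at_imp_differentiable_on)
    then have "continuous_on (closed_segment a1 a2) f" using seg continuous_on_subset by blast
    then have con: "connected (f ` closed_segment a1 a2)" by (intro connected_continuous_image connected_segment)
    have fp0: "f p = 0" using p(1) W(2) SW by blast
    have "f a2 \<le> 0" "0 \<le> f a1" using d1(2)[OF t(1,2)] d2(2)[OF t(1,3)] fp0 by (auto simp: a1_def a2_def)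
    then have "0 \<in> f ` closed_segment a1 a2" using connectedD_interval[OF con, of "f a2" "f a1" 0] by auto
    then obtain z where z: "z \<in> closed_segment a1 a2" "f z = 0" by auto
    then have "z \<in> closure U" using seg SW by (auto simp: frontier_def)
    then have "coord_sum z \<le> coord_sum p" by (rule p(2))
    moreover obtain u where u: "0 \<le> u" "u \<le> 1" "z = (1 - u) *\<^sub>R a1 + u *\<^sub>R a2" using z(1) by (auto simp: in_segment)
    have "coord_sum z = coord_sum p + t * ((1 - u) * coord_sum v1 + u * coord_sum v2)"
      unfolding u(3) a1_def a2_def by (simp add: coord_sum_linear algebra_simps)
    moreover have "0 < (1 - u) * coord_sum v1 + u * coord_sum v2"
      using u v(1,2) by (cases "u = 0") (auto intro!: add_nonneg_pos)
    ultimately show False using t(1) mult_pos_pos[of t "(1 - u) * coord_sum v1 + u * coord_sum v2"] by linarith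
  qed
  have main: False if lt: "partial f l p < partial f m p" for l m
  proof -
    \<comment> \<open>Both directions have coordinate sum one, and \<open>N\<close> makes the difference of the partials dominate.\<close>
    define N where "N = (\<bar>partial f l p\<bar> + 1) / (partial f m p - partial f l p)"
    have ND: "N * (partial f m p - partial f l p) = \<bar>partial f l p\<bar> + 1" using lt by (simp add: N_def)
    define v1 v2 :: "real^'d" where "v1 = N *\<^sub>R (axis m 1 - axis l 1) + axis l 1" and "v2 = - N *\<^sub>R (axis m 1 - axis l 1) + axis l 1"
    have "coord_sum v1 = 1" "coord_sum v2 = 1"
      by (simp_all add: v1_def v2_def coord_sum_linear coord_sum_axis)
    moreover have "?D v1 = N * (partial f m p - partial f l p) + partial f l p"
      using lin by (simp add: v1_def linear_add linear_scale linear_diff partial_def)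
    moreover have "?D v2 = - (N * (partial f m p - partial f l p)) + partial f l p"
      using lin by (simp add: v2_def linear_add linear_scale linear_diff linear_neg partial_def)
    ultimately show False using no[of v1 v2] ND by (simp add: abs_if split: if_splits)
  qed
  assume "partial f l p \<noteq> partial f m p"
  then show False using main[of l m] main[of m l] by linarith
qed

definition open_box :: "real^'d::finite \<Rightarrow> real \<Rightarrow> (real^'d) set" where
  "open_box p r = {x. \<forall>l. \<bar>x $ l - p $ l\<bar> < r}"

lemma convex_open_box: "convex (open_box p r)"
proof -
  have "open_box p r = (\<Inter>l. {x. axis l 1 \<bullet> x < p $ l + r} \<inter> {x. p $ l - r < axis l 1 \<bullet> x})"
    by (auto simp: open_box_def inner_axis inner_commute abs_less_iff algebra_simps)
  moreover have "convex {x :: real^'d. c < a \<bullet> x}" for c a by (rule convex_halfspace_gt)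
  ultimately show ?thesis by (auto intro!: convex_INT convex_Int convex_halfspace_lt)
qed

lemma open_open_box: "open (open_box p r)"
proof -
  have "open_box p r = (\<Inter>l. {x. \<bar>x $ l - p $ l\<bar> < r})" by (auto simp: open_box_def)
  then show ?thesis by (auto intro!: open_INT open_Collect_less continuous_intros)
qed

text \<open>
  Close to the extreme point all partial derivatives of \<open>\<plusminus>f\<close> are within ten percent of the same positive
  number; the mean value theorem makes this a two-sided monotonicity estimate for the coordinatewise
  order.
\<close>

lemma monotone_chart:
  fixes U :: "(real^'d::finite) set"
  assumes U: "open U" "U \<noteq> {}" "U \<subseteq> unit_cube" and S: "smooth_hypersurface (frontier U)"
  shows "\<exists>p F r a b. p \<in> frontier U \<and> (\<forall>x\<in>closure U. coord_sum x \<le> coord_sum p) \<and> 0 < r \<and> 0 < a \<and> 2 * b < 3 * a \<and>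
     continuous_on (open_box p r) F \<and> frontier U \<inter> open_box p r = {x \<in> open_box p r. F x = 0} \<and>
     (\<forall>x\<in>open_box p r. \<forall>y\<in>open_box p r. (\<forall>l. x $ l \<le> y $ l) \<longrightarrow> a * coord_sum (y - x) \<le> F y - F x \<and> F y - F x \<le> b * coord_sum (y - x))"
proof -
  obtain p where p: "p \<in> frontier U" "\<And>x. x \<in> closure U \<Longrightarrow> coord_sum x \<le> coord_sum p"
    using exists_extreme_point[OF U] by blast
  obtain W and f :: "real^'d \<Rightarrow> real" where W: "open W" "p \<in> W" "smooth_fun_on W f"
    and nz: "\<forall>x\<in>W. \<exists>v. frechet_derivative f (at x) v \<noteq> 0" and SW: "frontier U \<inter> W = {x \<in> W. f x = 0}"
    using S p(1) unfolding smooth_hypersurface_def by blast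
  note C1 = smooth_imp_C1[OF W(3)]
  obtain v where v: "frechet_derivative f (at p) v \<noteq> 0" using nz W by blast
  have "\<exists>l. partial f l p \<noteq> 0"
  proof (rule ccontr)
    assume "\<nexists>l. partial f l p \<noteq> 0"
    then show False using v frechet_derivative_partials[OF C1(1)[OF W(2)], of v] by simp
  qed
  then obtain l0 where l0: "partial f l0 p \<noteq> 0" by blast
  define \<mu> where "\<mu> = partial f l0 p"
  have eq: "partial f l p = \<mu>" for l unfolding \<mu>_def by (rule extreme_gradient[OF p W(1,2) C1(1) SW])
  define \<eta> where "\<eta> = \<bar>\<mu>\<bar>"
  have \<eta>: "0 < \<eta>" using l0 by (simp add: \<eta>_def \<mu>_def)
  have tn: "((\<lambda>x. partial f m x) \<longlongrightarrow> \<mu>) (nhds p)" for m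
  proof -
    have "isCont (\<lambda>x. partial f m x) p"
      using C1(2)[of "axis m 1"] W unfolding partial_def by (simp add: continuous_on_eq_continuous_at)
    then have "((\<lambda>x. partial f m x) \<longlongrightarrow> partial f m p) (nhds p)" by (simp add: isCont_def tendsto_at_iff_tendsto_nhds)
    then show ?thesis using eq[of m] by simp
  qed
  have 1: "\<forall>\<^sub>F x in nhds p. \<forall>m\<in>UNIV. dist (partial f m x) \<mu> < \<eta> / 10"
    using \<eta> by (intro eventually_ball_finite ballI tendstoD[OF tn]) auto
  have 2: "\<forall>\<^sub>F x in nhds p. x \<in> W" using W by (simp add: eventually_nhds_in_open)
  have "\<forall>\<^sub>F x in nhds p. x \<in> W \<and> (\<forall>m. dist (partial f m x) \<mu> < \<eta> / 10)"
    using 1 2 by eventually_elim auto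
  then obtain e where e: "0 < e" "\<And>x. dist x p < e \<Longrightarrow> x \<in> W \<and> (\<forall>m. dist (partial f m x) \<mu> < \<eta> / 10)"
    unfolding eventually_nhds_metric by blast
  define r where "r = e / real CARD('d)"
  have r: "0 < r" using e(1) by (simp add: r_def)
  let ?B = "open_box p r"
  have B: "x \<in> W" "dist (partial f m x) \<mu> < \<eta> / 10" if x: "x \<in> ?B" for x m
  proof -
    have "dist x p \<le> (\<Sum>l\<in>UNIV. \<bar>(x - p) $ l\<bar>)" unfolding dist_norm by (rule norm_le_l1_cart)
    also have "\<dots> < (\<Sum>l\<in>(UNIV::'d set). r)" using x by (intro sum_strict_mono) (auto simp: open_box_def)
    also have "\<dots> = e" by (simp add: r_def)
    finally show "x \<in> W" "dist (partial f m x) \<mu> < \<eta> / 10" using e(2) by auto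
  qed
  define F where "F x = sgn \<mu> * f x" for x
  have s: "sgn \<mu> * \<mu> = \<eta>" "\<bar>sgn \<mu>\<bar> = 1" using \<eta> by (auto simp: \<eta>_def sgn_if)
  have "9/10 * \<eta> * coord_sum (y - x) \<le> F y - F x \<and> F y - F x \<le> 11/10 * \<eta> * coord_sum (y - x)"
    if xy: "x \<in> ?B" "y \<in> ?B" "\<And>l. x $ l \<le> y $ l" for x y
  proof -
    obtain z where z: "z \<in> ?B" "f y - f x = (\<Sum>l\<in>UNIV. (y $ l - x $ l) * partial f l z)"
      using mean_value_partials[OF convex_open_box C1(1)[OF B(1)] xy(1,2)] by blast
    have F: "F y - F x = (\<Sum>l\<in>UNIV. (y $ l - x $ l) * (sgn \<mu> * partial f l z))"
      using z(2) by (simp add: F_def right_diff_distrib[symmetric] sum_distrib_left ac_simps)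
    have bd: "9/10 * \<eta> \<le> sgn \<mu> * partial f l z" "sgn \<mu> * partial f l z \<le> 11/10 * \<eta>" for l
    proof -
      have "\<bar>sgn \<mu> * partial f l z - \<eta>\<bar> = \<bar>sgn \<mu>\<bar> * \<bar>partial f l z - \<mu>\<bar>"
        unfolding s(1)[symmetric] abs_mult[symmetric] by (simp only: right_diff_distrib)
      also have "\<dots> < \<eta> / 10" using B(2)[OF z(1), of l] s by (simp add: dist_real_def)
      finally show "9/10 * \<eta> \<le> sgn \<mu> * partial f l z" "sgn \<mu> * partial f l z \<le> 11/10 * \<eta>" by linarith+
    qed
    have "(\<Sum>l\<in>UNIV. (y $ l - x $ l) * (9/10 * \<eta>)) \<le> F y - F x" "F y - F x \<le> (\<Sum>l\<in>UNIV. (y $ l - x $ l) * (11/10 * \<eta>))"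
      unfolding F by (rule sum_mono, rule mult_left_mono, rule bd, simp add: xy(3))+
    moreover have "(\<Sum>l\<in>UNIV. (y $ l - x $ l) * c) = c * coord_sum (y - x)" for c
      by (simp add: coord_sum_def sum_distrib_left mult.commute)
    ultimately show ?thesis by (simp only:)
  qed
  moreover have "continuous_on ?B F"
  proof -
    have "continuous_on ?B f"
      using C1(1)[OF B(1)] by (intro differentiable_imp_continuous_on differentiable_at_imp_differentiable_on)
    then show ?thesis unfolding F_def[abs_def] by (intro continuous_intros)
  qed
  moreover have "frontier U \<inter> ?B = {x \<in> ?B. F x = 0}"
  proof -
    have "F x = 0 \<longleftrightarrow> f x = 0" for x using s(2) by (simp add: F_def sgn_zero_iff)
    then show ?thesis using SW B(1) by blast
  qed
  ultimately show ?thesis using p r \<eta>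
    by (intro exI[of _ p] exI[of _ F] exI[of _ r] exI[of _ "9/10 * \<eta>"] exI[of _ "11/10 * \<eta>"] conjI) auto
qed


text \<open>
  From a point with \<open>F > 0\<close> one can go up inside the box, keeping \<open>F > 0\<close>, to a point whose coordinate sum exceeds
  that of \<open>p\<close>, which is outside \<open>U\<close>.  From a point with \<open>F < 0\<close> one can go down and then up again, keeping \<open>F < 0\<close>,
  to a point of \<open>U\<close> near \<open>p\<close>.  The segments avoid the frontier, so membership in \<open>U\<close> does not change.
\<close>

lemma chart_sides:
  fixes U :: "(real^'d::finite) set"
  assumes U: "open U" and p: "p \<in> frontier U" "\<And>x. x \<in> closure U \<Longrightarrow> coord_sum x \<le> coord_sum p"
    and r: "0 < r" and a: "0 < a"
    and front: "frontier U \<inter> open_box p r = {x \<in> open_box p r. F x = 0}"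
    and mono: "\<And>x y. x \<in> open_box p r \<Longrightarrow> y \<in> open_box p r \<Longrightarrow> (\<And>l. x $ l \<le> y $ l) \<Longrightarrow> a * coord_sum (y - x) \<le> F y - F x"
    and x: "x \<in> open_box p r"
  shows "0 < F x \<Longrightarrow> x \<notin> U" and "F x < 0 \<Longrightarrow> x \<in> U"
proof -
  let ?B = "open_box p r"
  let ?one = "\<chi> l. 1 :: real ^ 'd"
  have le: "F y \<le> F z" if "y \<in> ?B" "z \<in> ?B" "\<And>l. y $ l \<le> z $ l" for y z
  proof -
    have "0 \<le> coord_sum (z - y)" using that(3) by (auto simp: coord_sum_def intro: sum_nonneg)
    then have "0 \<le> a * coord_sum (z - y)" using a by simp
    then show ?thesis using mono[OF that] by linarith
  qed
  have segB: "closed_segment y z \<subseteq> ?B" if "y \<in> ?B" "z \<in> ?B" for y z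
    using closed_segment_subset[OF that convex_open_box] .
  have seg_le: "y $ l \<le> w $ l \<and> w $ l \<le> z $ l" if w: "w \<in> closed_segment y z" and yz: "\<And>l. y $ l \<le> z $ l" for y z w :: "real^'d" and l
  proof -
    obtain u where u: "0 \<le> u" "u \<le> 1" "w = (1 - u) *\<^sub>R y + u *\<^sub>R z" using w by (auto simp: in_segment)
    have "w $ l = y $ l + u * (z $ l - y $ l)" "w $ l = z $ l - (1 - u) * (z $ l - y $ l)" by (simp_all add: u(3) algebra_simps)
    moreover have "0 \<le> u * (z $ l - y $ l)" "0 \<le> (1 - u) * (z $ l - y $ l)" using u yz[of l] by auto
    ultimately show ?thesis by linarith
  qed
  have same_side: "y \<in> U \<longleftrightarrow> z \<in> U" if "y \<in> ?B" "z \<in> ?B" "\<And>w. w \<in> closed_segment y z \<Longrightarrow> F w \<noteq> 0" for y z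
  proof -
    have disj: "closed_segment y z \<inter> frontier U = {}" using that(3) segB[OF that(1,2)] front by blast
    have "closed_segment y z \<inter> U = {} \<or> closed_segment y z - U = {}"
      using connected_Int_frontier[of "closed_segment y z" U] disj by auto
    then show ?thesis using ends_in_segment[of y z] by blast
  qed
  have pB: "p \<in> ?B" using r by (simp add: open_box_def)
  have shift: "\<exists>s>0. s < r \<and> (\<forall>l. \<bar>x $ l - p $ l\<bar> \<le> s)" if "x \<in> ?B" for x
  proof -
    define s where "s = max (r / 2) (Max (range (\<lambda>l. \<bar>x $ l - p $ l\<bar>)))"
    have 1: "Max (range (\<lambda>l. \<bar>x $ l - p $ l\<bar>)) < r" using that by (subst Max_less_iff) (auto simp: open_box_def)
    have 2: "\<bar>x $ l - p $ l\<bar> \<le> Max (range (\<lambda>l. \<bar>x $ l - p $ l\<bar>))" for l by (intro Max_ge) auto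
    have "0 < s" using r by (simp add: s_def less_max_iff_disj)
    moreover have "s < r" using r 1 by (simp add: s_def)
    moreover have "\<bar>x $ l - p $ l\<bar> \<le> s" for l unfolding s_def using 2[of l] by (rule max.coboundedI2)
    ultimately show ?thesis by blast
  qed
  have pos_out: "x \<notin> U" if xB: "x \<in> ?B" and Fx: "0 < F x" for x
  proof
    assume xU: "x \<in> U"
    obtain s where s: "0 < s" "s < r" "\<And>l. \<bar>x $ l - p $ l\<bar> \<le> s" using shift[OF xB] by blast
    define z :: "real^'d" where "z = (\<chi> l. p $ l + s)"
    have zB: "z \<in> ?B" using s by (simp add: z_def open_box_def)
    have xz: "x $ l \<le> z $ l" for l using s(3)[of l] by (simp add: z_def abs_le_iff)
    have "F w \<noteq> 0" if w: "w \<in> closed_segment x z" for w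
      using le[OF xB, of w] segB[OF xB zB] w seg_le[OF w xz] Fx by fastforce
    then have "z \<in> U" using same_side[OF xB zB] xU by blast
    then have "coord_sum z \<le> coord_sum p" using p(2) closure_subset by blast
    then have "real CARD('d) * s \<le> 0" by (simp add: coord_sum_def z_def sum.distrib)
    moreover have "0 < real CARD('d) * s" using s(1) by simp
    ultimately show False by linarith
  qed
  then show "0 < F x \<Longrightarrow> x \<notin> U" using x by blast
  assume Fx: "F x < 0"
  have "p \<in> closure U" using p(1) by (simp add: frontier_def)
  then obtain y where y: "y \<in> U" "y \<in> ?B" using open_open_box[of p r] pB
    by (metis closure_iff_nhds_not_empty disjoint_iff order_refl)
  have "y \<notin> frontier U" using y(1) U by (simp add: frontier_def interior_open)
  then have "F y \<noteq> 0" using front y(2) by blast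
  then have Fy: "F y < 0" using pos_out[OF y(2)] y(1) by fastforce
  obtain s1 where s1: "0 < s1" "s1 < r" "\<And>l. \<bar>x $ l - p $ l\<bar> \<le> s1" using shift[OF x] by blast
  obtain s2 where s2: "0 < s2" "s2 < r" "\<And>l. \<bar>y $ l - p $ l\<bar> \<le> s2" using shift[OF y(2)] by blast
  define z :: "real^'d" where "z = (\<chi> l. p $ l - max s1 s2)"
  have zB: "z \<in> ?B" using s1 s2 by (simp add: z_def open_box_def max_def)
  have zx: "z $ l \<le> x $ l" for l using s1(3)[of l] by (auto simp: z_def abs_le_iff max_def)
  have zy: "z $ l \<le> y $ l" for l using s2(3)[of l] by (auto simp: z_def abs_le_iff max_def)
  have "F w \<noteq> 0" if w: "w \<in> closed_segment z x" for w
    using le[of w x] segB[OF zB x] w seg_le[OF w zx] Fx x by fastforce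
  then have 1: "z \<in> U \<longleftrightarrow> x \<in> U" by (intro same_side zB x)
  have "F w \<noteq> 0" if w: "w \<in> closed_segment z y" for w
    using le[of w y] segB[OF zB y(2)] w seg_le[OF w zy] Fy y(2) by fastforce
  then have "z \<in> U \<longleftrightarrow> y \<in> U" by (intro same_side zB y(2))
  then show "x \<in> U" using 1 y(1) by blast
qed

section \<open>Cells that straddle the boundary\<close>

text \<open>
  Shrinking the box places it inside the unit cube: moving \<open>p\<close> down in all coordinates, or up in one and down
  in the others, leads to points of \<open>U\<close>, whose coordinates lie in \<open>[0, 1)\<close>.
\<close>

lemma transversal_chart:
  fixes U :: "(real^'d::finite) set"
  assumes d: "3 \<le> CARD('d)" and U: "open U" "U \<noteq> {}" "U \<subseteq> unit_cube" and S: "smooth_hypersurface (frontier U)"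
  shows "\<exists>r a b p F. 0 < r \<and> 0 < a \<and> 2 * b < 3 * a \<and> (\<forall>l. r \<le> p $ l \<and> p $ l + r \<le> 1) \<and>
     continuous_on (open_box p r) F \<and> F p = 0 \<and>
     (\<forall>x\<in>open_box p r. \<forall>y\<in>open_box p r. (\<forall>l. x $ l \<le> y $ l) \<longrightarrow> a * coord_sum (y - x) \<le> F y - F x \<and> F y - F x \<le> b * coord_sum (y - x)) \<and>
     (\<forall>x\<in>open_box p r. (F x < 0 \<longrightarrow> x \<in> U) \<and> (0 < F x \<longrightarrow> x \<notin> U))"
proof -
  obtain p F r a b where p: "p \<in> frontier U" "\<forall>x\<in>closure U. coord_sum x \<le> coord_sum p" and r: "0 < r" and a: "0 < a" "2 * b < 3 * a"
     and cont: "continuous_on (open_box p r) F" and front: "frontier U \<inter> open_box p r = {x \<in> open_box p r. F x = 0}"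
     and mono: "\<forall>x\<in>open_box p r. \<forall>y\<in>open_box p r. (\<forall>l. x $ l \<le> y $ l) \<longrightarrow> a * coord_sum (y - x) \<le> F y - F x \<and> F y - F x \<le> b * coord_sum (y - x)"
    using monotone_chart[OF U S] by blast
  have lo: "a * coord_sum (y - x) \<le> F y - F x" and up: "F y - F x \<le> b * coord_sum (y - x)"
    if "x \<in> open_box p r" "y \<in> open_box p r" "\<And>l. x $ l \<le> y $ l" for x y
    using mono that by blast+
  have p': "coord_sum x \<le> coord_sum p" if "x \<in> closure U" for x using p(2) that by blast
  have out: "x \<notin> U" if "x \<in> open_box p r" "0 < F x" for x
    by (rule chart_sides(1)[of U p r a F x]) (fact U(1) p(1) p' r a(1) front lo that)+
  have ins: "x \<in> U" if "x \<in> open_box p r" "F x < 0" for x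
    by (rule chart_sides(2)[of U p r a F x]) (fact U(1) p(1) p' r a(1) front lo that)+
  have pB: "p \<in> open_box p r" using r by (simp add: open_box_def)
  then have Fp: "F p = 0" using p(1) front by blast
  define s where "s = r / 2"
  have s: "0 < s" "s < r" using r by (auto simp: s_def)
  define z :: "real^'d" where "z = (\<chi> l. p $ l - s)"
  have zB: "z \<in> open_box p r" using s by (simp add: z_def open_box_def)
  have "coord_sum (p - z) = real CARD('d) * s" by (simp add: coord_sum_def z_def)
  then have Fz: "F z \<le> - (a * (real CARD('d) * s))" using lo[OF zB pB] Fp s by (simp add: z_def)
  have "0 < a * (real CARD('d) * s)" using a s by simp
  then have "F z < 0" using Fz by linarith
  then have "z \<in> U" by (rule ins[OF zB])
  then have zU: "0 \<le> z $ l" for l using U(3) by (auto simp: unit_cube_def)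
  have bounds: "s \<le> p $ l \<and> p $ l + s \<le> 1" for l
  proof
    show "s \<le> p $ l" using zU[of l] by (simp add: z_def)
    define x where "x = z + (2 * s) *\<^sub>R axis l 1"
    have xm: "x $ m = (if m = l then p $ m + s else p $ m - s)" for m by (simp add: x_def z_def axis_def)
    have xB: "x \<in> open_box p r" using s by (simp add: open_box_def xm)
    have "coord_sum (x - z) = 2 * s" by (simp add: x_def coord_sum_linear coord_sum_axis)
    moreover have "z $ m \<le> x $ m" for m using s by (simp add: xm z_def)
    ultimately have "F x \<le> F z + b * (2 * s)" using up[OF zB xB] by simp
    moreover have "b * (2 * s) < a * (real CARD('d) * s)"
    proof -
      have "3 * a \<le> real CARD('d) * a" using d a by (intro mult_right_mono) auto
      then have "2 * b < real CARD('d) * a" using a(2) by linarith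
      then have "2 * b * s < real CARD('d) * a * s" using s(1) by (rule mult_strict_right_mono)
      then show ?thesis by (simp add: ac_simps)
    qed
    ultimately have "F x < 0" using Fz by linarith
    then have "x \<in> U" by (rule ins[OF xB])
    then have "x $ l < 1" using U(3) by (auto simp: unit_cube_def)
    then show "p $ l + s \<le> 1" by (simp add: xm)
  qed
  have sub: "open_box p s \<subseteq> open_box p r" using s by (auto simp: open_box_def intro: less_trans)
  have "continuous_on (open_box p s) F" using cont sub by (rule continuous_on_subset)
  moreover have "\<forall>x\<in>open_box p s. (F x < 0 \<longrightarrow> x \<in> U) \<and> (0 < F x \<longrightarrow> x \<notin> U)" using ins out sub by blast
  moreover have "\<forall>x\<in>open_box p s. \<forall>y\<in>open_box p s. (\<forall>l. x $ l \<le> y $ l) \<longrightarrow> a * coord_sum (y - x) \<le> F y - F x \<and> F y - F x \<le> b * coord_sum (y - x)"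
    using mono sub by blast
  ultimately show ?thesis using s a Fp bounds by blast
qed

text \<open>
  Cubes with the lowest of their \<open>4\<^sup>d\<close> subcubes inside \<open>U\<close> and the highest one outside.
\<close>

definition straddling :: "(real^'d::finite) set \<Rightarrow> nat \<Rightarrow> ('d \<Rightarrow> nat) set" where
  "straddling U k = {q \<in> cells k. cube (k + 2) (\<lambda>l. 4 * q l) \<subseteq> U \<and> cube (k + 2) (\<lambda>l. 4 * q l + 3) \<inter> U = {}}"

text \<open>
  Fix all coordinates but one to those of the centre of a cell near \<open>p\<close>.  By the intermediate value theorem \<open>F\<close>
  vanishes somewhere on the resulting line.  At the centre of the cell of that zero, \<open>\<bar>F\<bar>\<close> is at most \<open>b h / 2\<close>,
  where \<open>h\<close> is the cell size.  In the highest subcube every coordinate exceeds the centre by \<open>h / 4\<close>, so \<open>F\<close> is larger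
  by at least \<open>3 a h / 4 > b h / 2\<close>, hence positive there; likewise it is negative in the lowest subcube.
  The number of columns near \<open>p\<close> is of order \<open>2\<^sup>(\<^sup>d\<^sup>-\<^sup>1\<^sup>)\<^sup>k\<close>.
\<close>

lemma many_straddling_cells:
  fixes U :: "(real^'d::finite) set"
  assumes d: "3 \<le> CARD('d)" and U: "open U" "U \<noteq> {}" "U \<subseteq> unit_cube" and S: "smooth_hypersurface (frontier U)"
  shows "\<exists>c>0. \<exists>k0. \<forall>k\<ge>k0. c * (2 ^ (CARD('d) - 1)) ^ k \<le> real (card (straddling U k))"
proof -
  obtain r a b p F where chart: "0 < r \<and> 0 < a \<and> 2 * b < 3 * a \<and> (\<forall>l. r \<le> p $ l \<and> p $ l + r \<le> 1) \<and>
     continuous_on (open_box p r) F \<and> F p = 0 \<and>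
     (\<forall>x\<in>open_box p r. \<forall>y\<in>open_box p r. (\<forall>l. x $ l \<le> y $ l) \<longrightarrow> a * coord_sum (y - x) \<le> F y - F x \<and> F y - F x \<le> b * coord_sum (y - x)) \<and>
     (\<forall>x\<in>open_box p r. (F x < 0 \<longrightarrow> x \<in> U) \<and> (0 < F x \<longrightarrow> x \<notin> U))"
    using transversal_chart[OF d U S] by blast
  have r: "0 < r" and a: "0 < a" "2 * b < 3 * a" and cont: "continuous_on (open_box p r) F" and Fp: "F p = 0" using chart by blast+
  have pr: "r \<le> p $ l \<and> p $ l + r \<le> 1" for l using chart by blast
  have lo: "a * coord_sum (y - x) \<le> F y - F x" and up: "F y - F x \<le> b * coord_sum (y - x)"
    if "x \<in> open_box p r" "y \<in> open_box p r" "\<And>l. x $ l \<le> y $ l" for x y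
    using chart that by blast+
  have ins: "x \<in> U" if "x \<in> open_box p r" "F x < 0" for x using chart that by blast
  have out: "x \<notin> U" if "x \<in> open_box p r" "0 < F x" for x using chart that by blast
  let ?B = "open_box p r"
  let ?d = "real CARD('d)"
  have le: "F x \<le> F y" if "x \<in> ?B" "y \<in> ?B" "\<And>l. x $ l \<le> y $ l" for x y
  proof -
    have "0 \<le> coord_sum (y - x)" using that(3) by (auto simp: coord_sum_def intro: sum_nonneg)
    then have "0 \<le> a * coord_sum (y - x)" using a by simp
    then show ?thesis using lo[OF that] by linarith
  qed
  have pB: "p \<in> ?B" using r by (simp add: open_box_def)
  obtain l0 :: 'd where True by simp
  have ab: "a \<le> b"
  proof -
    define y where "y = p + (r / 2) *\<^sub>R axis l0 1"
    have yB: "y \<in> ?B" using r by (simp add: y_def open_box_def axis_def)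
    have cs: "coord_sum (y - p) = r / 2" by (simp add: y_def coord_sum_linear coord_sum_axis)
    have py: "p $ l \<le> y $ l" for l using r by (simp add: y_def axis_def)
    have "a * (r / 2) \<le> b * (r / 2)"
      using order_trans[OF lo[OF pB yB py] up[OF pB yB py]] unfolding cs .
    then show ?thesis using r by simp
  qed
  have b: "0 < b" using a ab by linarith
  \<comment> \<open>Moving the other coordinates by \<open>\<rho>\<close> changes \<open>F\<close> by less than moving one coordinate by \<open>r / 2\<close>.\<close>
  define \<rho> where "\<rho> = a * r / (4 * b * ?d)"
  have d0: "3 \<le> ?d" using d by simp
  have \<rho>: "0 < \<rho>" "b * (\<rho> * ?d) = a * r / 4" "\<rho> \<le> r / 12"
  proof -
    show "0 < \<rho>" using a b r d0 by (simp add: \<rho>_def)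
    show e: "b * (\<rho> * ?d) = a * r / 4" using b d0 by (simp add: \<rho>_def)
    have "a * r / 4 \<le> b * r / 4" using ab r by simp
    then have "b * (\<rho> * ?d) \<le> b * (r / 4)" using e by simp
    then have "\<rho> * ?d \<le> r / 4" using b by (simp only: mult_le_cancel_left_pos)
    moreover have "\<rho> * 3 \<le> \<rho> * ?d" using \<open>0 < \<rho>\<close> d0 by (intro mult_left_mono) auto
    ultimately show "\<rho> \<le> r / 12" by linarith
  qed
  have column: "\<exists>j. c(l0 := j) \<in> straddling U k"
    if h: "h = 1 / 2 ^ k" "h \<le> \<rho>" and c: "\<And>m. m \<noteq> l0 \<Longrightarrow> \<bar>(real (c m) + 1/2) * h - p $ m\<bar> \<le> \<rho>" for k h and c :: "'d \<Rightarrow> nat"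
  proof -
    have h0: "0 < h" by (simp add: h)
    define ctr :: "real \<Rightarrow> real^'d" where "ctr t = (\<chi> m. if m = l0 then 0 else (real (c m) + 1/2) * h) + t *\<^sub>R axis l0 1" for t
    have ctr: "ctr t $ m = (if m = l0 then t else (real (c m) + 1/2) * h)" for t m
      by (simp add: ctr_def axis_def)
    have ctrB: "ctr t \<in> ?B" if "\<bar>t - p $ l0\<bar> < r" for t
      unfolding open_box_def
    proof (intro CollectI allI)
      fix m show "\<bar>ctr t $ m - p $ m\<bar> < r"
        using c[of m] that \<rho>(3) r by (cases "m = l0") (auto simp: ctr)
    qed
    have neg: "F (ctr (p $ l0 - r / 2)) < 0"
    proof -
      define z y :: "real^'d" where "z = (\<chi> m. if m = l0 then p $ m - r / 2 else p $ m)" and "y = (\<chi> m. if m = l0 then p $ m - r / 2 else p $ m + \<rho>)"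
      have zB: "z \<in> ?B" and yB: "y \<in> ?B" using r \<rho> by (auto simp: z_def y_def open_box_def)
      have "coord_sum (p - z) = (\<Sum>m\<in>UNIV. if m = l0 then r / 2 else 0)"
        unfolding coord_sum_def by (intro sum.cong refl) (simp add: z_def)
      then have cpz: "coord_sum (p - z) = r / 2" by simp
      have zp: "z $ l \<le> p $ l" for l using r by (simp add: z_def)
      have zy: "z $ l \<le> y $ l" for l using \<rho>(1) by (simp add: z_def y_def)
      have "a * (r / 2) \<le> F p - F z" using lo[OF zB pB zp] unfolding cpz .
      moreover have "coord_sum (y - z) \<le> (\<Sum>m\<in>(UNIV::'d set). \<rho>)"
        unfolding coord_sum_def using \<rho>(1) by (intro sum_mono) (simp add: z_def y_def)
      then have "b * coord_sum (y - z) \<le> b * (\<rho> * ?d)" using b by (intro mult_left_mono) (auto simp: mult.commute)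
      then have "F y - F z \<le> a * r / 4" using up[OF zB yB zy] \<rho>(2) by linarith
      moreover have "F (ctr (p $ l0 - r / 2)) \<le> F y"
      proof (rule le[OF ctrB yB])
        fix m show "ctr (p $ l0 - r / 2) $ m \<le> y $ m" using c[of m] by (auto simp: ctr y_def abs_le_iff)
      qed (use r in auto)
      moreover have "0 < a * r / 4" using a r by simp
      ultimately show ?thesis using Fp by linarith
    qed
    have pos: "0 < F (ctr (p $ l0 + r / 2))"
    proof -
      define z y :: "real^'d" where "z = (\<chi> m. if m = l0 then p $ m + r / 2 else p $ m)" and "y = (\<chi> m. if m = l0 then p $ m + r / 2 else p $ m - \<rho>)"
      have zB: "z \<in> ?B" and yB: "y \<in> ?B" using r \<rho> by (auto simp: z_def y_def open_box_def)
      have "coord_sum (z - p) = (\<Sum>m\<in>UNIV. if m = l0 then r / 2 else 0)"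
        unfolding coord_sum_def by (intro sum.cong refl) (simp add: z_def)
      then have cpz: "coord_sum (z - p) = r / 2" by simp
      have zp: "p $ l \<le> z $ l" for l using r by (simp add: z_def)
      have zy: "y $ l \<le> z $ l" for l using \<rho>(1) by (simp add: z_def y_def)
      have "a * (r / 2) \<le> F z - F p" using lo[OF pB zB zp] unfolding cpz .
      moreover have "coord_sum (z - y) \<le> (\<Sum>m\<in>(UNIV::'d set). \<rho>)"
        unfolding coord_sum_def using \<rho>(1) by (intro sum_mono) (simp add: z_def y_def)
      then have "b * coord_sum (z - y) \<le> b * (\<rho> * ?d)" using b by (intro mult_left_mono) (auto simp: mult.commute)
      then have "F z - F y \<le> a * r / 4" using up[OF yB zB zy] \<rho>(2) by linarith
      moreover have "F y \<le> F (ctr (p $ l0 + r / 2))"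
      proof (rule le[OF yB ctrB])
        fix m show "y $ m \<le> ctr (p $ l0 + r / 2) $ m" using c[of m] by (auto simp: ctr y_def abs_le_iff)
      qed (use r in auto)
      moreover have "0 < a * r / 4" using a r by simp
      ultimately show ?thesis using Fp by linarith
    qed
    have "continuous_on {p $ l0 - r / 2..p $ l0 + r / 2} (\<lambda>t. F (ctr t))"
    proof (rule continuous_on_compose2[OF cont])
      show "continuous_on {p $ l0 - r / 2..p $ l0 + r / 2} ctr" unfolding ctr_def[abs_def] by (intro continuous_intros)
      show "ctr ` {p $ l0 - r / 2..p $ l0 + r / 2} \<subseteq> ?B" using r by (auto intro!: ctrB simp: abs_less_iff)
    qed
    then obtain t where t: "p $ l0 - r / 2 \<le> t" "t \<le> p $ l0 + r / 2" "F (ctr t) = 0"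
      using IVT'[of "\<lambda>t. F (ctr t)" "p $ l0 - r / 2" 0 "p $ l0 + r / 2"] neg pos r by auto
    have t0: "0 < t" using t(1) pr[of l0] r by linarith
    define j where "j = nat \<lfloor>2 ^ k * t\<rfloor>"
    have j: "real j \<le> 2 ^ k * t" "2 ^ k * t < real j + 1"
    proof -
      have "0 \<le> \<lfloor>2 ^ k * t\<rfloor>" using t0 by simp
      then have "real j = real_of_int \<lfloor>2 ^ k * t\<rfloor>" by (simp add: j_def)
      then show "real j \<le> 2 ^ k * t" "2 ^ k * t < real j + 1" by linarith+
    qed
    define cc where "cc = (real j + 1/2) * h"
    have jh: "real j * h \<le> t" "t < real j * h + h" using j by (simp_all add: h field_simps)
    have "cc = real j * h + h / 2" by (simp add: cc_def algebra_simps)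
    then have cct: "\<bar>cc - t\<bar> \<le> h / 2" using jh unfolding abs_le_iff by (intro conjI; linarith)
    have cct': "cc - t \<le> h / 2" "t - cc \<le> h / 2" using cct by linarith+
    have cs: "coord_sum (ctr u - ctr v) = u - v" for u v
    proof -
      have "ctr u - ctr v = (u - v) *\<^sub>R axis l0 1" by (simp add: ctr_def algebra_simps)
      then show ?thesis by (simp add: coord_sum_linear coord_sum_axis)
    qed
    have hr: "h \<le> r / 12" using h(2) \<rho>(3) by linarith
    have tB: "ctr t \<in> ?B" using t r by (intro ctrB) (auto simp: abs_less_iff)
    have ccp: "\<bar>cc - p $ l0\<bar> \<le> r / 2 + h / 2" using cct t by linarith
    then have cB: "ctr cc \<in> ?B" using hr r by (intro ctrB) linarith
    have Fc: "\<bar>F (ctr cc)\<bar> \<le> b * (h / 2)"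
    proof (cases "t \<le> cc")
      case True
      then have "F (ctr t) \<le> F (ctr cc)" by (intro le tB cB) (simp add: ctr)
      moreover have "F (ctr cc) - F (ctr t) \<le> b * (cc - t)" using up[OF tB cB] True unfolding cs by (simp add: ctr)
      moreover have "b * (cc - t) \<le> b * (h / 2)" by (rule mult_left_mono[OF cct'(1) less_imp_le[OF b]])
      ultimately show ?thesis using t(3) by linarith
    next
      case False
      then have "F (ctr cc) \<le> F (ctr t)" by (intro le tB cB) (simp add: ctr)
      moreover have "F (ctr t) - F (ctr cc) \<le> b * (t - cc)" using up[OF cB tB] False unfolding cs by (simp add: ctr)
      moreover have "b * (t - cc) \<le> b * (h / 2)" by (rule mult_left_mono[OF cct'(2) less_imp_le[OF b]])
      ultimately show ?thesis using t(3) by linarith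
    qed
    define q where "q = c(l0 := j)"
    have qc: "ctr cc $ m = (real (q m) + 1/2) * h" for m by (simp add: ctr q_def cc_def)
    have qp: "\<bar>(real (q m) + 1/2) * h - p $ m\<bar> \<le> r / 2 + h / 2" for m
      using ccp c[of m] \<rho>(3) h0 r by (cases "m = l0") (auto simp: q_def cc_def)
    have key: "b * (h / 2) < a * (?d * (h / 4))"
    proof -
      have "3 * a \<le> ?d * a" using d0 a by (intro mult_right_mono) auto
      then have "2 * b < ?d * a" using a(2) by linarith
      then have "2 * b * (h / 4) < ?d * a * (h / 4)" using h0 by (intro mult_strict_right_mono) auto
      then show ?thesis by (simp add: ac_simps)
    qed
    have pow: "2 ^ (k + 2) = 4 / h" by (simp add: h)
    have lowpart: "x \<in> U" if x: "x \<in> cube (k + 2) (\<lambda>l. 4 * q l)" for x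
    proof -
      have xm: "real (q m) * h \<le> x $ m" "x $ m \<le> (real (q m) + 1/2) * h - h / 4" for m
      proof -
        have "real (4 * q m) / (4 / h) \<le> x $ m" "x $ m < (real (4 * q m) + 1) / (4 / h)"
          using x unfolding cube_def pow by blast+
        then show "real (q m) * h \<le> x $ m" "x $ m \<le> (real (q m) + 1/2) * h - h / 4"
          using h0 by (simp_all add: field_simps)
      qed
      have xB: "x \<in> ?B" unfolding open_box_def
      proof (intro CollectI allI)
        fix m
        have "(real (q m) + 1/2) * h = real (q m) * h + h / 2" by (simp add: algebra_simps)
        then show "\<bar>x $ m - p $ m\<bar> < r" using xm[of m] qp[of m] hr h0 r by linarith
      qed
      have "?d * (h / 4) \<le> coord_sum (ctr cc - x)"
      proof -
        have "h / 4 \<le> (ctr cc - x) $ m" for m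
          using xm(2)[of m] qc[of m] unfolding vector_minus_component by linarith
        then have "(\<Sum>m\<in>(UNIV::'d set). h / 4) \<le> coord_sum (ctr cc - x)"
          unfolding coord_sum_def by (intro sum_mono)
        then show ?thesis by simp
      qed
      then have "a * (?d * (h / 4)) \<le> a * coord_sum (ctr cc - x)" using a by (intro mult_left_mono) auto
      also have "\<dots> \<le> F (ctr cc) - F x"
      proof (rule lo[OF xB cB])
        fix m show "x $ m \<le> ctr cc $ m" using xm(2)[of m] qc[of m] h0 by linarith
      qed
      finally have "F x < 0" using Fc key by linarith
      then show "x \<in> U" by (rule ins[OF xB])
    qed
    have highpart: "x \<notin> U" if x: "x \<in> cube (k + 2) (\<lambda>l. 4 * q l + 3)" for x
    proof -
      have xm: "(real (q m) + 1/2) * h + h / 4 \<le> x $ m" "x $ m \<le> real (q m) * h + h" for m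
      proof -
        have "real (4 * q m + 3) / (4 / h) \<le> x $ m" "x $ m < (real (4 * q m + 3) + 1) / (4 / h)"
          using x unfolding cube_def pow by blast+
        then show "(real (q m) + 1/2) * h + h / 4 \<le> x $ m" "x $ m \<le> real (q m) * h + h"
          using h0 by (simp_all add: field_simps)
      qed
      have xB: "x \<in> ?B" unfolding open_box_def
      proof (intro CollectI allI)
        fix m
        have "(real (q m) + 1/2) * h = real (q m) * h + h / 2" by (simp add: algebra_simps)
        then show "\<bar>x $ m - p $ m\<bar> < r" using xm[of m] qp[of m] hr h0 r by linarith
      qed
      have "?d * (h / 4) \<le> coord_sum (x - ctr cc)"
      proof -
        have "h / 4 \<le> (x - ctr cc) $ m" for m
          using xm(1)[of m] qc[of m] unfolding vector_minus_component by linarith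
        then have "(\<Sum>m\<in>(UNIV::'d set). h / 4) \<le> coord_sum (x - ctr cc)"
          unfolding coord_sum_def by (intro sum_mono)
        then show ?thesis by simp
      qed
      then have "a * (?d * (h / 4)) \<le> a * coord_sum (x - ctr cc)" using a by (intro mult_left_mono) auto
      also have "\<dots> \<le> F x - F (ctr cc)"
      proof (rule lo[OF cB xB])
        fix m show "ctr cc $ m \<le> x $ m" using xm(1)[of m] qc[of m] h0 by linarith
      qed
      finally have "0 < F x" using Fc key by linarith
      then show "x \<notin> U" by (rule out[OF xB])
    qed
    have "q m < 2 ^ k" for m
    proof -
      have "(real (q m) + 1/2) * h < p $ m + r" using cB qc[of m] by (auto simp: open_box_def abs_less_iff dest!: spec[of _ m])
      then have "(real (q m) + 1/2) * h < 1" using pr[of m] by linarith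
      then have "real (q m) + 1/2 < 2 ^ k" by (simp add: h pos_divide_less_eq)
      then have "real (q m) < 2 ^ k" by linarith
      then show ?thesis by (simp only: of_nat_less_numeral_power_cancel_iff)
    qed
    then have "q \<in> straddling U k" using lowpart highpart by (auto simp: straddling_def cells_def)
    then show ?thesis by (auto simp: q_def)
  qed
  have count: "(\<rho> / 2) ^ (CARD('d) - 1) * (2 ^ (CARD('d) - 1)) ^ k \<le> real (card (straddling U k))" if hk: "1 / 2 ^ k \<le> \<rho>" for k
  proof -
    define N where "N = nat \<lfloor>\<rho> * 2 ^ k\<rfloor>"
    have r1: "1 \<le> \<rho> * 2 ^ k" using hk by (simp add: field_simps)
    have N: "real N \<le> \<rho> * 2 ^ k" "\<rho> / 2 * 2 ^ k \<le> real N"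
    proof -
      have f: "1 \<le> \<lfloor>\<rho> * 2 ^ k\<rfloor>" using r1 by (simp add: le_floor_iff)
      then have e: "real N = real_of_int \<lfloor>\<rho> * 2 ^ k\<rfloor>" by (simp add: N_def)
      then show "real N \<le> \<rho> * 2 ^ k" by simp
      have "1 \<le> real N" "\<rho> * 2 ^ k < real N + 1" using e f by linarith+
      then show "\<rho> / 2 * 2 ^ k \<le> real N" by simp
    qed
    define base where "base m = nat \<lfloor>2 ^ k * p $ m\<rfloor>" for m
    have base: "real (base m) \<le> 2 ^ k * p $ m" "2 ^ k * p $ m < real (base m) + 1" for m
    proof -
      have "0 \<le> p $ m" using pr[of m] r by linarith
      then have "0 \<le> \<lfloor>2 ^ k * p $ m\<rfloor>" by simp
      then have "real (base m) = real_of_int \<lfloor>2 ^ k * p $ m\<rfloor>" by (simp add: base_def)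
      then show "real (base m) \<le> 2 ^ k * p $ m" "2 ^ k * p $ m < real (base m) + 1" by linarith+
    qed
    define C where "C = PiE (UNIV :: 'd set) (\<lambda>m. if m = l0 then {0} else {base m..<base m + N})"
    have mem: "c m \<in> (if m = l0 then {0} else {base m..<base m + N})" if "c \<in> C" for c m
      by (rule PiE_mem[OF that[unfolded C_def]]) simp
    have Cm1: "c l0 = 0" if "c \<in> C" for c using mem[OF that, of l0] by simp
    have Cm2: "base m \<le> c m \<and> c m < base m + N" if "c \<in> C" "m \<noteq> l0" for c m using mem[OF that(1), of m] that(2) by simp
    have "\<exists>j. c(l0 := j) \<in> straddling U k" if c: "c \<in> C" for c
    proof (rule column[OF refl hk])
      fix m assume m: "m \<noteq> l0"
      have "real (base m) \<le> real (c m)" "real (c m) + 1 \<le> real (base m) + real N"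
        using Cm2[OF c m] by (simp_all flip: of_nat_add of_nat_Suc)
      then have "\<bar>(real (c m) + 1/2) - 2 ^ k * p $ m\<bar> \<le> \<rho> * 2 ^ k"
        using base[of m] N(1) r1 by (simp add: abs_le_iff)
      moreover have "(real (c m) + 1/2) * (1 / 2 ^ k) - p $ m = ((real (c m) + 1/2) - 2 ^ k * p $ m) / 2 ^ k"
        by (simp add: field_simps)
      ultimately show "\<bar>(real (c m) + 1/2) * (1 / 2 ^ k) - p $ m\<bar> \<le> \<rho>" by (simp add: abs_divide pos_divide_le_eq)
    qed
    then obtain J where J: "\<And>c. c \<in> C \<Longrightarrow> c(l0 := J c) \<in> straddling U k" by metis
    have inj: "inj_on (\<lambda>c. c(l0 := J c)) C"
    proof (rule inj_onI)
      fix c c' assume cc: "c \<in> C" "c' \<in> C" "c(l0 := J c) = c'(l0 := J c')"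
      show "c = c'"
      proof
        fix m show "c m = c' m"
          using Cm1[OF cc(1)] Cm1[OF cc(2)] fun_cong[OF cc(3), of m] by (cases "m = l0") auto
      qed
    qed
    have finS: "finite (straddling U k)" by (rule finite_subset[of _ "cells k"]) (auto simp: straddling_def)
    have "card C \<le> card (straddling U k)" using inj J finS by (intro card_inj_on_le) auto
    moreover have "card C = N ^ (CARD('d) - 1)"
    proof -
      have "card C = (\<Prod>m\<in>(UNIV::'d set). if m = l0 then 1 else N)"
        unfolding C_def by (simp add: card_PiE if_distrib cong: if_cong)
      also have "\<dots> = (\<Prod>m\<in>UNIV - {l0}. N)" by (subst prod.remove[of UNIV l0]) (auto intro!: prod.cong)
      finally show ?thesis by (simp add: card_Diff_singleton)
    qed
    ultimately have "real N ^ (CARD('d) - 1) \<le> real (card (straddling U k))" by (simp flip: of_nat_power)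
    moreover have "(\<rho> / 2 * 2 ^ k) ^ (CARD('d) - 1) \<le> real N ^ (CARD('d) - 1)" using N(2) \<rho>(1) by (intro power_mono) auto
    moreover have "(\<rho> / 2 * 2 ^ k) ^ (CARD('d) - 1) = (\<rho> / 2) ^ (CARD('d) - 1) * (2 ^ (CARD('d) - 1)) ^ k"
      by (simp only: power_mult_distrib power_mult[symmetric] mult.commute)
    ultimately show ?thesis by linarith
  qed
  have "(\<lambda>k. (1/2 :: real) ^ k) \<longlonglongrightarrow> 0" by (intro LIMSEQ_power_zero) auto
  then have "\<forall>\<^sub>F k in sequentially. (1/2 :: real) ^ k < \<rho>" using \<rho>(1) by (rule order_tendstoD)
  then obtain k0 where "\<And>k. k0 \<le> k \<Longrightarrow> (1/2 :: real) ^ k < \<rho>" by (auto simp: eventually_sequentially)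
  then have "\<And>k. k0 \<le> k \<Longrightarrow> 1 / 2 ^ k \<le> \<rho>" by (simp add: power_divide less_imp_le)
  then show ?thesis using count \<rho>(1) by (intro exI[of _ "(\<rho> / 2) ^ (CARD('d) - 1)"] conjI exI[of _ k0]) auto
qed

section \<open>The number of points in a smooth domain\<close>

lemma level_weight_ge:
  assumes "2 \<le> \<theta>" "1 \<le> k" shows "real k \<le> level_weight \<theta> k"
proof -
  obtain j where k: "k = Suc j" using assms(2) by (cases k) auto
  have "real (Suc j) \<le> 2 ^ j" using less_exp[of j] by (metis Suc_leI of_nat_le_iff of_nat_numeral of_nat_power)
  also have "\<dots> \<le> \<theta> ^ j" using assms by (intro power_mono) auto
  also have "\<dots> = \<theta> ^ j * 1" by simp
  also have "\<dots> \<le> \<theta> ^ j * (\<theta> - 1)" using assms by (intro mult_left_mono) auto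
  also have "\<dots> = level_weight \<theta> k" by (simp add: k level_weight_def algebra_simps)
  finally show ?thesis by (simp add: k)
qed

lemma interaction_base_ge_2: "3 \<le> CARD('d::finite) \<Longrightarrow> (2::real) \<le> 2 ^ (CARD('d) - 2)"
  using power_increasing[of 1 "CARD('d) - 2" "2::real"] by simp

lemma hierarchical_gas_weights:
  assumes "3 \<le> CARD('d::finite)" "0 < \<beta>"
  shows "hierarchical_model (gas_weights TYPE('d) \<beta>) \<beta>"
proof
  show "0 < \<beta>" by fact
  note th = interaction_base_ge_2[OF assms(1)]
  show "0 \<le> \<beta> * level_weight (2 ^ (CARD('d) - 2)) k" for k
    using assms(2) th by (intro mult_nonneg_nonneg level_weight_nonneg) auto
  show "\<beta> \<le> \<beta> * level_weight (2 ^ (CARD('d) - 2)) k" if "1 \<le> k" for k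
  proof -
    have "1 \<le> level_weight (2 ^ (CARD('d) - 2) :: real) k" using level_weight_ge[OF th that] that by linarith
    then show ?thesis using assms(2) by simp
  qed
qed

lemma deep_weights:
  assumes "3 \<le> CARD('d::finite)" "0 < \<beta>"
  shows "\<exists>k1. \<forall>k>k1. exp (- gas_weights TYPE('d) \<beta> k / 2) \<le> 1/8"
proof (intro exI allI impI)
  fix k assume k: "nat \<lceil>2 * ln 8 / \<beta>\<rceil> < k"
  have "2 * ln 8 / \<beta> \<le> real k" using k by linarith
  also have "real k \<le> level_weight (2 ^ (CARD('d) - 2)) k"
    using k by (intro level_weight_ge interaction_base_ge_2 assms) auto
  finally have "ln 8 \<le> \<beta> * level_weight (2 ^ (CARD('d) - 2)) k / 2" using assms(2) by (simp add: field_simps)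
  then have "exp (- (\<beta> * level_weight (2 ^ (CARD('d) - 2)) k / 2)) \<le> exp (- ln 8)" by simp
  also have "\<dots> = 1/8" by (simp add: exp_minus)
  finally show "exp (- gas_weights TYPE('d) \<beta> k / 2) \<le> 1/8" by simp
qed

lemma inner_cells_subset: "inner_cells U K \<subseteq> cells K"
  by (auto simp: inner_cells_def)

lemma num_points_bounds: "0 \<le> num_points n U x" "num_points n U x \<le> real n"
proof -
  have "card {i. i < n \<and> x i \<in> U} \<le> card {..<n}" by (intro card_mono) auto
  then show "num_points n U x \<le> real n" by (simp add: num_points_def)
qed (simp add: num_points_def)

lemma num_points_gas_measurable:
  assumes "open U" shows "num_points n U \<in> borel_measurable (coulomb_gas n \<beta> :: (nat \<Rightarrow> real^'d::finite) measure)"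
  using num_points_measurable[OF assms] by (simp add: coulomb_gas_def)

text \<open>
  The discrete variance is at most the second moment about any point, and it converges to the variance
  under the gas.
\<close>

lemma gas_variance_le:
  fixes U :: "(real^'d::finite) set"
  assumes U: "open U" and \<beta>: "0 < \<beta>"
    and B: "\<And>K. \<exists>e. avg (gas_weights TYPE('d) \<beta>) K n (\<lambda>m. (inner_count U K m - e)\<^sup>2) \<le> B"
  shows "prob_space.variance (coulomb_gas n \<beta>) (num_points n U) \<le> B"
proof -
  let ?G = "coulomb_gas n \<beta> :: (nat \<Rightarrow> real^'d) measure"
  let ?avg = "avg (gas_weights TYPE('d) \<beta>)"
  interpret prob_space ?G by (rule prob_space_gas[OF \<beta>])
  have [measurable]: "num_points n U \<in> borel_measurable ?G" by (rule num_points_gas_measurable[OF U])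
  have "integrable ?G (num_points n U)"
    using num_points_bounds[of n U] by (intro integrable_const_bound[where B = "real n"]) auto
  moreover have "integrable ?G (\<lambda>x. (num_points n U x)\<^sup>2)"
    using num_points_bounds[of n U] by (intro integrable_const_bound[where B = "(real n)\<^sup>2"]) (auto intro!: AE_I2 power_mono)
  ultimately have var: "variance (num_points n U) = expectation (\<lambda>x. (num_points n U x)\<^sup>2) - (expectation (num_points n U))\<^sup>2"
    by (rule variance_eq)
  have lim: "(\<lambda>K. ?avg K n (\<lambda>m. (inner_count U K m)\<^sup>2) - (?avg K n (\<lambda>m. inner_count U K m))\<^sup>2) \<longlonglongrightarrow> variance (num_points n U)"
    unfolding var
    by (intro tendsto_diff tendsto_power gas_expectation_tendsto[OF U \<beta>, of "\<lambda>y. y\<^sup>2"] gas_expectation_tendsto[OF U \<beta>, of "\<lambda>y. y"]) auto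
  have "?avg K n (\<lambda>m. (inner_count U K m)\<^sup>2) - (?avg K n (\<lambda>m. inner_count U K m))\<^sup>2 \<le> B" for K
  proof -
    obtain e where e: "?avg K n (\<lambda>m. (inner_count U K m - e)\<^sup>2) \<le> B" using B by blast
    let ?X = "\<lambda>m. inner_count U K m"
    have "?avg K n (\<lambda>m. (?X m - e)\<^sup>2) = ?avg K n (\<lambda>m. (?X m)\<^sup>2 - (2 * e) * ?X m + e\<^sup>2)"
      by (intro avg_cong) (simp add: power2_diff)
    also have "\<dots> = ?avg K n (\<lambda>m. (?X m)\<^sup>2) - (2 * e) * ?avg K n ?X + e\<^sup>2"
      by (simp only: avg_add avg_diff avg_cmult avg_const)
    finally have "?avg K n (\<lambda>m. (?X m)\<^sup>2) - (?avg K n ?X)\<^sup>2 = ?avg K n (\<lambda>m. (?X m - e)\<^sup>2) - (?avg K n ?X - e)\<^sup>2"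
      by (simp add: power2_diff)
    then show ?thesis using e zero_le_power2[of "?avg K n ?X - e"] by linarith
  qed
  then show ?thesis by (intro LIMSEQ_le_const2[OF lim]) auto
qed

lemma gas_variance_upper:
  fixes U :: "(real^'d::finite) set"
  assumes d: "3 \<le> CARD('d)" and \<beta>: "0 < \<beta>" and U: "open U"
    and S: "smooth_hypersurface (frontier U)" "compact (frontier U)"
  shows "\<exists>C>0. \<forall>n\<ge>1. prob_space.variance (coulomb_gas n \<beta>) (num_points n U) \<le> C * real n powr ((real CARD('d) - 1) / real CARD('d))"
proof -
  interpret hierarchical_model "gas_weights TYPE('d) \<beta>" \<beta> by (rule hierarchical_gas_weights[OF d \<beta>])
  obtain T where T: "0 \<le> T" "\<And>k. real (card (touched k (frontier U))) \<le> T * (2 ^ (CARD('d) - 1)) ^ k"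
    using frontier_touched_bound[OF S(2,1)] by blast
  define C where "C = 3 * (2 ^ CARD('d))\<^sup>2 * unit_mean_bound (2 ^ CARD('d)) * T"
  have C0: "0 \<le> C" using T(1) sibling_bound_ge by (auto simp: C_def unit_mean_bound_def)
  have "prob_space.variance (coulomb_gas n \<beta>) (num_points n U) \<le> (C + 1) * real n powr ((real CARD('d) - 1) / real CARD('d))" if n: "1 \<le> n" for n
  proof -
    have "prob_space.variance (coulomb_gas n \<beta>) (num_points n U) \<le> C * real n powr ((real CARD('d) - 1) / real CARD('d))"
    proof (rule gas_variance_le[OF U \<beta>])
      fix K
      have mixed: "real (card (mixed (inner_cells U K) K k)) \<le> T * (2 ^ (CARD('d) - 1)) ^ k" if k: "k \<le> K" for k
      proof -
        have "mixed (inner_cells U K) K k \<subseteq> touched k (frontier U)"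
          using mixed_meets_frontier[OF _ k, of _ U] by (auto simp: touched_def mixed_def)
        then have "card (mixed (inner_cells U K) K k) \<le> card (touched k (frontier U))"
          by (intro card_mono) (auto simp: touched_def)
        then have "real (card (mixed (inner_cells U K) K k)) \<le> real (card (touched k (frontier U)))" by simp
        then show ?thesis using T(2)[of k] by linarith
      qed
      have "2 \<le> CARD('d)" using d by simp
      from surface_variance_bound[OF this inner_cells_subset n mixed T(1)]
      show "\<exists>e. avg (gas_weights TYPE('d) \<beta>) K n (\<lambda>m. (inner_count U K m - e)\<^sup>2) \<le> C * real n powr ((real CARD('d) - 1) / real CARD('d))"
        unfolding inner_count_def C_def by blast
    qed
    also have "\<dots> \<le> (C + 1) * real n powr ((real CARD('d) - 1) / real CARD('d))" by (intro mult_right_mono) auto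
    finally show ?thesis .
  qed
  then show ?thesis using C0 by (intro exI[of _ "C + 1"]) auto
qed

lemma inner_leaves:
  assumes q: "q \<in> straddling U k" and K: "k + 2 \<le> K"
  shows "leaves K (k + 2) (\<lambda>l. 4 * q l) \<subseteq> inner_cells U K" "leaves K (k + 2) (\<lambda>l. 4 * q l + 3) \<inter> inner_cells U K = {}"
proof -
  have sub: "cube K i \<subseteq> cube (k + 2) c" if "i \<in> leaves K (k + 2) c" for i c
    using cube_mono_anc[of i K "k + 2"] K that by (auto simp: leaves_def)
  show "leaves K (k + 2) (\<lambda>l. 4 * q l) \<subseteq> inner_cells U K"
    using sub q by (fastforce simp: inner_cells_def straddling_def leaves_def)
  show "leaves K (k + 2) (\<lambda>l. 4 * q l + 3) \<inter> inner_cells U K = {}"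
  proof (rule ccontr)
    assume "leaves K (k + 2) (\<lambda>l. 4 * q l + 3) \<inter> inner_cells U K \<noteq> {}"
    then obtain i where i: "i \<in> leaves K (k + 2) (\<lambda>l. 4 * q l + 3)" "cube K i \<subseteq> U" by (auto simp: inner_cells_def)
    then show False using sub[OF i(1)] q cube_nonempty[of K i] by (auto simp: straddling_def)
  qed
qed

text \<open>
  The number of straddling cells \<open>J\<close> levels below \<open>K0\<close> is of order \<open>n\<^sup>(\<^sup>d\<^sup>-\<^sup>1\<^sup>)\<^sup>/\<^sup>d\<close>, and \<open>K0\<close> exceeds any given level for
  large \<open>n\<close>.
\<close>

lemma gas_anticoncentration:
  fixes U :: "(real^'d::finite) set"
  assumes d: "3 \<le> CARD('d)" and \<beta>: "0 < \<beta>" and U: "open U" "U \<noteq> {}" "U \<subseteq> unit_cube"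
    and S: "smooth_hypersurface (frontier U)"
  shows "\<exists>c>0. \<exists>p<1. \<exists>n0. \<forall>n\<ge>n0. \<forall>a b. a \<le> b \<and> b - a \<le> c * real n powr ((real CARD('d) - 1) / (2 * real CARD('d))) \<longrightarrow>
     \<P>(x in coulomb_gas n \<beta>. a \<le> num_points n U x \<and> num_points n U x \<le> b) \<le> p"
proof -
  interpret hierarchical_model "gas_weights TYPE('d) \<beta>" \<beta> by (rule hierarchical_gas_weights[OF d \<beta>])
  let ?M = "2 ^ CARD('d) :: real"
  let ?x = "2 ^ (CARD('d) - 1) :: real"
  have M1: "1 < ?M" using d by simp
  obtain J where J: "2 * unit_mean_bound ?M \<le> ?M ^ J" using real_arch_pow[OF M1, of "2 * unit_mean_bound ?M"] less_imp_le by blast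
  obtain cs k0 where cs: "0 < cs" "\<And>k. k0 \<le> k \<Longrightarrow> cs * ?x ^ k \<le> real (card (straddling U k))"
    using many_straddling_cells[OF d U S] by blast
  obtain k1 where k1: "\<And>k. k1 < k \<Longrightarrow> exp (- gas_weights TYPE('d) \<beta> k / 2) \<le> 1/8"
    using deep_weights[OF d \<beta>] by blast
  define p1 where "p1 = 1 / (2 * ?M ^ J * ?M\<^sup>2)"
  have p1: "0 < p1" by (simp add: p1_def)
  define c where "c = sqrt (p1 / 8 * cs / ?x)"
  have c: "0 < c" "c\<^sup>2 = p1 / 8 * cs / ?x" using p1 cs by (simp_all add: c_def)
  define n0 where "n0 = ((2::nat) ^ CARD('d)) ^ (max k0 k1)"
  let ?\<alpha> = "(real CARD('d) - 1) / real CARD('d)"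
  have main: "\<P>(x in coulomb_gas n \<beta>. a \<le> num_points n U x \<and> num_points n U x \<le> b) \<le> 1 - p1 / 96"
    if n: "n0 \<le> n" and ab: "a \<le> b" "b - a \<le> c * real n powr ((real CARD('d) - 1) / (2 * real CARD('d)))" for n and a b :: real
  proof -
    let ?G = "coulomb_gas n \<beta> :: (nat \<Rightarrow> real^'d) measure"
    have n1: "1 \<le> n" using n unfolding n0_def by (meson one_le_numeral one_le_power order_trans)
    have M2: "2 \<le> (2::nat) ^ CARD('d)" using power_increasing[of 1 "CARD('d)" "2::nat"] d by simp
    obtain K0 where K0: "(2 ^ CARD('d)) ^ K0 \<le> n" "n < (2 ^ CARD('d)) ^ Suc K0"
      using ex_power_ivl1[OF M2 n1] by auto
    have K0k: "max k0 k1 \<le> K0"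
    proof (rule ccontr)
      assume "\<not> max k0 k1 \<le> K0"
      then have "((2::nat) ^ CARD('d)) ^ Suc K0 \<le> n0" unfolding n0_def by (intro power_increasing) auto
      then show False using K0(2) n by linarith
    qed
    let ?Gd = "straddling U (K0 + J)"
    have cardG: "cs / ?x * real n powr ?\<alpha> \<le> real (card ?Gd)"
    proof -
      have "real n \<le> ?M ^ Suc K0"
      proof -
        have "real n \<le> real (((2::nat) ^ CARD('d)) ^ Suc K0)" using K0(2) by (simp only: of_nat_le_iff)
        then show ?thesis by (simp only: of_nat_power of_nat_numeral)
      qed
      then have "real n powr ?\<alpha> \<le> (?M ^ Suc K0) powr ?\<alpha>" using d by (intro powr_mono2) auto
      also have "\<dots> = ?x ^ Suc K0"
      proof -
        have "?M ^ Suc K0 = 2 powr real (CARD('d) * Suc K0)"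
          by (simp only: powr_realpow[OF zero_less_numeral] power_mult)
        moreover have "?x ^ Suc K0 = 2 powr real ((CARD('d) - 1) * Suc K0)"
          by (simp only: powr_realpow[OF zero_less_numeral] power_mult)
        moreover have "real ((CARD('d) - 1) * k) = real (CARD('d) * k) * ?\<alpha>" for k
          using d by (simp add: of_nat_diff)
        ultimately show ?thesis by (simp only: powr_powr)
      qed
      finally have "cs / ?x * real n powr ?\<alpha> \<le> cs / ?x * ?x ^ Suc K0" using cs by (intro mult_left_mono) auto
      also have "\<dots> = cs * ?x ^ K0" by simp
      also have "\<dots> \<le> cs * ?x ^ (K0 + J)" using cs by (intro mult_left_mono power_increasing) auto
      also have "\<dots> \<le> real (card ?Gd)" using K0k by (intro cs(2)) auto
      finally show ?thesis .
    qed
    have "0 < cs / ?x * real n powr ?\<alpha>" using cs n1 by simp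
    then have Gne: "?Gd \<noteq> {}" using cardG by (intro notI) simp
    have width: "(b - a)\<^sup>2 \<le> p1 / 8 * real (card ?Gd)"
    proof -
      have "(b - a)\<^sup>2 \<le> (c * real n powr ((real CARD('d) - 1) / (2 * real CARD('d))))\<^sup>2" using ab by (intro power_mono) auto
      also have "\<dots> = c\<^sup>2 * real n powr ?\<alpha>"
      proof -
        have "(real n powr ((real CARD('d) - 1) / (2 * real CARD('d))))\<^sup>2 = real n powr ((real CARD('d) - 1) / (2 * real CARD('d)) + (real CARD('d) - 1) / (2 * real CARD('d)))"
          by (simp only: power2_eq_square powr_add)
        also have "(real CARD('d) - 1) / (2 * real CARD('d)) + (real CARD('d) - 1) / (2 * real CARD('d)) = ?\<alpha>" by (simp add: field_simps)
        finally show ?thesis by (simp add: power_mult_distrib)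
      qed
      also have "\<dots> = p1 / 8 * (cs / ?x * real n powr ?\<alpha>)" by (simp add: c(2))
      also have "\<dots> \<le> p1 / 8 * real (card ?Gd)" using p1 cardG by (intro mult_left_mono) auto
      finally show ?thesis .
    qed
    let ?I = "indicator {a..b} :: real \<Rightarrow> real"
    have lim: "(\<lambda>K. avg (gas_weights TYPE('d) \<beta>) K n (\<lambda>m. ?I (inner_count U K m))) \<longlonglongrightarrow> (\<integral>x. ?I (num_points n U x) \<partial>?G)"
      by (rule gas_expectation_tendsto[OF U(1) \<beta>]) simp
    have "avg (gas_weights TYPE('d) \<beta>) K n (\<lambda>m. ?I (inner_count U K m)) \<le> 1 - p1 / 96" if K: "K0 + J + 2 \<le> K" for K
    proof -
      have "avg (gas_weights TYPE('d) \<beta>) K n (\<lambda>m. if a \<le> (\<Sum>i\<in>inner_cells U K. real (m i)) \<and> (\<Sum>i\<in>inner_cells U K. real (m i)) \<le> b then 1 else 0) \<le> 1 - p1 / 96"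
      proof (rule anticoncentration[OF J _ K0 K inner_cells_subset _ Gne _ _ p1_def ab(1) width])
        show "exp (- gas_weights TYPE('d) \<beta> k / 2) \<le> 1/8" if "K0 < k" for k using K0k that by (intro k1) auto
        show "?Gd \<subseteq> cells (K0 + J)" by (auto simp: straddling_def)
        show "leaves K (K0 + J + 2) (\<lambda>l. 4 * q l) \<subseteq> inner_cells U K" if "q \<in> ?Gd" for q by (rule inner_leaves(1)[OF that K])
        show "leaves K (K0 + J + 2) (\<lambda>l. 4 * q l + 3) \<inter> inner_cells U K = {}" if "q \<in> ?Gd" for q by (rule inner_leaves(2)[OF that K])
      qed
      then show ?thesis by (simp add: inner_count_def indicator_def of_bool_def)
    qed
    then have "(\<integral>x. ?I (num_points n U x) \<partial>?G) \<le> 1 - p1 / 96" by (intro LIMSEQ_le_const2[OF lim]) auto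
    moreover have "(\<integral>x. ?I (num_points n U x) \<partial>?G) = \<P>(x in ?G. a \<le> num_points n U x \<and> num_points n U x \<le> b)"
    proof -
      have [measurable]: "num_points n U \<in> borel_measurable ?G" by (rule num_points_gas_measurable[OF U(1)])
      let ?E = "{x \<in> space ?G. a \<le> num_points n U x \<and> num_points n U x \<le> b}"
      have "(\<integral>x. ?I (num_points n U x) \<partial>?G) = (\<integral>x. indicator ?E x \<partial>?G)"
        by (intro Bochner_Integration.integral_cong refl) (auto simp: indicator_def)
      also have "\<dots> = measure ?G ?E" by (simp add: Int_absorb2)
      finally show ?thesis .
    qed
    ultimately show ?thesis by simp
  qed
  show ?thesis
    using c(1) p1 main by (intro exI[of _ c] conjI exI[of _ "1 - p1 / 96"] exI[of _ n0]) auto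
qed

text \<open>
  Anti-concentration is applied to the interval of length \<open>w\<close> centred at the mean.
\<close>

lemma gas_variance_lower:
  fixes U :: "(real^'d::finite) set"
  assumes \<beta>: "0 < \<beta>" and U: "open U" and w: "0 \<le> w"
    and anti: "\<And>a b. a \<le> b \<Longrightarrow> b - a \<le> w \<Longrightarrow> \<P>(x in coulomb_gas n \<beta>. a \<le> num_points n U x \<and> num_points n U x \<le> b) \<le> p"
  shows "(1 - p) / 4 * w\<^sup>2 \<le> prob_space.variance (coulomb_gas n \<beta>) (num_points n U)"
proof -
  let ?G = "coulomb_gas n \<beta> :: (nat \<Rightarrow> real^'d) measure"
  let ?N = "num_points n U :: (nat \<Rightarrow> real^'d) \<Rightarrow> real"
  interpret prob_space ?G by (rule prob_space_gas[OF \<beta>])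
  have [measurable]: "?N \<in> borel_measurable ?G" by (rule num_points_gas_measurable[OF U])
  define \<mu> where "\<mu> = expectation ?N"
  let ?E = "{x \<in> space ?G. \<mu> - w / 2 \<le> ?N x \<and> ?N x \<le> \<mu> + w / 2}"
  have E: "prob ?E \<le> p" by (rule anti) (use w in auto)
  have int: "integrable ?G (\<lambda>x. (?N x - \<mu>)\<^sup>2)"
  proof (rule integrable_const_bound[where B = "(real n + \<bar>\<mu>\<bar>)\<^sup>2"])
    show "AE x in ?G. norm ((?N x - \<mu>)\<^sup>2) \<le> (real n + \<bar>\<mu>\<bar>)\<^sup>2"
    proof (rule AE_I2)
      fix x
      have "\<bar>?N x - \<mu>\<bar> \<le> real n + \<bar>\<mu>\<bar>" using num_points_bounds[of n U x] by linarith
      then have "\<bar>?N x - \<mu>\<bar>\<^sup>2 \<le> (real n + \<bar>\<mu>\<bar>)\<^sup>2" by (intro power_mono) auto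
      then show "norm ((?N x - \<mu>)\<^sup>2) \<le> (real n + \<bar>\<mu>\<bar>)\<^sup>2" by simp
    qed
  qed simp
  have "(w / 2)\<^sup>2 * (1 - prob ?E) = expectation (\<lambda>x. (w / 2)\<^sup>2 * (1 - indicator ?E x))"
  proof -
    have "expectation (\<lambda>x. 1 - indicator ?E x) = 1 - prob ?E"
      by (subst Bochner_Integration.integral_diff) (auto simp: prob_space Int_absorb2 less_top[symmetric])
    then show ?thesis by simp
  qed
  also have "\<dots> \<le> expectation (\<lambda>x. (?N x - \<mu>)\<^sup>2)"
  proof (rule integral_mono[OF _ int])
    fix x assume x: "x \<in> space ?G"
    show "(w / 2)\<^sup>2 * (1 - indicator ?E x) \<le> (?N x - \<mu>)\<^sup>2"
    proof (cases "x \<in> ?E")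
      case False
      then have "\<not> (\<mu> - w / 2 \<le> ?N x \<and> ?N x \<le> \<mu> + w / 2)" using x by blast
      then have "w / 2 \<le> \<bar>?N x - \<mu>\<bar>" by linarith
      then have "(w / 2)\<^sup>2 \<le> \<bar>?N x - \<mu>\<bar>\<^sup>2" using w by (intro power_mono) auto
      then show ?thesis using False by simp
    qed simp
  next
    show "integrable ?G (\<lambda>x. (w / 2)\<^sup>2 * (1 - indicator ?E x))"
      by (intro integrable_mult_right Bochner_Integration.integrable_diff integrable_const integrable_real_indicator)
         (auto simp: less_top[symmetric])
  qed
  finally have "(w / 2)\<^sup>2 * (1 - prob ?E) \<le> variance ?N" by (simp add: \<mu>_def)
  moreover have "(w / 2)\<^sup>2 * (1 - p) \<le> (w / 2)\<^sup>2 * (1 - prob ?E)" using E by (intro mult_left_mono) auto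
  ultimately show ?thesis by (simp add: power_divide mult.commute)
qed

theorem theorem1:
  fixes U :: "(real^'d) set" and \<beta> :: real
  assumes "CARD('d) \<ge> 3" and "\<beta> > 0"
    and "U \<noteq> {}" and "connected U" and "open U" and "U \<subseteq> unit_cube"
    and "smooth_hypersurface (frontier U)" and "compact (frontier U)"
    and "orientable_hypersurface (frontier U)"
  shows
    "(\<exists>C c. C > 0 \<and> c > 0 \<and>
       (\<forall>\<^sub>F n in sequentially.
          c * real n powr ((real CARD('d) - 1) / real CARD('d))
            \<le> prob_space.variance (coulomb_gas n \<beta>) (num_points n U) \<and>
          prob_space.variance (coulomb_gas n \<beta>) (num_points n U)
            \<le> C * real n powr ((real CARD('d) - 1) / real CARD('d)) * ln (real n) ^ 13)) \<and>
     (\<exists>c p. c > 0 \<and> p < 1 \<and>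
       (\<forall>\<^sub>F n in sequentially. \<forall>a b :: real.
          a \<le> b \<and> b - a \<le> c * real n powr ((real CARD('d) - 1) / (2 * real CARD('d))) \<longrightarrow>
          \<P>(x in coulomb_gas n \<beta>. a \<le> num_points n U x \<and> num_points n U x \<le> b) \<le> p))"
proof -
  let ?\<alpha> = "(real CARD('d) - 1) / real CARD('d)"
  let ?h = "(real CARD('d) - 1) / (2 * real CARD('d))"
  obtain c p n0 where c: "0 < c" and p: "p < 1"
    and anti: "\<forall>n\<ge>n0. \<forall>a b. a \<le> b \<and> b - a \<le> c * real n powr ?h \<longrightarrow>
     \<P>(x in coulomb_gas n \<beta>. a \<le> num_points n U x \<and> num_points n U x \<le> b) \<le> p"
    using gas_anticoncentration[OF assms(1,2,5,3,6,7)] by blast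
  obtain C where C: "0 < C" and upper: "\<forall>n\<ge>1. prob_space.variance (coulomb_gas n \<beta>) (num_points n U) \<le> C * real n powr ?\<alpha>"
    using gas_variance_upper[OF assms(1,2,5,7,8)] by blast
  define c' where "c' = (1 - p) / 4 * c\<^sup>2"
  have c': "0 < c'" using c p by (simp add: c'_def)
  have lower: "c' * real n powr ?\<alpha> \<le> prob_space.variance (coulomb_gas n \<beta>) (num_points n U)" if "n0 \<le> n" for n
  proof -
    have "(1 - p) / 4 * (c * real n powr ?h)\<^sup>2 \<le> prob_space.variance (coulomb_gas n \<beta>) (num_points n U)"
      by (rule gas_variance_lower[OF assms(2,5)]) (use c anti that in auto)
    moreover have "(real n powr ?h)\<^sup>2 = real n powr ?\<alpha>"
    proof -
      have "(real n powr ?h)\<^sup>2 = real n powr (?h + ?h)" by (simp only: power2_eq_square powr_add)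
      also have "?h + ?h = ?\<alpha>" by (simp add: field_simps)
      finally show ?thesis .
    qed
    ultimately show ?thesis by (simp add: c'_def power_mult_distrib)
  qed
  have "c' * real n powr ?\<alpha> \<le> prob_space.variance (coulomb_gas n \<beta>) (num_points n U) \<and>
        prob_space.variance (coulomb_gas n \<beta>) (num_points n U) \<le> C * real n powr ?\<alpha> * ln (real n) ^ 13"
    if n: "max n0 3 \<le> n" for n
  proof
    show "c' * real n powr ?\<alpha> \<le> prob_space.variance (coulomb_gas n \<beta>) (num_points n U)" using lower n by simp
    have "exp 1 \<le> real n" using exp_le n by simp
    then have "1 \<le> ln (real n)" using n by (simp add: ln_ge_iff)
    then have "1 \<le> ln (real n) ^ 13" by (rule one_le_power)
    then have "C * real n powr ?\<alpha> * 1 \<le> C * real n powr ?\<alpha> * ln (real n) ^ 13"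
      using C by (intro mult_left_mono) auto
    moreover have "prob_space.variance (coulomb_gas n \<beta>) (num_points n U) \<le> C * real n powr ?\<alpha>" using upper n by simp
    ultimately show "prob_space.variance (coulomb_gas n \<beta>) (num_points n U) \<le> C * real n powr ?\<alpha> * ln (real n) ^ 13"
      by linarith
  qed
  then have "\<forall>\<^sub>F n in sequentially. c' * real n powr ?\<alpha> \<le> prob_space.variance (coulomb_gas n \<beta>) (num_points n U) \<and>
        prob_space.variance (coulomb_gas n \<beta>) (num_points n U) \<le> C * real n powr ?\<alpha> * ln (real n) ^ 13"
    unfolding eventually_sequentially by blast
  moreover have "\<forall>\<^sub>F n in sequentially. \<forall>a b :: real. a \<le> b \<and> b - a \<le> c * real n powr ?h \<longrightarrow>
          \<P>(x in coulomb_gas n \<beta>. a \<le> num_points n U x \<and> num_points n U x \<le> b) \<le> p"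
    using anti by (auto simp: eventually_sequentially)
  ultimately show ?thesis using C c' c p by blast
qed

end
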